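(* Let $F,G\colon(\mathbb{R}_{\ge 0})^n\to\mathcal{M}$ be functors to a good model category. For all positive integers $k$, $$d^{\Lambda}_H(T_kF,T_kG)\le d^{\Lambda}_H(F,G)$$ and $$d^{\Lambda}_H(T_kF,T_kG)\le d^{\Lambda}_H(T_{k+1}F,T_{k+1}G).$$
   Context: $\mathbb{R}_{\ge 0}$ is the totally ordered set of nonnegative reals and $P=(\mathbb{R}_{\ge 0})^n$ has the product order, viewed as a category. A model category $\mathcal{M}$ is good if $\operatorname{Fun}(P,\mathcal{M})$ admits the projective model structure for every poset $P$. Let $P_{\le k}\subseteq P$ be the subposet of elements with at most $k$ nonzero coordinates (these are the elements of join-dimension $\le k$). The codegree $k$ approximation $T_kF$ of $F\colon P\to\mathcal{M}$ is the homotopy left Kan extension of $F|_{P_{\le k}}$ along the inclusion $P_{\le k}\hookrightarrow P$; on objects $T_kF(x)=\operatorname{hocolim}_{v\in P_{\le k},\,v\le x}F(v)$. For $\varepsilon\in[0,\infty)$ let $\Lambda_\varepsilon\colon P\to P$ be the functor $\Lambda_\varepsilon(v_1,\dots,v_n)=(e^{\varepsilon}v_1,\dots,e^{\varepsilon}v_n)$. A $\Lambda_\varepsilon$-interleaving between functors $F',G'\colon P\to\mathcal{M}$ is a pair of natural transformations $\phi\colon F'\to G'\circ\Lambda_\varepsilon$, $\psi\colon G'\to F'\circ\Lambda_\varepsilon$ such that for all $x\in P$, $\psi_{\Lambda_\varepsilon(x)}\circ\phi_x=F'(x\le\Lambda_\varepsilon^2(x))$ and $\phi_{\Lambda_\varepsilon(x)}\circ\psi_x=G'(x\le\Lambda_\varepsilon^2(x))$.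 Functors $F,G$ are $\Lambda_\varepsilon$-homotopy-interleaved if there exist $F'\simeq F$ and $G'\simeq G$ (connected by zigzags of objectwise weak equivalences in $\operatorname{Fun}(P,\mathcal{M})$) such that $F'$ and $G'$ are $\Lambda_\varepsilon$-interleaved. The multiplicative interleaving distance is $d^{\Lambda}_H(F,G)=\inf\{\varepsilon\in[0,\infty): F,G\text{ are }\Lambda_\varepsilon\text{-homotopy-interleaved}\}$ (with $\inf\emptyset=\infty$). *)

theory Defs
  imports "HOL-Analysis.Analysis"
begin

section \<open>Categories, functors and functor categories\<close>

text \<open>A category is given by carrier sets of objects and arrows inside two types; hom-sets are
  disjoint because every arrow determines its domain and codomain. \<open>Comp C g f\<close> is \<open>g\<close> after
  \<open>f\<close> and is only meaningful for composable arrows of \<open>C\<close>.\<close>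

record ('o, 'a) cat =
  Obj :: "'o set"
  Arr :: "'a set"
  Dom :: "'a \<Rightarrow> 'o"
  Cod :: "'a \<Rightarrow> 'o"
  Ident :: "'o \<Rightarrow> 'a"
  Comp :: "'a \<Rightarrow> 'a \<Rightarrow> 'a"

definition hom :: "('o, 'a) cat \<Rightarrow> 'o \<Rightarrow> 'o \<Rightarrow> 'a set" where
  "hom C x y = {f \<in> Arr C. Dom C f = x \<and> Cod C f = y}"

definition category :: "('o, 'a) cat \<Rightarrow> bool" where
  "category C \<longleftrightarrow>
     (\<forall>f\<in>Arr C. Dom C f \<in> Obj C \<and> Cod C f \<in> Obj C) \<and>
     (\<forall>x\<in>Obj C. Ident C x \<in> hom C x x) \<and>
     (\<forall>f\<in>Arr C. \<forall>g\<in>Arr C. Cod C f = Dom C g \<longrightarrow> Comp C g f \<in> hom C (Dom C f) (Cod C g)) \<and>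
     (\<forall>f\<in>Arr C. Comp C f (Ident C (Dom C f)) = f \<and> Comp C (Ident C (Cod C f)) f = f) \<and>
     (\<forall>f\<in>Arr C. \<forall>g\<in>Arr C. \<forall>h\<in>Arr C. Cod C f = Dom C g \<longrightarrow> Cod C g = Dom C h \<longrightarrow>
        Comp C h (Comp C g f) = Comp C (Comp C h g) f)"

record ('o, 'a, 'p, 'b) ftor =
  fobj :: "'o \<Rightarrow> 'p"
  farr :: "'a \<Rightarrow> 'b"

definition is_functor :: "('o, 'a) cat \<Rightarrow> ('p, 'b) cat \<Rightarrow> ('o, 'a, 'p, 'b) ftor \<Rightarrow> bool" where
  "is_functor C D F \<longleftrightarrow>
     (\<forall>x\<in>Obj C. fobj F x \<in> Obj D) \<and>
     (\<forall>f\<in>Arr C. farr F f \<in> hom D (fobj F (Dom C f)) (fobj F (Cod C f))) \<and>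
     (\<forall>x\<in>Obj C. farr F (Ident C x) = Ident D (fobj F x)) \<and>
     (\<forall>f\<in>Arr C. \<forall>g\<in>Arr C. Cod C f = Dom C g \<longrightarrow>
        farr F (Comp C g f) = Comp D (farr F g) (farr F f))"

text \<open>In the functor category the two maps of a functor, and the components of a natural
  transformation, take the value \<^const>\<open>undefined\<close> outside the carriers of the source, so that
  equality of functors and of natural transformations is the intended one.\<close>

definition functors :: "('o, 'a) cat \<Rightarrow> ('p, 'b) cat \<Rightarrow> ('o, 'a, 'p, 'b) ftor set" where
  "functors C D =
     {F. is_functor C D F \<and> fobj F \<in> extensional (Obj C) \<and> farr F \<in> extensional (Arr C)}"

record ('o, 'a, 'p, 'b) ntrans =
  nsrc :: "('o, 'a, 'p, 'b) ftor"
  ntgt :: "('o, 'a, 'p, 'b) ftor"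
  ncomp :: "'o \<Rightarrow> 'b"

definition ntranses :: "('o, 'a) cat \<Rightarrow> ('p, 'b) cat \<Rightarrow> ('o, 'a, 'p, 'b) ntrans set" where
  "ntranses C D =
     {t. nsrc t \<in> functors C D \<and> ntgt t \<in> functors C D \<and> ncomp t \<in> extensional (Obj C) \<and>
         (\<forall>x\<in>Obj C. ncomp t x \<in> hom D (fobj (nsrc t) x) (fobj (ntgt t) x)) \<and>
         (\<forall>f\<in>Arr C. Comp D (ncomp t (Cod C f)) (farr (nsrc t) f)
                  = Comp D (farr (ntgt t) f) (ncomp t (Dom C f)))}"

definition Fun ::
    "('o, 'a) cat \<Rightarrow> ('p, 'b) cat \<Rightarrow> (('o, 'a, 'p, 'b) ftor, ('o, 'a, 'p, 'b) ntrans) cat" where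
  "Fun C D =
     \<lparr> Obj = functors C D,
       Arr = ntranses C D,
       Dom = nsrc,
       Cod = ntgt,
       Ident = (\<lambda>F. \<lparr> nsrc = F, ntgt = F, ncomp = (\<lambda>x\<in>Obj C. Ident D (fobj F x)) \<rparr>),
       Comp = (\<lambda>t s. \<lparr> nsrc = nsrc s, ntgt = ntgt t,
                        ncomp = (\<lambda>x\<in>Obj C. Comp D (ncomp t x) (ncomp s x)) \<rparr>) \<rparr>"

text \<open>\<open>precomp C G u\<close> is the composite functor \<open>G \<circ> u\<close>, and \<open>whisker C t u\<close> the transformation
  \<open>t u : G \<circ> u \<rightarrow> H \<circ> u\<close> for \<open>t : G \<rightarrow> H\<close>, where \<open>C\<close> is the source category of \<open>u\<close>.\<close>

definition precomp ::
    "('o, 'a) cat \<Rightarrow> ('q, 'c, 'p, 'b) ftor \<Rightarrow> ('o, 'a, 'q, 'c) ftor \<Rightarrow> ('o, 'a, 'p, 'b) ftor" where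
  "precomp C G u = \<lparr> fobj = compose (Obj C) (fobj G) (fobj u),
                     farr = compose (Arr C) (farr G) (farr u) \<rparr>"

definition whisker ::
    "('o, 'a) cat \<Rightarrow> ('q, 'c, 'p, 'b) ntrans \<Rightarrow> ('o, 'a, 'q, 'c) ftor \<Rightarrow> ('o, 'a, 'p, 'b) ntrans" where
  "whisker C t u = \<lparr> nsrc = precomp C (nsrc t) u, ntgt = precomp C (ntgt t) u,
                     ncomp = compose (Obj C) (ncomp t) (fobj u) \<rparr>"

section \<open>Limits and colimits\<close>

definition is_cocone ::
    "('i, 'j) cat \<Rightarrow> ('o, 'a) cat \<Rightarrow> ('i, 'j, 'o, 'a) ftor \<Rightarrow> 'o \<Rightarrow> ('i \<Rightarrow> 'a) \<Rightarrow> bool" where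
  "is_cocone J C D c \<kappa> \<longleftrightarrow> c \<in> Obj C \<and>
     (\<forall>j\<in>Obj J. \<kappa> j \<in> hom C (fobj D j) c) \<and>
     (\<forall>u\<in>Arr J. Comp C (\<kappa> (Cod J u)) (farr D u) = \<kappa> (Dom J u))"

definition is_colimit ::
    "('i, 'j) cat \<Rightarrow> ('o, 'a) cat \<Rightarrow> ('i, 'j, 'o, 'a) ftor \<Rightarrow> 'o \<Rightarrow> ('i \<Rightarrow> 'a) \<Rightarrow> bool" where
  "is_colimit J C D c \<kappa> \<longleftrightarrow> is_cocone J C D c \<kappa> \<and>
     (\<forall>c' \<kappa>'. is_cocone J C D c' \<kappa>' \<longrightarrow>
        (\<exists>!h. h \<in> hom C c c' \<and> (\<forall>j\<in>Obj J. Comp C h (\<kappa> j) = \<kappa>' j)))"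

definition is_cone ::
    "('i, 'j) cat \<Rightarrow> ('o, 'a) cat \<Rightarrow> ('i, 'j, 'o, 'a) ftor \<Rightarrow> 'o \<Rightarrow> ('i \<Rightarrow> 'a) \<Rightarrow> bool" where
  "is_cone J C D l \<pi> \<longleftrightarrow> l \<in> Obj C \<and>
     (\<forall>j\<in>Obj J. \<pi> j \<in> hom C l (fobj D j)) \<and>
     (\<forall>u\<in>Arr J. Comp C (farr D u) (\<pi> (Dom J u)) = \<pi> (Cod J u))"

definition is_limit ::
    "('i, 'j) cat \<Rightarrow> ('o, 'a) cat \<Rightarrow> ('i, 'j, 'o, 'a) ftor \<Rightarrow> 'o \<Rightarrow> ('i \<Rightarrow> 'a) \<Rightarrow> bool" where
  "is_limit J C D l \<pi> \<longleftrightarrow> is_cone J C D l \<pi> \<and>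
     (\<forall>l' \<pi>'. is_cone J C D l' \<pi>' \<longrightarrow>
        (\<exists>!h. h \<in> hom C l' l \<and> (\<forall>j\<in>Obj J. Comp C (\<pi> j) h = \<pi>' j)))"

text \<open>Size convention: the subsets of a type \<open>'u\<close> play the role of the small sets. A small
  category is one whose objects and arrows are drawn from \<open>'u\<close>, and a small poset one whose
  carrier is a subset of \<open>'u\<close>. The type \<open>'u\<close> is passed around as \<open>TYPE('u)\<close>.\<close>

definition bicomplete :: "'u itself \<Rightarrow> ('o, 'a) cat \<Rightarrow> bool" where
  "bicomplete U C \<longleftrightarrow>
     (\<forall>(J :: ('u, 'u) cat) D. category J \<longrightarrow> is_functor J C D \<longrightarrow>
        (\<exists>l \<pi>. is_limit J C D l \<pi>) \<and> (\<exists>c \<kappa>. is_colimit J C D c \<kappa>))"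

definition is_initial :: "('o, 'a) cat \<Rightarrow> 'o \<Rightarrow> bool" where
  "is_initial C z \<longleftrightarrow> z \<in> Obj C \<and> (\<forall>x\<in>Obj C. \<exists>!f. f \<in> hom C z x)"

section \<open>Model categories\<close>

record 'a model_structure =
  Weq :: "'a set"
  Cofib :: "'a set"
  Fib :: "'a set"

definition wide_subcategory :: "('o, 'a) cat \<Rightarrow> 'a set \<Rightarrow> bool" where
  "wide_subcategory C W \<longleftrightarrow> W \<subseteq> Arr C \<and> (\<forall>x\<in>Obj C. Ident C x \<in> W) \<and>
     (\<forall>f\<in>W. \<forall>g\<in>W. Cod C f = Dom C g \<longrightarrow> Comp C g f \<in> W)"

definition two_out_of_three :: "('o, 'a) cat \<Rightarrow> 'a set \<Rightarrow> bool" where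
  "two_out_of_three C W \<longleftrightarrow>
     (\<forall>f\<in>Arr C. \<forall>g\<in>Arr C. Cod C f = Dom C g \<longrightarrow>
        (f \<in> W \<and> g \<in> W \<longrightarrow> Comp C g f \<in> W) \<and>
        (f \<in> W \<and> Comp C g f \<in> W \<longrightarrow> g \<in> W) \<and>
        (g \<in> W \<and> Comp C g f \<in> W \<longrightarrow> f \<in> W))"

definition is_retract :: "('o, 'a) cat \<Rightarrow> 'a \<Rightarrow> 'a \<Rightarrow> bool" where
  "is_retract C f g \<longleftrightarrow>
     (\<exists>i\<in>hom C (Dom C f) (Dom C g). \<exists>r\<in>hom C (Dom C g) (Dom C f).
      \<exists>j\<in>hom C (Cod C f) (Cod C g). \<exists>s\<in>hom C (Cod C g) (Cod C f).
        Comp C r i = Ident C (Dom C f) \<and> Comp C s j = Ident C (Cod C f) \<and>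
        Comp C g i = Comp C j f \<and> Comp C f r = Comp C s g)"

definition closed_under_retracts :: "('o, 'a) cat \<Rightarrow> 'a set \<Rightarrow> bool" where
  "closed_under_retracts C W \<longleftrightarrow> (\<forall>f\<in>Arr C. \<forall>g\<in>W. is_retract C f g \<longrightarrow> f \<in> W)"

definition has_lifting :: "('o, 'a) cat \<Rightarrow> 'a \<Rightarrow> 'a \<Rightarrow> bool" where
  "has_lifting C i p \<longleftrightarrow>
     (\<forall>u\<in>hom C (Dom C i) (Dom C p). \<forall>v\<in>hom C (Cod C i) (Cod C p). Comp C p u = Comp C v i \<longrightarrow>
        (\<exists>h\<in>hom C (Cod C i) (Dom C p). Comp C h i = u \<and> Comp C p h = v))"

definition factors_through :: "('o, 'a) cat \<Rightarrow> 'a set \<Rightarrow> 'a set \<Rightarrow> bool" where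
  "factors_through C L R \<longleftrightarrow>
     (\<forall>f\<in>Arr C. \<exists>i\<in>L. \<exists>p\<in>R. Cod C i = Dom C p \<and> Comp C p i = f)"

text \<open>Factorizations are not required to be functorial.\<close>

definition model_category ::
    "'u itself \<Rightarrow> ('o, 'a) cat \<Rightarrow> 'a model_structure \<Rightarrow> bool" where
  "model_category U C S \<longleftrightarrow>
     category C \<and> bicomplete U C \<and>
     wide_subcategory C (Weq S) \<and> wide_subcategory C (Cofib S) \<and> wide_subcategory C (Fib S) \<and>
     two_out_of_three C (Weq S) \<and>
     closed_under_retracts C (Weq S) \<and>
     closed_under_retracts C (Cofib S) \<and>
     closed_under_retracts C (Fib S) \<and>
     (\<forall>i\<in>Cofib S. \<forall>p\<in>Fib S \<inter> Weq S. has_lifting C i p) \<and>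
     (\<forall>i\<in>Cofib S \<inter> Weq S. \<forall>p\<in>Fib S. has_lifting C i p) \<and>
     factors_through C (Cofib S) (Fib S \<inter> Weq S) \<and>
     factors_through C (Cofib S \<inter> Weq S) (Fib S)"

definition cofibrant :: "('o, 'a) cat \<Rightarrow> 'a model_structure \<Rightarrow> 'o \<Rightarrow> bool" where
  "cofibrant C S x \<longleftrightarrow> (\<exists>z f. is_initial C z \<and> f \<in> hom C z x \<and> f \<in> Cofib S)"

definition objectwise ::
    "('i, 'j) cat \<Rightarrow> ('o, 'a) cat \<Rightarrow> 'a set \<Rightarrow> ('i, 'j, 'o, 'a) ntrans set" where
  "objectwise J C W = {t \<in> Arr (Fun J C). \<forall>x\<in>Obj J. ncomp t x \<in> W}"

definition projective_structure ::
    "('i, 'j) cat \<Rightarrow> ('o, 'a) cat \<Rightarrow> 'a model_structure \<Rightarrow> ('i, 'j, 'o, 'a) ntrans model_structure"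
  where
  "projective_structure J C S =
     \<lparr> Weq = objectwise J C (Weq S),
       Cofib = {i \<in> Arr (Fun J C).
                  \<forall>p \<in> objectwise J C (Fib S) \<inter> objectwise J C (Weq S). has_lifting (Fun J C) i p},
       Fib = objectwise J C (Fib S) \<rparr>"

definition poset_cat :: "'p set \<Rightarrow> 'p rel \<Rightarrow> ('p, 'p \<times> 'p) cat" where
  "poset_cat A r =
     \<lparr> Obj = A, Arr = {(x, y). x \<in> A \<and> y \<in> A \<and> (x, y) \<in> r}, Dom = fst, Cod = snd,
       Ident = (\<lambda>x. (x, x)), Comp = (\<lambda>g f. (fst f, snd g)) \<rparr>"

definition good_model_category ::
    "'u itself \<Rightarrow> ('o, 'a) cat \<Rightarrow> 'a model_structure \<Rightarrow> bool" where
  "good_model_category U M S \<longleftrightarrow> model_category U M S \<and>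
     (\<forall>(A :: 'u set) r. partial_order_on A r \<longrightarrow>
        model_category U (Fun (poset_cat A r) M) (projective_structure (poset_cat A r) M S))"

section \<open>Homotopy left Kan extensions\<close>

definition is_left_kan_extension ::
    "('o, 'a) cat \<Rightarrow> ('q, 'c) cat \<Rightarrow> ('p, 'b) cat \<Rightarrow> ('o, 'a, 'q, 'c) ftor \<Rightarrow>
     ('o, 'a, 'p, 'b) ftor \<Rightarrow> ('q, 'c, 'p, 'b) ftor \<Rightarrow> ('o, 'a, 'p, 'b) ntrans \<Rightarrow> bool" where
  "is_left_kan_extension A B M u X L \<eta> \<longleftrightarrow>
     L \<in> Obj (Fun B M) \<and> \<eta> \<in> hom (Fun A M) X (precomp A L u) \<and>
     (\<forall>H\<in>Obj (Fun B M). \<forall>\<alpha>\<in>hom (Fun A M) X (precomp A H u).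
        \<exists>!\<beta>. \<beta> \<in> hom (Fun B M) L H \<and> Comp (Fun A M) (whisker A \<beta> u) \<eta> = \<alpha>)"

text \<open>The value at \<open>X\<close> of the left derived functor of left Kan extension along \<open>u\<close>: the left Kan
  extension of a projectively cofibrant replacement of \<open>X\<close>.\<close>

definition is_homotopy_left_kan_extension ::
    "('o, 'a) cat \<Rightarrow> ('q, 'c) cat \<Rightarrow> ('p, 'b) cat \<Rightarrow> 'b model_structure \<Rightarrow>
     ('o, 'a, 'q, 'c) ftor \<Rightarrow> ('o, 'a, 'p, 'b) ftor \<Rightarrow> ('q, 'c, 'p, 'b) ftor \<Rightarrow> bool" where
  "is_homotopy_left_kan_extension A B M S u X T \<longleftrightarrow>
     (\<exists>Q q \<eta>. cofibrant (Fun A M) (projective_structure A M S) Q \<and>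
        q \<in> hom (Fun A M) Q X \<and> q \<in> objectwise A M (Weq S) \<and>
        is_left_kan_extension A B M u Q T \<eta>)"

section \<open>The codegree approximations\<close>

definition mono_functor :: "('p \<Rightarrow> 'q) \<Rightarrow> ('p, 'p \<times> 'p, 'q, 'q \<times> 'q) ftor" where
  "mono_functor h = \<lparr> fobj = h, farr = map_prod h h \<rparr>"

definition order_cat :: "'p::order set \<Rightarrow> ('p, 'p \<times> 'p) cat" where
  "order_cat A = poset_cat A {(x, y). x \<le> y}"

definition orthant :: "(real ^ 'n) set" where
  "orthant = {v. \<forall>i. 0 \<le> v $ i}"

definition orthant_le :: "nat \<Rightarrow> (real ^ 'n) set" where
  "orthant_le k = {v \<in> orthant. card {i. v $ i \<noteq> 0} \<le> k}"

abbreviation P_cat :: "(real ^ 'n, (real ^ 'n) \<times> (real ^ 'n)) cat" where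
  "P_cat \<equiv> order_cat orthant"

abbreviation P_le_cat :: "nat \<Rightarrow> (real ^ 'n, (real ^ 'n) \<times> (real ^ 'n)) cat" where
  "P_le_cat k \<equiv> order_cat (orthant_le k)"

type_synonym ('n, 'o, 'a) orthant_functor =
  "(real ^ 'n, (real ^ 'n) \<times> (real ^ 'n), 'o, 'a) ftor"

text \<open>Homotopy left Kan extensions are only determined up to weak equivalence, so some choice is
  made; the interleaving distance below does not depend on it.\<close>

definition codegree_approx ::
    "('o, 'a) cat \<Rightarrow> 'a model_structure \<Rightarrow> nat \<Rightarrow> ('n::finite, 'o, 'a) orthant_functor \<Rightarrow>
     ('n, 'o, 'a) orthant_functor" where
  "codegree_approx M S k F =
     (SOME T. is_homotopy_left_kan_extension (P_le_cat k) P_cat M S (mono_functor (\<lambda>v. v))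
        (precomp (P_le_cat k) F (mono_functor (\<lambda>v. v))) T)"

section \<open>The multiplicative interleaving distance\<close>

definition scaling :: "real \<Rightarrow> real ^ 'n \<Rightarrow> real ^ 'n" where
  "scaling \<epsilon> v = exp \<epsilon> *\<^sub>R v"

definition interleaved ::
    "('o, 'a) cat \<Rightarrow> real \<Rightarrow> ('n::finite, 'o, 'a) orthant_functor \<Rightarrow>
     ('n, 'o, 'a) orthant_functor \<Rightarrow> bool" where
  "interleaved M \<epsilon> F G \<longleftrightarrow>
     (\<exists>\<phi> \<in> hom (Fun P_cat M) F (precomp P_cat G (mono_functor (scaling \<epsilon>))).
      \<exists>\<psi> \<in> hom (Fun P_cat M) G (precomp P_cat F (mono_functor (scaling \<epsilon>))).
      \<forall>x\<in>orthant.
        Comp M (ncomp \<psi> (scaling \<epsilon> x)) (ncomp \<phi> x) = farr F (x, scaling \<epsilon> (scaling \<epsilon> x)) \<and>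
        Comp M (ncomp \<phi> (scaling \<epsilon> x)) (ncomp \<psi> x) = farr G (x, scaling \<epsilon> (scaling \<epsilon> x)))"

text \<open>\<^const>\<open>equivclp\<close> is the generated equivalence relation, so this is the existence of a finite
  zigzag of objectwise weak equivalences.\<close>

definition weakly_equivalent ::
    "('i, 'j) cat \<Rightarrow> ('o, 'a) cat \<Rightarrow> 'a model_structure \<Rightarrow>
     ('i, 'j, 'o, 'a) ftor \<Rightarrow> ('i, 'j, 'o, 'a) ftor \<Rightarrow> bool" where
  "weakly_equivalent J M S =
     equivclp (\<lambda>F G. \<exists>t \<in> hom (Fun J M) F G. t \<in> objectwise J M (Weq S))"

definition homotopy_interleaved ::
    "('o, 'a) cat \<Rightarrow> 'a model_structure \<Rightarrow> real \<Rightarrow> ('n::finite, 'o, 'a) orthant_functor \<Rightarrow>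
     ('n, 'o, 'a) orthant_functor \<Rightarrow> bool" where
  "homotopy_interleaved M S \<epsilon> F G \<longleftrightarrow>
     (\<exists>F' \<in> Obj (Fun P_cat M). \<exists>G' \<in> Obj (Fun P_cat M).
        weakly_equivalent P_cat M S F' F \<and> weakly_equivalent P_cat M S G' G \<and>
        interleaved M \<epsilon> F' G')"

text \<open>The infimum of the empty set is \<open>\<infinity>\<close> in \<^typ>\<open>ennreal\<close>.\<close>

definition interleaving_distance ::
    "('o, 'a) cat \<Rightarrow> 'a model_structure \<Rightarrow> ('n::finite, 'o, 'a) orthant_functor \<Rightarrow>
     ('n, 'o, 'a) orthant_functor \<Rightarrow> ennreal" where
  "interleaving_distance M S F G =
     (INF \<epsilon> \<in> {\<epsilon>. 0 \<le> \<epsilon> \<and> homotopy_interleaved M S \<epsilon> F G}. ennreal \<epsilon>)"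

end

theory Submission
  imports Defs
begin

text \<open>Factorizations are not functorial, so \<open>F\<close> and \<open>G\<close> cannot be cofibrantly replaced separately without
  destroying the strict interleaving identities. Instead a \<open>\<Lambda>\<^sub>\<epsilon>\<close>-interleaving is regarded as one diagram
  on a poset \<open>I\<close> containing two copies of \<open>P\<close>. Its restriction to the part \<open>I\<^sub>k\<close> lying over
  \<open>P\<^sub>\<le>\<^sub>k\<close> is replaced cofibrantly and left Kan extended back to \<open>I\<close>, which gives a strictly
  interleaved pair. The inclusion of each copy of \<open>P\<close> has a left adjoint, collapsing the other copy by
  \<open>\<Lambda>\<^sub>\<epsilon>\<close>; hence restriction to a copy is itself a left Kan extension. It therefore
  preserves cofibrant objects and commutes with the extension from \<open>I\<^sub>k\<close> to \<open>I\<close>, so the pair consists of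
  models of \<open>T\<^sub>k F\<close> and \<open>T\<^sub>k G\<close>. For the second inequality, \<open>P\<^sub>\<le>\<^sub>k\<^sub>+\<^sub>1\<close> is a full
  subposet, so \<open>T\<^sub>k\<^sub>+\<^sub>1 F\<close> agrees with \<open>F\<close> on \<open>P\<^sub>\<le>\<^sub>k\<close> up to weak equivalence, and the first
  argument applies to \<open>T\<^sub>k\<^sub>+\<^sub>1 F\<close> and \<open>T\<^sub>k\<^sub>+\<^sub>1 G\<close>.\<close>

section \<open>Functor categories and restriction\<close>

text \<open>Two obstacles shape the construction. Goodness provides projective model structures only
  for partial orders carried by subsets of \<open>'u\<close>, so the indexing poset must be
  antisymmetric and its model structure has to be transported along an injection. The given
  injection of \<open>real ^ 'n\<close> also makes \<open>'u\<close> infinite, which leaves room for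
  labelled points and for arrows. Secondly, neither cofibrant replacements nor Kan extensions come
  as chosen functors, so the arguments use the universal property of each single extension, and left
  Quillen behaviour appears as transposition of lifting problems.

  Extension commutes with restriction to a copy because the square of inclusions and collapses
  commutes: Kan extensions are pasted along one side of it, and the collapse on the other side is
  cancelled. Since \<open>codegree_approx\<close> is a choice by \<open>SOME\<close>, reaching it
  also requires that homotopy left Kan extensions of weakly equivalent functors are joined by a
  zigzag.\<close>

lemma homD:
  assumes "f \<in> hom C x y"
  shows "f \<in> Arr C" "Dom C f = x" "Cod C f = y"
  using assms by (auto simp: hom_def)

lemma homI: "f \<in> Arr C \<Longrightarrow> Dom C f = x \<Longrightarrow> Cod C f = y \<Longrightarrow> f \<in> hom C x y"
  by (auto simp: hom_def)

lemma hom_Dom_Cod: "f \<in> Arr C \<Longrightarrow> f \<in> hom C (Dom C f) (Cod C f)"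
  by (auto simp: hom_def)

context
  fixes C :: "('o, 'a) cat"
  assumes C: "category C"
begin

lemma hom_Obj:
  assumes "f \<in> hom C x y"
  shows "x \<in> Obj C" "y \<in> Obj C"
  using assms C by (auto simp: hom_def category_def)

lemma Ident_hom: "x \<in> Obj C \<Longrightarrow> Ident C x \<in> hom C x x"
  using C by (auto simp: category_def)

lemma Comp_hom:
  assumes "f \<in> hom C x y" "g \<in> hom C y z"
  shows "Comp C g f \<in> hom C x z"
proof -
  have "Comp C g f \<in> hom C (Dom C f) (Cod C g)"
    using assms C unfolding category_def by (auto simp: hom_def[of C x y] hom_def[of C y z])
  then show ?thesis using assms by (simp add: homD)
qed

lemma Comp_assoc:
  assumes "f \<in> hom C x y" "g \<in> hom C y z" "h \<in> hom C z w"
  shows "Comp C (Comp C h g) f = Comp C h (Comp C g f)"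
proof -
  have *: "f \<in> Arr C" "g \<in> Arr C" "h \<in> Arr C" "Cod C f = Dom C g" "Cod C g = Dom C h"
    using assms by (auto simp: hom_def)
  show ?thesis
    using C * unfolding category_def by metis
qed

lemma Comp_Ident_left: "f \<in> hom C x y \<Longrightarrow> Comp C (Ident C y) f = f"
  using C unfolding category_def hom_def by auto

lemma Comp_Ident_right: "f \<in> hom C x y \<Longrightarrow> Comp C f (Ident C x) = f"
  using C unfolding category_def hom_def by auto

end

lemma categoryI:
  assumes "\<And>f. f \<in> Arr C \<Longrightarrow> Dom C f \<in> Obj C \<and> Cod C f \<in> Obj C"
    and "\<And>x. x \<in> Obj C \<Longrightarrow> Ident C x \<in> hom C x x"
    and "\<And>f g x y z. f \<in> hom C x y \<Longrightarrow> g \<in> hom C y z \<Longrightarrow> Comp C g f \<in> hom C x z"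
    and "\<And>f x y. f \<in> hom C x y \<Longrightarrow> Comp C f (Ident C x) = f"
    and "\<And>f x y. f \<in> hom C x y \<Longrightarrow> Comp C (Ident C y) f = f"
    and "\<And>f g h x y z w. f \<in> hom C x y \<Longrightarrow> g \<in> hom C y z \<Longrightarrow> h \<in> hom C z w \<Longrightarrow>
           Comp C h (Comp C g f) = Comp C (Comp C h g) f"
  shows "category C"
  unfolding category_def
proof (intro conjI ballI impI)
  fix f assume f: "f \<in> Arr C"
  show "Dom C f \<in> Obj C" "Cod C f \<in> Obj C"
    using assms(1)[OF f] by auto
  show "Comp C f (Ident C (Dom C f)) = f" "Comp C (Ident C (Cod C f)) f = f"
    using assms(4,5)[OF hom_Dom_Cod[OF f]] by auto
  fix g assume g: "g \<in> Arr C" "Cod C f = Dom C g"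
  have g': "g \<in> hom C (Cod C f) (Cod C g)" using g by (simp add: homI)
  show "Comp C g f \<in> hom C (Dom C f) (Cod C g)"
    by (rule assms(3)[OF hom_Dom_Cod[OF f] g'])
  fix h assume h: "h \<in> Arr C" "Cod C g = Dom C h"
  have h': "h \<in> hom C (Cod C g) (Cod C h)" using h by (simp add: homI)
  show "Comp C h (Comp C g f) = Comp C (Comp C h g) f"
    by (rule assms(6)[OF hom_Dom_Cod[OF f] g' h'])
qed (rule assms(2))

lemma is_functorD:
  assumes "is_functor C D F"
  shows "x \<in> Obj C \<Longrightarrow> fobj F x \<in> Obj D"
    and "f \<in> hom C x y \<Longrightarrow> farr F f \<in> hom D (fobj F x) (fobj F y)"
    and "x \<in> Obj C \<Longrightarrow> farr F (Ident C x) = Ident D (fobj F x)"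
    and "f \<in> hom C x y \<Longrightarrow> g \<in> hom C y z \<Longrightarrow> farr F (Comp C g f) = Comp D (farr F g) (farr F f)"
  using assms by (auto simp: is_functor_def hom_def)

lemma hom_Fun_iff:
  "t \<in> hom (Fun J M) X Y \<longleftrightarrow>
     X \<in> functors J M \<and> Y \<in> functors J M \<and> nsrc t = X \<and> ntgt t = Y \<and>
     ncomp t \<in> extensional (Obj J) \<and>
     (\<forall>x\<in>Obj J. ncomp t x \<in> hom M (fobj X x) (fobj Y x)) \<and>
     (\<forall>f\<in>Arr J. Comp M (ncomp t (Cod J f)) (farr X f) = Comp M (farr Y f) (ncomp t (Dom J f)))"
  unfolding hom_def[of "Fun J M"] by (auto simp: Fun_def ntranses_def)

lemma hom_FunD:
  assumes "t \<in> hom (Fun J M) X Y"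
  shows "X \<in> functors J M" "Y \<in> functors J M"
    and "x \<in> Obj J \<Longrightarrow> ncomp t x \<in> hom M (fobj X x) (fobj Y x)"
    and "f \<in> hom J x y \<Longrightarrow> Comp M (ncomp t y) (farr X f) = Comp M (farr Y f) (ncomp t x)"
  using assms homD[of f J x y] unfolding hom_Fun_iff by auto

lemma ntrans_eqI:
  assumes "t \<in> hom (Fun J M) X Y" "s \<in> hom (Fun J M) X Y"
    and "\<And>x. x \<in> Obj J \<Longrightarrow> ncomp t x = ncomp s x"
  shows "t = s"
proof -
  have "ncomp t = ncomp s"
    using assms by (auto simp: hom_Fun_iff intro: extensionalityI)
  then show ?thesis
    using assms(1,2) by (auto simp: hom_Fun_iff)
qed

lemma Obj_Fun [simp]: "Obj (Fun J M) = functors J M"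
  by (simp add: Fun_def)

lemma ncomp_Comp [simp]:
  "x \<in> Obj J \<Longrightarrow> ncomp (Comp (Fun J M) t s) x = Comp M (ncomp t x) (ncomp s x)"
  by (simp add: Fun_def)

lemma ncomp_Ident [simp]:
  "x \<in> Obj J \<Longrightarrow> ncomp (Ident (Fun J M) X) x = Ident M (fobj X x)"
  by (simp add: Fun_def)

lemma is_functor_functors: "X \<in> functors J M \<Longrightarrow> is_functor J M X"
  by (simp add: functors_def)

lemma category_Fun:
  assumes J: "category J" and M: "category M"
  shows "category (Fun J M)"
proof -
  have comp: "Comp (Fun J M) t s \<in> hom (Fun J M) X Z"
    if s: "s \<in> hom (Fun J M) X Y" and t: "t \<in> hom (Fun J M) Y Z" for s t X Y Z
  proof -
    have X: "is_functor J M X" and Y: "is_functor J M Y" and Z: "is_functor J M Z"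
      using hom_FunD(1,2)[OF s] hom_FunD(1,2)[OF t] by (auto simp: is_functor_functors)
    have "Comp M (Comp M (ncomp t y) (ncomp s y)) (farr X f)
        = Comp M (farr Z f) (Comp M (ncomp t x) (ncomp s x))"
      if f: "f \<in> hom J x y" for f x y
    proof -
      have x: "x \<in> Obj J" and y: "y \<in> Obj J" using hom_Obj[OF J f] by auto
      note sx = hom_FunD(3)[OF s x] and sy = hom_FunD(3)[OF s y]
       and tx = hom_FunD(3)[OF t x] and ty = hom_FunD(3)[OF t y]
       and Xf = is_functorD(2)[OF X f] and Yf = is_functorD(2)[OF Y f]
       and Zf = is_functorD(2)[OF Z f]
      show ?thesis
        by (simp add: Comp_assoc[OF M Xf sy ty] hom_FunD(4)[OF s f]
            Comp_assoc[OF M sx Yf ty, symmetric] hom_FunD(4)[OF t f] Comp_assoc[OF M sx tx Zf])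
    qed
    moreover have "Comp M (ncomp t x) (ncomp s x) \<in> hom M (fobj X x) (fobj Z x)"
      if "x \<in> Obj J" for x
      using Comp_hom[OF M hom_FunD(3)[OF s that] hom_FunD(3)[OF t that]] .
    ultimately show ?thesis
      using s t hom_Obj[OF J hom_Dom_Cod] hom_Dom_Cod[of _ J]
      unfolding hom_Fun_iff by (auto simp: Fun_def)
  qed
  have ident: "Ident (Fun J M) X \<in> hom (Fun J M) X X" if X: "X \<in> functors J M" for X
  proof -
    note F = is_functor_functors[OF X]
    show ?thesis
      using X is_functorD(1)[OF F] Ident_hom[OF M] hom_Obj[OF J hom_Dom_Cod]
        Comp_Ident_left[OF M is_functorD(2)[OF F hom_Dom_Cod]]
        Comp_Ident_right[OF M is_functorD(2)[OF F hom_Dom_Cod]]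
      unfolding hom_Fun_iff by (auto simp: Fun_def)
  qed
  show ?thesis
  proof (rule categoryI)
    show "Dom (Fun J M) f \<in> Obj (Fun J M) \<and> Cod (Fun J M) f \<in> Obj (Fun J M)"
      if "f \<in> Arr (Fun J M)" for f
      using that by (auto simp: Fun_def ntranses_def)
    show "Ident (Fun J M) x \<in> hom (Fun J M) x x" if "x \<in> Obj (Fun J M)" for x
      using that ident by auto
    show "Comp (Fun J M) g f \<in> hom (Fun J M) x z"
      if "f \<in> hom (Fun J M) x y" "g \<in> hom (Fun J M) y z" for f g x y z
      using that by (rule comp)
    show "Comp (Fun J M) f (Ident (Fun J M) x) = f" if "f \<in> hom (Fun J M) x y" for f x y
      using that comp[OF ident that] hom_FunD(1)[OF that]
      by (intro ntrans_eqI[OF _ that]) (auto simp: Comp_Ident_right[OF M hom_FunD(3)[OF that]])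
    show "Comp (Fun J M) (Ident (Fun J M) y) f = f" if "f \<in> hom (Fun J M) x y" for f x y
      using that comp[OF that ident] hom_FunD(2)[OF that]
      by (intro ntrans_eqI[OF _ that]) (auto simp: Comp_Ident_left[OF M hom_FunD(3)[OF that]])
    show "Comp (Fun J M) h (Comp (Fun J M) g f) = Comp (Fun J M) (Comp (Fun J M) h g) f"
      if f: "f \<in> hom (Fun J M) x y" and g: "g \<in> hom (Fun J M) y z"
        and h: "h \<in> hom (Fun J M) z w" for f g h x y z w
      using Comp_assoc[OF M hom_FunD(3)[OF f] hom_FunD(3)[OF g] hom_FunD(3)[OF h]]
      by (intro ntrans_eqI[OF comp[OF comp[OF f g] h] comp[OF f comp[OF g h]]]) auto
  qed
qed

lemma is_functor_compose:
  assumes "is_functor J K u" "is_functor K M X"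
  shows "is_functor J M \<lparr>fobj = \<lambda>x. fobj X (fobj u x), farr = \<lambda>f. farr X (farr u f)\<rparr>"
  using assms unfolding is_functor_def by (simp add: hom_def)

lemma is_functor_cong:
  assumes "category J" and "is_functor J M X"
    and "\<And>x. x \<in> Obj J \<Longrightarrow> fobj Y x = fobj X x" "\<And>f. f \<in> Arr J \<Longrightarrow> farr Y f = farr X f"
  shows "is_functor J M Y"
  using assms unfolding is_functor_def category_def hom_def by auto

lemma precomp_functors:
  assumes "category J" "is_functor J K u" "X \<in> functors K M"
  shows "precomp J X u \<in> functors J M"
  using is_functor_cong[OF assms(1) is_functor_compose[OF assms(2)
        is_functor_functors[OF assms(3)]], of "precomp J X u"]
  by (auto simp: functors_def precomp_def compose_def)

lemma fobj_precomp [simp]: "x \<in> Obj J \<Longrightarrow> fobj (precomp J X u) x = fobj X (fobj u x)"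
  by (simp add: precomp_def compose_def)

lemma farr_precomp [simp]: "f \<in> Arr J \<Longrightarrow> farr (precomp J X u) f = farr X (farr u f)"
  by (simp add: precomp_def compose_def)

lemma ncomp_whisker [simp]: "x \<in> Obj J \<Longrightarrow> ncomp (whisker J t u) x = ncomp t (fobj u x)"
  by (simp add: whisker_def compose_def)

lemma whisker_hom:
  assumes J: "category J" and u: "is_functor J K u" and t: "t \<in> hom (Fun K M) X Y"
  shows "whisker J t u \<in> hom (Fun J M) (precomp J X u) (precomp J Y u)"
proof -
  have "Dom J f \<in> Obj J" "Cod J f \<in> Obj J" if "f \<in> Arr J" for f
    using J that by (auto simp: category_def)
  then show ?thesis
    using hom_FunD(1-3)[OF t] hom_FunD(4)[OF t is_functorD(2)[OF u hom_Dom_Cod]]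
      precomp_functors[OF J u] is_functorD(1)[OF u] t
    by (auto simp: hom_Fun_iff precomp_def whisker_def compose_def)
qed

lemma whisker_Comp:
  assumes J: "category J" and K: "category K" and M: "category M" and u: "is_functor J K u"
    and s: "s \<in> hom (Fun K M) X Y" and t: "t \<in> hom (Fun K M) Y Z"
  shows "whisker J (Comp (Fun K M) t s) u = Comp (Fun J M) (whisker J t u) (whisker J s u)"
  using is_functorD(1)[OF u]
  by (intro ntrans_eqI[OF whisker_hom[OF J u Comp_hom[OF category_Fun[OF K M] s t]]
        Comp_hom[OF category_Fun[OF J M] whisker_hom[OF J u s] whisker_hom[OF J u t]]]) auto

lemma whisker_Ident:
  assumes J: "category J" and K: "category K" and M: "category M" and u: "is_functor J K u"
    and X: "X \<in> functors K M"
  shows "whisker J (Ident (Fun K M) X) u = Ident (Fun J M) (precomp J X u)"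
  using is_functorD(1)[OF u] precomp_functors[OF J u X] X
  by (intro ntrans_eqI[OF whisker_hom[OF J u Ident_hom[OF category_Fun[OF K M]]]
        Ident_hom[OF category_Fun[OF J M]]]) auto

lemma objectwise_iff:
  "t \<in> hom (Fun J M) X Y \<Longrightarrow> t \<in> objectwise J M W \<longleftrightarrow> (\<forall>x\<in>Obj J. ncomp t x \<in> W)"
  by (auto simp: objectwise_def hom_def)

text \<open>Objectwise classes are tested point by point, so restriction preserves them along any
  functor. This is the right Quillen half of every Kan extension argument below.\<close>

lemma whisker_objectwise:
  assumes "category J" "is_functor J K u" "t \<in> hom (Fun K M) X Y" "t \<in> objectwise K M W"
  shows "whisker J t u \<in> objectwise J M W"
  using assms is_functorD(1)[OF assms(2)]
  by (auto simp: objectwise_iff[OF whisker_hom[OF assms(1-3)]] objectwise_iff[OF assms(3)])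

section \<open>Left Kan extensions\<close>

context
  fixes A :: "('o, 'a) cat" and B :: "('q, 'c) cat" and M :: "('p, 'b) cat"
    and u :: "('o, 'a, 'q, 'c) ftor"
  assumes A: "category A" and B: "category B" and M: "category M" and u: "is_functor A B u"
begin

lemma left_kan_extensionD:
  assumes "is_left_kan_extension A B M u X L \<eta>"
  shows "L \<in> functors B M" "\<eta> \<in> hom (Fun A M) X (precomp A L u)"
  using assms by (auto simp: is_left_kan_extension_def)

lemma left_kan_extension_factor:
  assumes "is_left_kan_extension A B M u X L \<eta>" "H \<in> functors B M"
    and "\<alpha> \<in> hom (Fun A M) X (precomp A H u)"
  obtains \<beta> where "\<beta> \<in> hom (Fun B M) L H" "Comp (Fun A M) (whisker A \<beta> u) \<eta> = \<alpha>"
  using assms unfolding is_left_kan_extension_def by (metis Obj_Fun)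

lemma left_kan_extension_unique:
  assumes K: "is_left_kan_extension A B M u X L \<eta>"
    and \<beta>: "\<beta> \<in> hom (Fun B M) L H" and \<beta>': "\<beta>' \<in> hom (Fun B M) L H"
    and eq: "Comp (Fun A M) (whisker A \<beta> u) \<eta> = Comp (Fun A M) (whisker A \<beta>' u) \<eta>"
  shows "\<beta> = \<beta>'"
proof -
  have "Comp (Fun A M) (whisker A \<beta> u) \<eta> \<in> hom (Fun A M) X (precomp A H u)"
    using Comp_hom[OF category_Fun[OF A M] left_kan_extensionD(2)[OF K] whisker_hom[OF A u \<beta>]] .
  then show ?thesis
    using K \<beta> \<beta>' eq hom_FunD(2)[OF \<beta>] unfolding is_left_kan_extension_def
    by (metis Obj_Fun)
qed

lemma whisker_Comp_unit:
  assumes "\<eta> \<in> hom (Fun A M) X (precomp A L u)"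
    and "\<beta> \<in> hom (Fun B M) L H" "\<gamma> \<in> hom (Fun B M) H H'"
  shows "Comp (Fun A M) (whisker A (Comp (Fun B M) \<gamma> \<beta>) u) \<eta>
       = Comp (Fun A M) (whisker A \<gamma> u) (Comp (Fun A M) (whisker A \<beta> u) \<eta>)"
  using Comp_assoc[OF category_Fun[OF A M] assms(1) whisker_hom[OF A u assms(2)]
      whisker_hom[OF A u assms(3)]] whisker_Comp[OF A B M u assms(2,3)] by simp

lemma left_kan_extension_iso:
  assumes K: "is_left_kan_extension A B M u X L \<eta>" and K': "is_left_kan_extension A B M u X L' \<eta>'"
  obtains \<theta> \<theta>' where "\<theta> \<in> hom (Fun B M) L L'" "\<theta>' \<in> hom (Fun B M) L' L"
    "Comp (Fun B M) \<theta>' \<theta> = Ident (Fun B M) L" "Comp (Fun B M) \<theta> \<theta>' = Ident (Fun B M) L'"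
proof -
  have key: "Comp (Fun B M) \<theta>' \<theta> = Ident (Fun B M) L"
    if K: "is_left_kan_extension A B M u X L \<eta>" and K': "is_left_kan_extension A B M u X L' \<eta>'"
      and \<theta>: "\<theta> \<in> hom (Fun B M) L L'" "Comp (Fun A M) (whisker A \<theta> u) \<eta> = \<eta>'"
      and \<theta>': "\<theta>' \<in> hom (Fun B M) L' L" "Comp (Fun A M) (whisker A \<theta>' u) \<eta>' = \<eta>"
    for L L' \<eta> \<eta>' \<theta> \<theta>'
  proof (rule left_kan_extension_unique[OF K Comp_hom[OF category_Fun[OF B M] \<theta>(1) \<theta>'(1)]
        Ident_hom[OF category_Fun[OF B M]]])
    show "L \<in> Obj (Fun B M)" using left_kan_extensionD[OF K] by simp
    show "Comp (Fun A M) (whisker A (Comp (Fun B M) \<theta>' \<theta>) u) \<eta>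
        = Comp (Fun A M) (whisker A (Ident (Fun B M) L) u) \<eta>"
      using whisker_Comp_unit[OF left_kan_extensionD(2)[OF K] \<theta>(1) \<theta>'(1)] \<theta>(2) \<theta>'(2)
        whisker_Ident[OF A B M u left_kan_extensionD(1)[OF K]]
        Comp_Ident_left[OF category_Fun[OF A M] left_kan_extensionD(2)[OF K]] by simp
  qed
  obtain \<theta> where \<theta>: "\<theta> \<in> hom (Fun B M) L L'" "Comp (Fun A M) (whisker A \<theta> u) \<eta> = \<eta>'"
    using left_kan_extension_factor[OF K left_kan_extensionD[OF K']] .
  obtain \<theta>' where \<theta>': "\<theta>' \<in> hom (Fun B M) L' L" "Comp (Fun A M) (whisker A \<theta>' u) \<eta>' = \<eta>"
    using left_kan_extension_factor[OF K' left_kan_extensionD[OF K]] .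
  show thesis
    using that[OF \<theta>(1) \<theta>'(1) key[OF K K' \<theta> \<theta>'] key[OF K' K \<theta>' \<theta>]] .
qed

text \<open>Lifting problems transpose across the adjunction between extension and restriction. The
  statement concerns two individual Kan extensions and the induced map \<open>l\<close>, so that no
  functor of Kan extensions has to be chosen. The diagonal is transposed back by factoring, and both
  triangles follow from uniqueness.\<close>

lemma has_lifting_left_kan_extension:
  assumes K: "is_left_kan_extension A B M u Q L \<eta>" and K': "is_left_kan_extension A B M u Z L' \<eta>'"
    and g: "g \<in> hom (Fun A M) Q Z" and l: "l \<in> hom (Fun B M) L L'"
    and eq: "Comp (Fun A M) (whisker A l u) \<eta> = Comp (Fun A M) \<eta>' g"
    and p: "p \<in> hom (Fun B M) E D" and lift: "has_lifting (Fun A M) g (whisker A p u)"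
  shows "has_lifting (Fun B M) l p"
  unfolding has_lifting_def homD[OF l] homD[OF p]
proof (intro ballI impI)
  fix a b assume a: "a \<in> hom (Fun B M) L E" and b: "b \<in> hom (Fun B M) L' D"
    and sq: "Comp (Fun B M) p a = Comp (Fun B M) b l"
  note FA = category_Fun[OF A M] and FB = category_Fun[OF B M]
  note \<eta> = left_kan_extensionD(2)[OF K] and \<eta>' = left_kan_extensionD(2)[OF K']
  note wa = whisker_hom[OF A u a] and wb = whisker_hom[OF A u b] and wp = whisker_hom[OF A u p]
  let ?a = "Comp (Fun A M) (whisker A a u) \<eta>" and ?b = "Comp (Fun A M) (whisker A b u) \<eta>'"
  have a': "?a \<in> hom (Fun A M) Q (precomp A E u)" using Comp_hom[OF FA \<eta> wa] .
  have b': "?b \<in> hom (Fun A M) Z (precomp A D u)" using Comp_hom[OF FA \<eta>' wb] .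
  have "Comp (Fun A M) (whisker A p u) ?a = Comp (Fun A M) (whisker A (Comp (Fun B M) p a) u) \<eta>"
    using whisker_Comp_unit[OF \<eta> a p] by simp
  also have "\<dots> = Comp (Fun A M) (whisker A b u) (Comp (Fun A M) \<eta>' g)"
    using whisker_Comp_unit[OF \<eta> l b] sq eq by simp
  also have "\<dots> = Comp (Fun A M) ?b g"
    using Comp_assoc[OF FA g \<eta>' wb] by simp
  finally obtain h' where h': "h' \<in> hom (Fun A M) Z (precomp A E u)"
    and h'a: "Comp (Fun A M) h' g = ?a" and h'b: "Comp (Fun A M) (whisker A p u) h' = ?b"
    using lift a' b' unfolding has_lifting_def homD[OF g] homD[OF wp] by blast
  obtain h where h: "h \<in> hom (Fun B M) L' E" and hh': "Comp (Fun A M) (whisker A h u) \<eta>' = h'"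
    using left_kan_extension_factor[OF K' hom_FunD(1)[OF p] h'] .
  note wh = whisker_hom[OF A u h]
  have "Comp (Fun B M) h l = a"
  proof (rule left_kan_extension_unique[OF K Comp_hom[OF FB l h] a])
    show "Comp (Fun A M) (whisker A (Comp (Fun B M) h l) u) \<eta> = ?a"
      using whisker_Comp_unit[OF \<eta> l h] eq Comp_assoc[OF FA g \<eta>' wh] hh' h'a by simp
  qed
  moreover have "Comp (Fun B M) p h = b"
  proof (rule left_kan_extension_unique[OF K' Comp_hom[OF FB h p] b])
    show "Comp (Fun A M) (whisker A (Comp (Fun B M) p h) u) \<eta>' = ?b"
      using whisker_Comp_unit[OF \<eta>' h p] hh' h'b by simp
  qed
  ultimately show "\<exists>h\<in>hom (Fun B M) L' E. Comp (Fun B M) h l = a \<and> Comp (Fun B M) p h = b"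
    using h by blast
qed

end

context
  fixes A :: "('o, 'a) cat" and B :: "('q, 'c) cat" and C :: "('r, 'd) cat" and M :: "('p, 'b) cat"
    and u :: "('o, 'a, 'q, 'c) ftor" and v :: "('q, 'c, 'r, 'd) ftor" and w :: "('o, 'a, 'r, 'd) ftor"
  assumes A: "category A" and B: "category B" and C: "category C" and M: "category M"
    and u: "is_functor A B u" and v: "is_functor B C v" and w: "is_functor A C w"
    and fobj_vu: "\<And>x. x \<in> Obj A \<Longrightarrow> fobj v (fobj u x) = fobj w x"
    and farr_vu: "\<And>f. f \<in> Arr A \<Longrightarrow> farr v (farr u f) = farr w f"
begin

text \<open>\<open>w\<close> plays the role of the composite of \<open>u\<close> and
  \<open>v\<close>. The two are compared only on the carriers because records such as
  \<open>mono_functor h\<close> have arbitrary values elsewhere; \<open>precomp\<close> restricts to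
  the carriers, so the conclusion is a true equality.\<close>

lemma precomp_comp: "precomp A (precomp B N v) u = precomp A N w"
  using fobj_vu farr_vu is_functorD(1)[OF u] homD(1)[OF is_functorD(2)[OF u hom_Dom_Cod]]
  by (auto simp: precomp_def compose_def intro!: restrict_ext)

lemma whisker_comp: "whisker A (whisker B t v) u = whisker A t w"
  using precomp_comp fobj_vu is_functorD(1)[OF u]
  by (auto simp: whisker_def compose_def intro!: restrict_ext)

lemma whisker_paste:
  assumes \<eta>: "\<eta> \<in> hom (Fun A M) X (precomp A L u)" and \<zeta>: "\<zeta> \<in> hom (Fun B M) L (precomp B N v)"
    and \<beta>: "\<beta> \<in> hom (Fun C M) N H"
  shows "Comp (Fun A M) (whisker A \<beta> w) (Comp (Fun A M) (whisker A \<zeta> u) \<eta>)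
       = Comp (Fun A M) (whisker A (Comp (Fun B M) (whisker B \<beta> v) \<zeta>) u) \<eta>"
  using whisker_Comp_unit[OF A B M u \<eta> \<zeta> whisker_hom[OF B v \<beta>]] by (simp add: whisker_comp)

text \<open>A transformation out of \<open>X\<close> factors through \<open>L\<close> and its factor
  through \<open>N\<close>; \<open>whisker_paste\<close> identifies this double factorization with
  one through the pasted unit.\<close>

lemma left_kan_extension_trans:
  assumes K: "is_left_kan_extension A B M u X L \<eta>" and K': "is_left_kan_extension B C M v L N \<zeta>"
  shows "is_left_kan_extension A C M w X N (Comp (Fun A M) (whisker A \<zeta> u) \<eta>)"
  unfolding is_left_kan_extension_def
proof (intro conjI ballI)
  note \<eta> = left_kan_extensionD(2)[OF A B M u K] and \<zeta> = left_kan_extensionD(2)[OF B C M v K']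
  show "N \<in> Obj (Fun C M)" using left_kan_extensionD(1)[OF B C M v K'] by simp
  show "Comp (Fun A M) (whisker A \<zeta> u) \<eta> \<in> hom (Fun A M) X (precomp A N w)"
    using Comp_hom[OF category_Fun[OF A M] \<eta> whisker_hom[OF A u \<zeta>]] by (simp add: precomp_comp)
  fix H \<alpha> assume H: "H \<in> Obj (Fun C M)" and \<alpha>: "\<alpha> \<in> hom (Fun A M) X (precomp A H w)"
  have vH: "precomp B H v \<in> functors B M" using precomp_functors[OF B v] H by simp
  obtain \<gamma> where \<gamma>: "\<gamma> \<in> hom (Fun B M) L (precomp B H v)"
    "Comp (Fun A M) (whisker A \<gamma> u) \<eta> = \<alpha>"
    using left_kan_extension_factor[OF A B M u K vH] \<alpha> by (metis precomp_comp)
  obtain \<beta> where \<beta>: "\<beta> \<in> hom (Fun C M) N H" "Comp (Fun B M) (whisker B \<beta> v) \<zeta> = \<gamma>"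
    using left_kan_extension_factor[OF B C M v K' _ \<gamma>(1)] H by auto
  show "\<exists>!\<beta>. \<beta> \<in> hom (Fun C M) N H \<and>
     Comp (Fun A M) (whisker A \<beta> w) (Comp (Fun A M) (whisker A \<zeta> u) \<eta>) = \<alpha>"
  proof (intro ex1I[of _ \<beta>] conjI)
    show "Comp (Fun A M) (whisker A \<beta> w) (Comp (Fun A M) (whisker A \<zeta> u) \<eta>) = \<alpha>"
      using \<beta> \<gamma> whisker_paste[OF \<eta> \<zeta> \<beta>(1)] by simp
    fix \<beta>' assume "\<beta>' \<in> hom (Fun C M) N H \<and>
      Comp (Fun A M) (whisker A \<beta>' w) (Comp (Fun A M) (whisker A \<zeta> u) \<eta>) = \<alpha>"
    then have \<beta>': "\<beta>' \<in> hom (Fun C M) N H"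
      and eq: "Comp (Fun A M) (whisker A \<beta>' w) (Comp (Fun A M) (whisker A \<zeta> u) \<eta>) = \<alpha>" by auto
    have "Comp (Fun B M) (whisker B \<beta>' v) \<zeta> = \<gamma>"
      using left_kan_extension_unique[OF A B M u K
          Comp_hom[OF category_Fun[OF B M] \<zeta> whisker_hom[OF B v \<beta>']] \<gamma>(1)]
        whisker_paste[OF \<eta> \<zeta> \<beta>'] eq \<gamma>(2) by simp
    then show "\<beta>' = \<beta>"
      using left_kan_extension_unique[OF B C M v K' \<beta>' \<beta>(1)] \<beta>(2) by simp
  qed (rule \<beta>(1))
qed

text \<open>Maps out of \<open>L\<close> are tested on \<open>X\<close> through
  \<open>\<eta>\<close>, so the universal property of \<open>N\<close> along \<open>w\<close> passes
  to \<open>v\<close>. This later strips the collapse off a composite and leaves an extension along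
  the inclusion of \<open>V\<close>.\<close>

lemma left_kan_extension_cancel:
  assumes K: "is_left_kan_extension A B M u X L \<eta>" and K': "is_left_kan_extension A C M w X N \<zeta>"
  obtains \<xi> where "is_left_kan_extension B C M v L N \<xi>"
proof -
  note \<eta> = left_kan_extensionD(2)[OF A B M u K] and \<zeta> = left_kan_extensionD(2)[OF A C M w K']
  note N = left_kan_extensionD(1)[OF A C M w K']
  obtain \<xi> where \<xi>: "\<xi> \<in> hom (Fun B M) L (precomp B N v)"
    "Comp (Fun A M) (whisker A \<xi> u) \<eta> = \<zeta>"
    using left_kan_extension_factor[OF A B M u K precomp_functors[OF B v N], of \<zeta>] \<zeta>
    by (auto simp: precomp_comp)
  have "is_left_kan_extension B C M v L N \<xi>"
    unfolding is_left_kan_extension_def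
  proof (intro conjI ballI)
    show "N \<in> Obj (Fun C M)" using N by simp
    show "\<xi> \<in> hom (Fun B M) L (precomp B N v)" by (rule \<xi>)
    fix H \<delta> assume H: "H \<in> Obj (Fun C M)" and \<delta>: "\<delta> \<in> hom (Fun B M) L (precomp B H v)"
    let ?\<alpha> = "Comp (Fun A M) (whisker A \<delta> u) \<eta>"
    have \<alpha>: "?\<alpha> \<in> hom (Fun A M) X (precomp A H w)"
      using Comp_hom[OF category_Fun[OF A M] \<eta> whisker_hom[OF A u \<delta>]] by (simp add: precomp_comp)
    obtain \<beta> where \<beta>: "\<beta> \<in> hom (Fun C M) N H" "Comp (Fun A M) (whisker A \<beta> w) \<zeta> = ?\<alpha>"
      using left_kan_extension_factor[OF A C M w K' _ \<alpha>] H by auto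
    show "\<exists>!\<beta>. \<beta> \<in> hom (Fun C M) N H \<and> Comp (Fun B M) (whisker B \<beta> v) \<xi> = \<delta>"
    proof (intro ex1I[of _ \<beta>] conjI)
      show "Comp (Fun B M) (whisker B \<beta> v) \<xi> = \<delta>"
        using left_kan_extension_unique[OF A B M u K
            Comp_hom[OF category_Fun[OF B M] \<xi>(1) whisker_hom[OF B v \<beta>(1)]] \<delta>]
          whisker_paste[OF \<eta> \<xi>(1) \<beta>(1)] \<xi>(2) \<beta>(2) by simp
      fix \<beta>' assume "\<beta>' \<in> hom (Fun C M) N H \<and> Comp (Fun B M) (whisker B \<beta>' v) \<xi> = \<delta>"
      then show "\<beta>' = \<beta>"
        using left_kan_extension_unique[OF A C M w K' _ \<beta>(1), of \<beta>']
          whisker_paste[OF \<eta> \<xi>(1), of \<beta>' H] \<xi>(2) \<beta>(2) by simp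
    qed (rule \<beta>(1))
  qed
  then show thesis by (rule that)
qed

end

section \<open>Diagrams indexed by preorders\<close>

lemma poset_cat_simps [simp]:
  "Obj (poset_cat A r) = A"
  "f \<in> Arr (poset_cat A r) \<longleftrightarrow> fst f \<in> A \<and> snd f \<in> A \<and> f \<in> r"
  "Dom (poset_cat A r) = fst" "Cod (poset_cat A r) = snd"
  "Ident (poset_cat A r) x = (x, x)" "Comp (poset_cat A r) g f = (fst f, snd g)"
  by (auto simp: poset_cat_def)

lemma hom_poset_cat [simp]:
  "f \<in> hom (poset_cat A r) x y \<longleftrightarrow> f = (x, y) \<and> x \<in> A \<and> y \<in> A \<and> (x, y) \<in> r"
  by (cases f) (auto simp: hom_def)

lemma category_poset_cat:
  assumes "refl_on A r" "trans_on A r"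
  shows "category (poset_cat A r)"
  using assms by (intro categoryI) (auto simp: refl_on_def dest: trans_onD)

lemma is_functor_posetI:
  assumes "\<And>x. x \<in> A \<Longrightarrow> fobj X x \<in> Obj M"
    and "\<And>x y. x \<in> A \<Longrightarrow> y \<in> A \<Longrightarrow> (x, y) \<in> r \<Longrightarrow> farr X (x, y) \<in> hom M (fobj X x) (fobj X y)"
    and "\<And>x. x \<in> A \<Longrightarrow> farr X (x, x) = Ident M (fobj X x)"
    and "\<And>x y z. x \<in> A \<Longrightarrow> y \<in> A \<Longrightarrow> z \<in> A \<Longrightarrow> (x, y) \<in> r \<Longrightarrow> (y, z) \<in> r \<Longrightarrow>
           farr X (x, z) = Comp M (farr X (y, z)) (farr X (x, y))"
  shows "is_functor (poset_cat A r) M X"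
  using assms unfolding is_functor_def by auto

text \<open>Both maps are cut down to the carriers because \<open>functors\<close> demands
  extensional functions; \<open>ntransf\<close> below does the same for components.\<close>

definition diagram ::
    "'p set \<Rightarrow> 'p rel \<Rightarrow> ('p \<Rightarrow> 'o) \<Rightarrow> ('p \<Rightarrow> 'p \<Rightarrow> 'a) \<Rightarrow> ('p, 'p \<times> 'p, 'o, 'a) ftor" where
  "diagram A r X f = \<lparr> fobj = restrict X A, farr = restrict (case_prod f) (Arr (poset_cat A r)) \<rparr>"

lemma diagram_simps [simp]:
  "x \<in> A \<Longrightarrow> fobj (diagram A r X f) x = X x"
  "x \<in> A \<Longrightarrow> y \<in> A \<Longrightarrow> (x, y) \<in> r \<Longrightarrow> farr (diagram A r X f) (x, y) = f x y"
  by (auto simp: diagram_def)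

lemma diagram_functors:
  assumes "refl_on A r" "trans_on A r"
    and "\<And>x. x \<in> A \<Longrightarrow> X x \<in> Obj M"
    and "\<And>x y. x \<in> A \<Longrightarrow> y \<in> A \<Longrightarrow> (x, y) \<in> r \<Longrightarrow> f x y \<in> hom M (X x) (X y)"
    and "\<And>x. x \<in> A \<Longrightarrow> f x x = Ident M (X x)"
    and "\<And>x y z. x \<in> A \<Longrightarrow> y \<in> A \<Longrightarrow> z \<in> A \<Longrightarrow> (x, y) \<in> r \<Longrightarrow> (y, z) \<in> r \<Longrightarrow>
           f x z = Comp M (f y z) (f x y)"
  shows "diagram A r X f \<in> functors (poset_cat A r) M"
proof -
  have "is_functor (poset_cat A r) M (diagram A r X f)"
  proof (rule is_functor_posetI)
    fix x assume x: "x \<in> A"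
    show "fobj (diagram A r X f) x \<in> Obj M" "farr (diagram A r X f) (x, x) = Ident M (fobj (diagram A r X f) x)"
      using x assms(3,5)[OF x] refl_onD[OF assms(1) x] by simp_all
    fix y assume y: "y \<in> A" and xy: "(x, y) \<in> r"
    show "farr (diagram A r X f) (x, y) \<in> hom M (fobj (diagram A r X f) x) (fobj (diagram A r X f) y)"
      using x y xy assms(4)[OF x y xy] by simp
    fix z assume z: "z \<in> A" and yz: "(y, z) \<in> r"
    show "farr (diagram A r X f) (x, z) = Comp M (farr (diagram A r X f) (y, z)) (farr (diagram A r X f) (x, y))"
      using x y z xy yz trans_onD[OF assms(2) x y z xy yz] assms(6)[OF x y z xy yz] by simp
  qed
  then show ?thesis by (auto simp: functors_def diagram_def)
qed

lemma poset_functorD: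
  assumes "X \<in> functors (poset_cat A r) M"
  shows "x \<in> A \<Longrightarrow> fobj X x \<in> Obj M"
    and "x \<in> A \<Longrightarrow> y \<in> A \<Longrightarrow> (x, y) \<in> r \<Longrightarrow> farr X (x, y) \<in> hom M (fobj X x) (fobj X y)"
    and "x \<in> A \<Longrightarrow> farr X (x, x) = Ident M (fobj X x)"
    and "x \<in> A \<Longrightarrow> y \<in> A \<Longrightarrow> z \<in> A \<Longrightarrow> (x, y) \<in> r \<Longrightarrow> (y, z) \<in> r \<Longrightarrow>
           Comp M (farr X (y, z)) (farr X (x, y)) = farr X (x, z)"
  using is_functorD(1)[OF is_functor_functors[OF assms], of x]
    is_functorD(2)[OF is_functor_functors[OF assms], of "(x, y)" x y]
    is_functorD(3)[OF is_functor_functors[OF assms], of x]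
    is_functorD(4)[OF is_functor_functors[OF assms], of "(x, y)" x y "(y, z)" z]
  by simp_all

definition ntransf ::
    "('i, 'j) cat \<Rightarrow> ('i, 'j, 'o, 'a) ftor \<Rightarrow> ('i, 'j, 'o, 'a) ftor \<Rightarrow> ('i \<Rightarrow> 'a) \<Rightarrow>
     ('i, 'j, 'o, 'a) ntrans" where
  "ntransf J X Y c = \<lparr> nsrc = X, ntgt = Y, ncomp = restrict c (Obj J) \<rparr>"

lemma ncomp_ntransf [simp]: "x \<in> Obj J \<Longrightarrow> ncomp (ntransf J X Y c) x = c x"
  by (simp add: ntransf_def)

lemma ntransf_hom:
  assumes "X \<in> functors (poset_cat A r) M" "Y \<in> functors (poset_cat A r) M"
    and "\<And>x. x \<in> A \<Longrightarrow> c x \<in> hom M (fobj X x) (fobj Y x)"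
    and "\<And>x y. x \<in> A \<Longrightarrow> y \<in> A \<Longrightarrow> (x, y) \<in> r \<Longrightarrow>
           Comp M (c y) (farr X (x, y)) = Comp M (farr Y (x, y)) (c x)"
  shows "ntransf (poset_cat A r) X Y c \<in> hom (Fun (poset_cat A r) M) X Y"
  using assms by (auto simp: hom_Fun_iff ntransf_def)

lemma ntrans_posetD:
  assumes "t \<in> hom (Fun (poset_cat A r) M) X Y"
  shows "x \<in> A \<Longrightarrow> ncomp t x \<in> hom M (fobj X x) (fobj Y x)"
    and "x \<in> A \<Longrightarrow> y \<in> A \<Longrightarrow> (x, y) \<in> r \<Longrightarrow>
           Comp M (ncomp t y) (farr X (x, y)) = Comp M (farr Y (x, y)) (ncomp t x)"
  using hom_FunD[OF assms] by auto

lemma fobj_mono_functor [simp]: "fobj (mono_functor h) = h"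
  by (simp add: mono_functor_def)

lemma farr_mono_functor [simp]: "farr (mono_functor h) f = (h (fst f), h (snd f))"
  by (cases f) (simp add: mono_functor_def)

lemma is_functor_mono_functor:
  assumes "h \<in> A \<rightarrow> B"
    and "\<And>x y. x \<in> A \<Longrightarrow> y \<in> A \<Longrightarrow> (x, y) \<in> r \<Longrightarrow> (h x, h y) \<in> s"
  shows "is_functor (poset_cat A r) (poset_cat B s) (mono_functor h)"
  using assms by (intro is_functor_posetI) auto

text \<open>In a preorder both sides of the naturality square are the single arrow from
  \<open>h x\<close> to \<open>h' y\<close>. This gives the interleaving maps and the isomorphisms
  between comparable restrictions.\<close>

lemma ntransf_mono_hom:
  assumes M: "category M"
    and A: "refl_on A r" "trans_on A r" and B: "trans_on B s"
    and h: "is_functor (poset_cat A r) (poset_cat B s) (mono_functor h)"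
    and h': "is_functor (poset_cat A r) (poset_cat B s) (mono_functor h')"
    and le: "\<And>x. x \<in> A \<Longrightarrow> (h x, h' x) \<in> s"
    and X: "X \<in> functors (poset_cat B s) M"
  shows "ntransf (poset_cat A r) (precomp (poset_cat A r) X (mono_functor h))
           (precomp (poset_cat A r) X (mono_functor h')) (\<lambda>x. farr X (h x, h' x))
       \<in> hom (Fun (poset_cat A r) M) (precomp (poset_cat A r) X (mono_functor h))
           (precomp (poset_cat A r) X (mono_functor h'))"
proof -
  note J = category_poset_cat[OF A]
  have hB: "h x \<in> B" "h' x \<in> B" if "x \<in> A" for x
    using is_functorD(1)[OF h, of x] is_functorD(1)[OF h', of x] that by auto
  have mono: "(h x, h y) \<in> s" "(h' x, h' y) \<in> s" if "x \<in> A" "y \<in> A" "(x, y) \<in> r" for x y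
    using is_functorD(2)[OF h, of "(x, y)" x y] is_functorD(2)[OF h', of "(x, y)" x y] that by auto
  show ?thesis
    by (intro ntransf_hom precomp_functors[OF J h X] precomp_functors[OF J h' X])
       (auto simp: hB le mono poset_functorD[OF X])
qed

text \<open>The points \<open>x\<close> with \<open>h x\<close> below \<open>y\<close> are those
  below \<open>i y\<close>, so the slice has a greatest point and its colimit is the value of
  \<open>X\<close> at \<open>i y\<close>. The components of the unit are recorded because the
  comparison of induced maps needs them.\<close>

lemma left_kan_extension_Galois:
  assumes M: "category M"
    and A: "refl_on A r" "trans_on A r" and B: "refl_on B s" "trans_on B s"
    and h: "h \<in> A \<rightarrow> B" and i: "i \<in> B \<rightarrow> A"
    and adj: "\<And>x y. x \<in> A \<Longrightarrow> y \<in> B \<Longrightarrow> (h x, y) \<in> s \<longleftrightarrow> (x, i y) \<in> r"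
    and X: "X \<in> functors (poset_cat A r) M"
  obtains \<eta> where "is_left_kan_extension (poset_cat A r) (poset_cat B s) M (mono_functor h) X
     (precomp (poset_cat B s) X (mono_functor i)) \<eta>"
    "\<And>x. x \<in> A \<Longrightarrow> ncomp \<eta> x = farr X (x, i (h x))"
proof -
  have hB: "h x \<in> B" if "x \<in> A" for x using h that by auto
  have iA: "i y \<in> A" if "y \<in> B" for y using i that by auto
  have unit: "(x, i (h x)) \<in> r" if "x \<in> A" for x
    using adj[OF that hB[OF that]] refl_onD[OF B(1) hB[OF that]] by simp
  have counit: "(h (i y), y) \<in> s" if "y \<in> B" for y
    using adj[OF iA[OF that] that] refl_onD[OF A(1) iA[OF that]] by simp
  have monoh: "(h x, h y) \<in> s" if "x \<in> A" "y \<in> A" "(x, y) \<in> r" for x y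
    using that adj trans_onD[OF A(2) that(1,2) iA[OF hB[OF that(2)]] that(3) unit[OF that(2)]]
    by (simp add: hB)
  have monoi: "(i x, i y) \<in> r" if "x \<in> B" "y \<in> B" "(x, y) \<in> s" for x y
    using that adj trans_onD[OF B(2) hB[OF iA[OF that(1)]] that(1,2) counit[OF that(1)] that(3)]
    by (simp add: iA)
  let ?A = "poset_cat A r" and ?B = "poset_cat B s"
  note cA = category_poset_cat[OF A] and cB = category_poset_cat[OF B]
  have fh: "is_functor ?A ?B (mono_functor h)"
    using h monoh by (intro is_functor_mono_functor) auto
  have fi: "is_functor ?B ?A (mono_functor i)"
    using i monoi by (intro is_functor_mono_functor) auto
  let ?L = "precomp ?B X (mono_functor i)"
  note L = precomp_functors[OF cB fi X]
  define \<eta> where "\<eta> = ntransf ?A X (precomp ?A ?L (mono_functor h)) (\<lambda>x. farr X (x, i (h x)))"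
  have \<eta>: "\<eta> \<in> hom (Fun ?A M) X (precomp ?A ?L (mono_functor h))"
    unfolding \<eta>_def
    by (intro ntransf_hom X precomp_functors[OF cA fh L])
      (auto simp: hB iA monoh monoi unit poset_functorD[OF X])
  have "is_left_kan_extension ?A ?B M (mono_functor h) X ?L \<eta>"
    unfolding is_left_kan_extension_def
  proof (intro conjI ballI)
    fix H \<alpha> assume "H \<in> Obj (Fun ?B M)" and \<alpha>: "\<alpha> \<in> hom (Fun ?A M) X (precomp ?A H (mono_functor h))"
    then have H: "H \<in> functors ?B M" by simp
    note Xh = poset_functorD(2)[OF X] and Hh = poset_functorD(2)[OF H]
    have \<alpha>h: "ncomp \<alpha> x \<in> hom M (fobj X x) (fobj H (h x))" if "x \<in> A" for x
      using ntrans_posetD(1)[OF \<alpha> that] that by simp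
    have \<alpha>n: "Comp M (ncomp \<alpha> y) (farr X (x, y)) = Comp M (farr H (h x, h y)) (ncomp \<alpha> x)"
      if "x \<in> A" "y \<in> A" "(x, y) \<in> r" for x y
      using ntrans_posetD(2)[OF \<alpha> that] that by simp
    \<comment> \<open>The transpose of \<open>\<alpha>\<close>: evaluate at \<open>i y\<close>, then
      go back along the counit \<open>h (i y) \<le> y\<close>.\<close>
    let ?c = "\<lambda>y. Comp M (farr H (h (i y), y)) (ncomp \<alpha> (i y))"
    let ?\<beta> = "ntransf ?B ?L H ?c"
    have \<beta>: "?\<beta> \<in> hom (Fun ?B M) ?L H"
    proof (rule ntransf_hom[OF L H])
      fix x assume x: "x \<in> B"
      show "?c x \<in> hom M (fobj ?L x) (fobj H x)"
        using Comp_hom[OF M \<alpha>h[OF iA[OF x]] Hh[OF hB[OF iA[OF x]] x counit[OF x]]] x by simp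
      fix y assume y: "y \<in> B" and xy: "(x, y) \<in> s"
      note ix = iA[OF x] and iy = iA[OF y]
      note hix = hB[OF ix] and hiy = hB[OF iy]
      have "Comp M (?c y) (farr X (i x, i y))
          = Comp M (farr H (h (i y), y)) (Comp M (farr H (h (i x), h (i y))) (ncomp \<alpha> (i x)))"
        using Comp_assoc[OF M Xh[OF ix iy monoi[OF x y xy]] \<alpha>h[OF iy] Hh[OF hiy y counit[OF y]]]
          \<alpha>n[OF ix iy monoi[OF x y xy]] by simp
      also have "\<dots> = Comp M (farr H (h (i x), y)) (ncomp \<alpha> (i x))"
        using Comp_assoc[OF M \<alpha>h[OF ix] Hh[OF hix hiy monoh[OF ix iy monoi[OF x y xy]]]
            Hh[OF hiy y counit[OF y]]]
          poset_functorD(4)[OF H hix hiy y monoh[OF ix iy monoi[OF x y xy]] counit[OF y]] by simp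
      also have "\<dots> = Comp M (farr H (x, y)) (?c x)"
        using Comp_assoc[OF M \<alpha>h[OF ix] Hh[OF hix x counit[OF x]] Hh[OF x y xy]]
          poset_functorD(4)[OF H hix x y counit[OF x] xy] by simp
      finally show "Comp M (?c y) (farr ?L (x, y)) = Comp M (farr H (x, y)) (?c x)"
        using x y xy by simp
    qed
    show "\<exists>!\<beta>. \<beta> \<in> hom (Fun ?B M) ?L H \<and> Comp (Fun ?A M) (whisker ?A \<beta> (mono_functor h)) \<eta> = \<alpha>"
    proof (intro ex1I[of _ ?\<beta>] conjI)
      show "Comp (Fun ?A M) (whisker ?A ?\<beta> (mono_functor h)) \<eta> = \<alpha>"
      proof (rule ntrans_eqI[OF Comp_hom[OF category_Fun[OF cA M] \<eta> whisker_hom[OF cA fh \<beta>]] \<alpha>])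
        fix x assume "x \<in> Obj ?A"
        then have x: "x \<in> A" by simp
        note hx = hB[OF x] note ihx = iA[OF hx] note hihx = hB[OF ihx]
        have "Comp M (?c (h x)) (farr X (x, i (h x)))
            = Comp M (farr H (h (i (h x)), h x)) (Comp M (farr H (h x, h (i (h x)))) (ncomp \<alpha> x))"
          using Comp_assoc[OF M Xh[OF x ihx unit[OF x]] \<alpha>h[OF ihx] Hh[OF hihx hx counit[OF hx]]]
            \<alpha>n[OF x ihx unit[OF x]] by simp
        also have "\<dots> = ncomp \<alpha> x"
          using Comp_assoc[OF M \<alpha>h[OF x] Hh[OF hx hihx monoh[OF x ihx unit[OF x]]]
              Hh[OF hihx hx counit[OF hx]]]
            poset_functorD(4)[OF H hx hihx hx monoh[OF x ihx unit[OF x]] counit[OF hx]]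
            poset_functorD(3)[OF H hx] Comp_Ident_left[OF M \<alpha>h[OF x]] by simp
        finally show "ncomp (Comp (Fun ?A M) (whisker ?A ?\<beta> (mono_functor h)) \<eta>) x = ncomp \<alpha> x"
          using x hx by (simp add: \<eta>_def)
      qed
      fix \<beta>' assume *: "\<beta>' \<in> hom (Fun ?B M) ?L H \<and>
        Comp (Fun ?A M) (whisker ?A \<beta>' (mono_functor h)) \<eta> = \<alpha>"
      then have \<beta>': "\<beta>' \<in> hom (Fun ?B M) ?L H" by simp
      show "\<beta>' = ?\<beta>"
      proof (rule ntrans_eqI[OF \<beta>' \<beta>])
        fix y assume "y \<in> Obj ?B"
        then have y: "y \<in> B" by simp
        note iy = iA[OF y] note hiy = hB[OF iy] note ihiy = iA[OF hiy]
        have \<beta>'h: "ncomp \<beta>' z \<in> hom M (fobj X (i z)) (fobj H z)" if "z \<in> B" for z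
          using ntrans_posetD(1)[OF \<beta>' that] that by simp
        \<comment> \<open>The component of \<open>\<beta>'\<close> at \<open>y\<close> is recovered
          from the one at \<open>h (i y)\<close> by naturality along the counit; the round trip from
          \<open>i y\<close> through \<open>i (h (i y))\<close> acts as the identity.\<close>
        have "ncomp \<alpha> (i y) = Comp M (ncomp \<beta>' (h (i y))) (farr X (i y, i (h (i y))))"
          using * iy by (auto simp: \<eta>_def)
        then have "?c y = Comp M (Comp M (farr H (h (i y), y)) (ncomp \<beta>' (h (i y))))
            (farr X (i y, i (h (i y))))"
          using Comp_assoc[OF M Xh[OF iy ihiy unit[OF iy]] \<beta>'h[OF hiy] Hh[OF hiy y counit[OF y]]]
          by simp
        also have "\<dots> = Comp M (Comp M (ncomp \<beta>' y) (farr X (i (h (i y)), i y)))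
            (farr X (i y, i (h (i y))))"
          using ntrans_posetD(2)[OF \<beta>' hiy y counit[OF y]] hiy y counit[OF y] by simp
        also have "\<dots> = ncomp \<beta>' y"
          using Comp_assoc[OF M Xh[OF iy ihiy unit[OF iy]]
              Xh[OF ihiy iy monoi[OF hiy y counit[OF y]]] \<beta>'h[OF y]]
            poset_functorD(4)[OF X iy ihiy iy unit[OF iy] monoi[OF hiy y counit[OF y]]]
            poset_functorD(3)[OF X iy] Comp_Ident_right[OF M \<beta>'h[OF y]] by simp
        finally show "ncomp \<beta>' y = ncomp ?\<beta> y" using y by simp
      qed
    qed (rule \<beta>)
  qed (use L \<eta> in auto)
  then show thesis by (rule that) (simp add: \<eta>_def)
qed

section \<open>Colimits and pointwise left Kan extensions\<close>

text \<open>Bicompleteness speaks only of index categories with objects and arrows in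
  \<open>'u\<close>. Hence \<open>J\<close> is copied there along \<open>f\<close> and
  \<open>g\<close>, and cocones under the two diagrams correspond.\<close>

lemma small_colimit_exists:
  fixes f :: "'i \<Rightarrow> 'u" and g :: "'j \<Rightarrow> 'u" and J :: "('i, 'j) cat"
  assumes bi: "bicomplete TYPE('u) M" and J: "category J"
    and f: "inj_on f (Obj J)" and g: "inj_on g (Arr J)" and D: "is_functor J M D"
  obtains c \<kappa> where "is_colimit J M D c \<kappa>"
proof -
  define f' where "f' = the_inv_into (Obj J) f"
  define g' where "g' = the_inv_into (Arr J) g"
  have f' [simp]: "f' (f x) = x" if "x \<in> Obj J" for x
    unfolding f'_def by (rule the_inv_into_f_f[OF f that])
  have g' [simp]: "g' (g x) = x" if "x \<in> Arr J" for x
    unfolding g'_def by (rule the_inv_into_f_f[OF g that])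
  define J' where "J' = \<lparr> Obj = f ` Obj J, Arr = g ` Arr J, Dom = f \<circ> Dom J \<circ> g',
     Cod = f \<circ> Cod J \<circ> g', Ident = g \<circ> Ident J \<circ> f', Comp = (\<lambda>b a. g (Comp J (g' b) (g' a))) \<rparr>"
  define D' where "D' = \<lparr> fobj = fobj D \<circ> f', farr = farr D \<circ> g' \<rparr>"
  have J'_simps [simp]: "Obj J' = f ` Obj J" "Arr J' = g ` Arr J"
    "\<And>a. a \<in> Arr J \<Longrightarrow> Dom J' (g a) = f (Dom J a)" "\<And>a. a \<in> Arr J \<Longrightarrow> Cod J' (g a) = f (Cod J a)"
    "\<And>x. x \<in> Obj J \<Longrightarrow> Ident J' (f x) = g (Ident J x)"
    "\<And>a b. a \<in> Arr J \<Longrightarrow> b \<in> Arr J \<Longrightarrow> Comp J' (g b) (g a) = g (Comp J b a)"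
    "\<And>x. x \<in> Obj J \<Longrightarrow> fobj D' (f x) = fobj D x" "\<And>a. a \<in> Arr J \<Longrightarrow> farr D' (g a) = farr D a"
    by (auto simp: J'_def D'_def)
  have DC: "Dom J a \<in> Obj J" "Cod J a \<in> Obj J" if "a \<in> Arr J" for a
    using hom_Obj[OF J hom_Dom_Cod[OF that]] by auto
  have hom'I: "g b \<in> hom J' (f p) (f q)" if "b \<in> hom J p q" for b p q
    using homD[OF that] by (auto simp: hom_def)
  have hom'E: thesis
    if a: "a \<in> hom J' (f p) y" and p: "p \<in> Obj J"
      and r: "\<And>b q. b \<in> hom J p q \<Longrightarrow> a = g b \<Longrightarrow> y = f q \<Longrightarrow> q \<in> Obj J \<Longrightarrow> thesis" for a p y thesis
  proof -
    obtain b where b: "b \<in> Arr J" "a = g b" using homD(1)[OF a] by auto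
    then have "f (Dom J b) = f p" "y = f (Cod J b)" using homD(2,3)[OF a] by auto
    then show thesis
      using r[of b "Cod J b"] b DC[OF b(1)] inj_onD[OF f, of "Dom J b" p] p by (auto intro: homI)
  qed
  have hom'O: "x \<in> f ` Obj J" if "a \<in> hom J' x y" for a x y
    using homD[OF that] DC by auto
  have J': "category J'"
  proof (rule categoryI)
    show "Dom J' a \<in> Obj J' \<and> Cod J' a \<in> Obj J'" if "a \<in> Arr J'" for a
      using that DC by auto
    show "Ident J' x \<in> hom J' x x" if "x \<in> Obj J'" for x
      using that hom'I[OF Ident_hom[OF J]] by auto
    fix a x y assume a: "a \<in> hom J' x y"
    then obtain p where p: "p \<in> Obj J" "x = f p" using hom'O by blast
    obtain a0 q where a0: "a0 \<in> hom J p q" "a = g a0" "y = f q" "q \<in> Obj J"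
      using hom'E[OF _ p(1)] a p(2) by blast
    show "Comp J' a (Ident J' x) = a" "Comp J' (Ident J' y) a = a"
      using Comp_Ident_left[OF J a0(1)] Comp_Ident_right[OF J a0(1)] homD(1)[OF a0(1)]
        homD(1)[OF Ident_hom[OF J p(1)]] homD(1)[OF Ident_hom[OF J a0(4)]] p a0 by auto
    fix b z assume "b \<in> hom J' y z"
    then obtain b0 s where b0: "b0 \<in> hom J q s" "b = g b0" "z = f s" "s \<in> Obj J"
      using hom'E[OF _ a0(4)] a0(3) by blast
    show "Comp J' b a \<in> hom J' x z"
      using hom'I[OF Comp_hom[OF J a0(1) b0(1)]] homD(1)[OF a0(1)] homD(1)[OF b0(1)] p a0 b0 by simp
    fix c w assume "c \<in> hom J' z w"
    then obtain c0 t where c0: "c0 \<in> hom J s t" "c = g c0"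
      using hom'E[OF _ b0(4)] b0(3) by blast
    show "Comp J' c (Comp J' b a) = Comp J' (Comp J' c b) a"
      using homD(1)[OF a0(1)] homD(1)[OF b0(1)] homD(1)[OF c0(1)] Comp_assoc[OF J a0(1) b0(1) c0(1)]
        homD(1)[OF Comp_hom[OF J a0(1) b0(1)]] homD(1)[OF Comp_hom[OF J b0(1) c0(1)]]
      by (simp add: a0 b0 c0)
  qed
  have D': "is_functor J' M D'"
    unfolding is_functor_def
  proof (intro conjI ballI impI)
    show "fobj D' x \<in> Obj M" "farr D' (Ident J' x) = Ident M (fobj D' x)" if "x \<in> Obj J'" for x
      using that is_functorD(1,3)[OF D] homD(1)[OF Ident_hom[OF J]] by auto
    fix a assume "a \<in> Arr J'"
    then obtain a0 where a0: "a0 \<in> Arr J" "a = g a0" by auto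
    show "farr D' a \<in> hom M (fobj D' (Dom J' a)) (fobj D' (Cod J' a))"
      using a0 is_functorD(2)[OF D hom_Dom_Cod[OF a0(1)]] DC[OF a0(1)] by simp
    fix b assume "b \<in> Arr J'" and eq: "Cod J' a = Dom J' b"
    then obtain b0 where b0: "b0 \<in> Arr J" "b = g b0" by auto
    have "Cod J a0 = Dom J b0"
      using eq a0 b0 DC inj_onD[OF f, of "Cod J a0" "Dom J b0"] by simp
    then have b0': "b0 \<in> hom J (Cod J a0) (Cod J b0)" using b0 by (auto intro: homI)
    show "farr D' (Comp J' b a) = Comp M (farr D' b) (farr D' a)"
      using is_functorD(4)[OF D hom_Dom_Cod[OF a0(1)] b0'] a0 b0
        homD(1)[OF Comp_hom[OF J hom_Dom_Cod[OF a0(1)] b0']] by simp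
  qed
  have cocone: "is_cocone J' M D' c \<kappa> \<longleftrightarrow> is_cocone J M D c (\<kappa> \<circ> f)" for c \<kappa>
    using DC by (auto simp: is_cocone_def)
  obtain c \<kappa> where c: "is_colimit J' M D' c \<kappa>"
    using bi J' D' unfolding bicomplete_def by blast
  have "is_colimit J M D c (\<kappa> \<circ> f)"
    unfolding is_colimit_def
  proof (intro conjI allI impI)
    show "is_cocone J M D c (\<kappa> \<circ> f)" using c cocone by (auto simp: is_colimit_def)
    fix c' \<kappa>' assume "is_cocone J M D c' \<kappa>'"
    then have "is_cocone J M D c' ((\<kappa>' \<circ> f') \<circ> f)"
      using DC unfolding is_cocone_def by auto
    then have "\<exists>!h. h \<in> hom M c c' \<and> (\<forall>j\<in>Obj J'. Comp M h (\<kappa> j) = (\<kappa>' \<circ> f') j)"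
      using c cocone unfolding is_colimit_def by blast
    then show "\<exists>!h. h \<in> hom M c c' \<and> (\<forall>j\<in>Obj J. Comp M h ((\<kappa> \<circ> f) j) = \<kappa>' j)"
      by simp
  qed
  then show thesis by (rule that)
qed

lemma is_cocone_poset_cat:
  "is_cocone (poset_cat A r) M D c \<kappa> \<longleftrightarrow> c \<in> Obj M \<and> (\<forall>j\<in>A. \<kappa> j \<in> hom M (fobj D j) c) \<and>
     (\<forall>j\<in>A. \<forall>j'\<in>A. (j, j') \<in> r \<longrightarrow> Comp M (\<kappa> j') (farr D (j, j')) = \<kappa> j)"
  by (simp add: is_cocone_def Ball_def split_paired_all) blast

lemma colimit_factor:
  assumes "is_colimit J M D c \<kappa>" "is_cocone J M D c' \<kappa>'"
  obtains h where "h \<in> hom M c c'" "\<And>j. j \<in> Obj J \<Longrightarrow> Comp M h (\<kappa> j) = \<kappa>' j"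
  using assms unfolding is_colimit_def by blast

lemma colimit_unique:
  assumes M: "category M" and c: "is_colimit J M D c \<kappa>" and J: "category J" and D: "is_functor J M D"
    and h: "h \<in> hom M c c'" and h': "h' \<in> hom M c c'"
    and eq: "\<And>j. j \<in> Obj J \<Longrightarrow> Comp M h (\<kappa> j) = Comp M h' (\<kappa> j)"
  shows "h = h'"
proof -
  have \<kappa>: "\<kappa> j \<in> hom M (fobj D j) c" if "j \<in> Obj J" for j
    using c that by (auto simp: is_colimit_def is_cocone_def)
  have \<kappa>n: "Comp M (\<kappa> (Cod J u)) (farr D u) = \<kappa> (Dom J u)" if "u \<in> Arr J" for u
    using c that by (auto simp: is_colimit_def is_cocone_def)
  have "is_cocone J M D c' (\<lambda>j. Comp M h (\<kappa> j))"
    unfolding is_cocone_def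
  proof (intro conjI ballI)
    show "c' \<in> Obj M" using hom_Obj[OF M h] by simp
    show "Comp M h (\<kappa> j) \<in> hom M (fobj D j) c'" if "j \<in> Obj J" for j
      using Comp_hom[OF M \<kappa>[OF that] h] .
    show "Comp M (Comp M h (\<kappa> (Cod J u))) (farr D u) = Comp M h (\<kappa> (Dom J u))" if "u \<in> Arr J" for u
      using Comp_assoc[OF M is_functorD(2)[OF D hom_Dom_Cod[OF that]]
          \<kappa>[OF hom_Obj(2)[OF J hom_Dom_Cod[OF that]]] h] \<kappa>n[OF that] by simp
  qed
  then have "\<exists>!k. k \<in> hom M c c' \<and> (\<forall>j\<in>Obj J. Comp M k (\<kappa> j) = Comp M h (\<kappa> j))"
    using c unfolding is_colimit_def by blast
  then show ?thesis using h h' eq by metis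
qed

text \<open>A cocone is determined by its leg at the greatest point \<open>b\<close>. This
  particular colimit is the one selected at points of the subposet in the pointwise Kan
  extension.\<close>

lemma is_colimit_greatest:
  assumes M: "category M" and D: "D \<in> functors (poset_cat A r) M"
    and b: "b \<in> A" "refl_on A r" and le: "\<And>a. a \<in> A' \<longleftrightarrow> a \<in> A \<and> (a, b) \<in> r"
  shows "is_colimit (poset_cat A' r) M D (fobj D b) (\<lambda>a. farr D (a, b))"
  unfolding is_colimit_def is_cocone_poset_cat
proof (intro conjI allI impI ballI)
  note bb = refl_onD[OF b(2,1)]
  show "fobj D b \<in> Obj M" using poset_functorD(1)[OF D b(1)] .
  show "farr D (j, b) \<in> hom M (fobj D j) (fobj D b)" if "j \<in> A'" for j
    using poset_functorD(2)[OF D] b le that by auto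
  show "Comp M (farr D (j', b)) (farr D (j, j')) = farr D (j, b)"
    if "j \<in> A'" "j' \<in> A'" "(j, j') \<in> r" for j j'
    using poset_functorD(4)[OF D] b le that by auto
  fix c' \<kappa>' assume co: "c' \<in> Obj M \<and> (\<forall>j\<in>A'. \<kappa>' j \<in> hom M (fobj D j) c') \<and>
     (\<forall>j\<in>A'. \<forall>j'\<in>A'. (j, j') \<in> r \<longrightarrow> Comp M (\<kappa>' j') (farr D (j, j')) = \<kappa>' j)"
  have bA: "b \<in> A'" using le b bb by auto
  show "\<exists>!h. h \<in> hom M (fobj D b) c' \<and> (\<forall>j\<in>Obj (poset_cat A' r). Comp M h (farr D (j, b)) = \<kappa>' j)"
  proof (intro ex1I[of _ "\<kappa>' b"] conjI ballI)
    show "\<kappa>' b \<in> hom M (fobj D b) c'" using co bA by auto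
    show "Comp M (\<kappa>' b) (farr D (j, b)) = \<kappa>' j" if "j \<in> Obj (poset_cat A' r)" for j
      using co bA le that by auto
    fix h assume h: "h \<in> hom M (fobj D b) c' \<and> (\<forall>j\<in>Obj (poset_cat A' r). Comp M h (farr D (j, b)) = \<kappa>' j)"
    then have "Comp M h (farr D (b, b)) = \<kappa>' b" using bA by auto
    then show "h = \<kappa>' b"
      using Comp_Ident_right[OF M, of h] h poset_functorD(3)[OF D b(1)] by auto
  qed
qed

text \<open>Colimits over the slices below \<open>b\<close> are glued. Selecting the value of
  \<open>X\<close> itself at points of \<open>A\<close> makes the unit an identity there, and this
  strictness is what makes the restriction of an extension weakly equivalent to the original
  functor.\<close>

lemma pointwise_left_kan_extension:
  assumes M: "category M" and B: "refl_on B r" "trans_on B r" and AB: "A \<subseteq> B"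
    and X: "X \<in> functors (poset_cat A r) M"
    and colim: "\<And>b. b \<in> B \<Longrightarrow> \<exists>c \<kappa>. is_colimit (poset_cat {a \<in> A. (a, b) \<in> r} r) M X c \<kappa>"
  obtains L \<eta> where
    "is_left_kan_extension (poset_cat A r) (poset_cat B r) M (mono_functor (\<lambda>x. x)) X L \<eta>"
    "\<And>a. a \<in> A \<Longrightarrow> fobj L a = fobj X a" "\<And>a. a \<in> A \<Longrightarrow> ncomp \<eta> a = Ident M (fobj X a)"
proof -
  have A: "refl_on A r" "trans_on A r"
    using B(1) AB trans_on_subset[OF B(2) AB] unfolding refl_on_def by blast+
  let ?A = "poset_cat A r" and ?B = "poset_cat B r" and ?J = "\<lambda>b. poset_cat {a \<in> A. (a, b) \<in> r} r"
    and ?u = "mono_functor (\<lambda>x. x)"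
  note cA = category_poset_cat[OF A] and cB = category_poset_cat[OF B]
  have u: "is_functor ?A ?B ?u" using AB by (intro is_functor_mono_functor) auto
  have bB: "b \<in> B" if "b \<in> A" for b using that AB by auto
  have bb: "(b, b) \<in> r" if "b \<in> B" for b using B that by (auto simp: refl_on_def)
  have tr: "(x, z) \<in> r" if "x \<in> B" "y \<in> B" "z \<in> B" "(x, y) \<in> r" "(y, z) \<in> r" for x y z
    using trans_onD[OF B(2)] that by blast
  \<comment> \<open>All colimits are chosen at once, with the choice forced to be \<open>X\<close>
    on \<open>A\<close>.\<close>
  have "\<exists>p. is_colimit (?J b) M X (fst p) (snd p) \<and> (b \<in> A \<longrightarrow> p = (fobj X b, \<lambda>a. farr X (a, b)))"
    if "b \<in> B" for b
  proof (cases "b \<in> A")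
    case True
    then show ?thesis using is_colimit_greatest[OF M X True A(1), of "{a \<in> A. (a, b) \<in> r}"] by simp
  next
    case False
    then show ?thesis using colim[OF that] by auto
  qed
  then obtain p where p: "\<And>b. b \<in> B \<Longrightarrow> is_colimit (?J b) M X (fst (p b)) (snd (p b)) \<and>
      (b \<in> A \<longrightarrow> p b = (fobj X b, \<lambda>a. farr X (a, b)))"
    using bchoice[of B "\<lambda>b p. is_colimit (?J b) M X (fst p) (snd p) \<and>
      (b \<in> A \<longrightarrow> p = (fobj X b, \<lambda>a. farr X (a, b)))"] by blast
  define c where "c b = fst (p b)" for b
  define \<kappa> where "\<kappa> b = snd (p b)" for b
  have col: "is_colimit (?J b) M X (c b) (\<kappa> b)" if "b \<in> B" for b
    using p[OF that] by (simp add: c_def \<kappa>_def)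
  have triv: "c b = fobj X b" "\<kappa> b a = farr X (a, b)" if "b \<in> A" for a b
    using p[OF bB[OF that]] that by (simp_all add: c_def \<kappa>_def)
  have coc: "is_cocone (?J b) M X (c b) (\<kappa> b)" if "b \<in> B" for b
    using col[OF that] unfolding is_colimit_def by blast
  note coc' = coc[unfolded is_cocone_poset_cat]
  have cO: "c b \<in> Obj M" if "b \<in> B" for b
    using coc'[OF that] by blast
  have \<kappa>: "\<kappa> b a \<in> hom M (fobj X a) (c b)" if "a \<in> A" "b \<in> B" "(a, b) \<in> r" for a b
    using coc'[OF that(2)] that by blast
  have \<kappa>n: "Comp M (\<kappa> b a') (farr X (a, a')) = \<kappa> b a"
    if "a \<in> A" "a' \<in> A" "b \<in> B" "(a, a') \<in> r" "(a', b) \<in> r" for a a' b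
    using coc'[OF that(3)] tr[OF bB[OF that(1)] bB[OF that(2)] that(3-5)] that by blast
  have refl_J: "refl_on {a \<in> A. (a, b) \<in> r} r" and trans_J: "trans_on {a \<in> A. (a, b) \<in> r} r" for b
    using A(1) trans_on_subset[OF A(2), of "{a \<in> A. (a, b) \<in> r}"] unfolding refl_on_def by blast+
  have XJ: "is_functor (?J b) M X" for b
    by (rule is_functor_posetI) (simp_all add: poset_functorD[OF X])
  have unique: "h = h'"
    if "b \<in> B" "h \<in> hom M (c b) d" "h' \<in> hom M (c b) d"
      "\<And>a. a \<in> A \<Longrightarrow> (a, b) \<in> r \<Longrightarrow> Comp M h (\<kappa> b a) = Comp M h' (\<kappa> b a)" for b h h' d
    using colimit_unique[OF M col[OF that(1)] category_poset_cat[OF refl_J trans_J] XJ that(2,3)] that(4)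
    by simp
  have "\<exists>h. h \<in> hom M (c b) (c b') \<and> (\<forall>a\<in>A. (a, b) \<in> r \<longrightarrow> Comp M h (\<kappa> b a) = \<kappa> b' a)"
    if "b \<in> B" "b' \<in> B" "(b, b') \<in> r" for b b'
  proof -
    have "is_cocone (?J b) M X (c b') (\<kappa> b')"
      unfolding is_cocone_poset_cat using cO[OF that(2)] \<kappa>[OF _ that(2)] \<kappa>n[OF _ _ that(2)]
        tr[OF bB that(1,2) _ that(3)] by auto
    from colimit_factor[OF col[OF that(1)] this] show ?thesis by (metis (no_types, lifting) mem_Collect_eq poset_cat_simps(1))
  qed
  then obtain l where l: "\<And>b b'. b \<in> B \<Longrightarrow> b' \<in> B \<Longrightarrow> (b, b') \<in> r \<Longrightarrow> l b b' \<in> hom M (c b) (c b')"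
    and l\<kappa>: "\<And>b b' a. b \<in> B \<Longrightarrow> b' \<in> B \<Longrightarrow> (b, b') \<in> r \<Longrightarrow> a \<in> A \<Longrightarrow> (a, b) \<in> r \<Longrightarrow>
       Comp M (l b b') (\<kappa> b a) = \<kappa> b' a" by metis
  let ?L = "diagram B r c l"
  have L: "?L \<in> functors ?B M"
  proof (rule diagram_functors[OF B cO l])
    show "l b b = Ident M (c b)" if b: "b \<in> B" for b
      using unique[OF b l[OF b b bb[OF b]] Ident_hom[OF M cO[OF b]]] l\<kappa>[OF b b bb[OF b]]
        Comp_Ident_left[OF M \<kappa>[OF _ b]] by auto
    show "l x z = Comp M (l y z) (l x y)"
      if x: "x \<in> B" and y: "y \<in> B" and z: "z \<in> B" and xy: "(x, y) \<in> r" and yz: "(y, z) \<in> r" for x y z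
    proof (rule unique[OF x l[OF x z tr[OF x y z xy yz]] Comp_hom[OF M l[OF x y xy] l[OF y z yz]]])
      fix a assume a: "a \<in> A" and ax: "(a, x) \<in> r"
      show "Comp M (l x z) (\<kappa> x a) = Comp M (Comp M (l y z) (l x y)) (\<kappa> x a)"
        using Comp_assoc[OF M \<kappa>[OF a x ax] l[OF x y xy] l[OF y z yz]] l\<kappa>[OF x z tr[OF x y z xy yz] a ax]
          l\<kappa>[OF x y xy a ax] l\<kappa>[OF y z yz a tr[OF bB[OF a] x y ax xy]] by simp
    qed
  qed
  define \<eta> where "\<eta> = ntransf ?A X (precomp ?A ?L ?u) (\<lambda>a. \<kappa> a a)"
  have \<eta>: "\<eta> \<in> hom (Fun ?A M) X (precomp ?A ?L ?u)"
    unfolding \<eta>_def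
  proof (rule ntransf_hom[OF X precomp_functors[OF cA u L]])
    show "\<kappa> a a \<in> hom M (fobj X a) (fobj (precomp ?A ?L ?u) a)" if "a \<in> A" for a
      using \<kappa>[OF that bB[OF that] bb[OF bB[OF that]]] that bB by simp
    show "Comp M (\<kappa> y y) (farr X (x, y)) = Comp M (farr (precomp ?A ?L ?u) (x, y)) (\<kappa> x x)"
      if "x \<in> A" "y \<in> A" "(x, y) \<in> r" for x y
      using \<kappa>n[of x y y] l\<kappa>[of x y x] that bB bb by simp
  qed
  have "is_left_kan_extension ?A ?B M ?u X ?L \<eta>"
    unfolding is_left_kan_extension_def
  proof (intro conjI ballI)
    fix H \<alpha> assume "H \<in> Obj (Fun ?B M)" and \<alpha>: "\<alpha> \<in> hom (Fun ?A M) X (precomp ?A H ?u)"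
    then have H: "H \<in> functors ?B M" by simp
    note Hh = poset_functorD(2)[OF H] and Xh = poset_functorD(2)[OF X]
    have \<alpha>h: "ncomp \<alpha> a \<in> hom M (fobj X a) (fobj H a)" if "a \<in> A" for a
      using ntrans_posetD(1)[OF \<alpha> that] that by simp
    have \<alpha>n: "Comp M (ncomp \<alpha> y) (farr X (x, y)) = Comp M (farr H (x, y)) (ncomp \<alpha> x)"
      if "x \<in> A" "y \<in> A" "(x, y) \<in> r" for x y
      using ntrans_posetD(2)[OF \<alpha> that] that by simp
    have "\<exists>h. h \<in> hom M (c b) (fobj H b) \<and>
        (\<forall>a\<in>A. (a, b) \<in> r \<longrightarrow> Comp M h (\<kappa> b a) = Comp M (farr H (a, b)) (ncomp \<alpha> a))"
      if b: "b \<in> B" for b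
    proof -
      have "is_cocone (?J b) M X (fobj H b) (\<lambda>a. Comp M (farr H (a, b)) (ncomp \<alpha> a))"
        unfolding is_cocone_poset_cat
      proof (intro conjI ballI impI)
        show "fobj H b \<in> Obj M" using poset_functorD(1)[OF H b] .
        show "Comp M (farr H (a, b)) (ncomp \<alpha> a) \<in> hom M (fobj X a) (fobj H b)"
          if "a \<in> {a \<in> A. (a, b) \<in> r}" for a
          using Comp_hom[OF M \<alpha>h Hh[OF bB b]] that by simp
        fix a a' assume "a \<in> {a \<in> A. (a, b) \<in> r}" "a' \<in> {a \<in> A. (a, b) \<in> r}" and aa': "(a, a') \<in> r"
        then have a: "a \<in> A" "(a, b) \<in> r" and a': "a' \<in> A" "(a', b) \<in> r" by auto
        show "Comp M (Comp M (farr H (a', b)) (ncomp \<alpha> a')) (farr X (a, a'))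
            = Comp M (farr H (a, b)) (ncomp \<alpha> a)"
          using Comp_assoc[OF M Xh[OF a(1) a'(1) aa'] \<alpha>h[OF a'(1)] Hh[OF bB[OF a'(1)] b a'(2)]]
            Comp_assoc[OF M \<alpha>h[OF a(1)] Hh[OF bB[OF a(1)] bB[OF a'(1)] aa'] Hh[OF bB[OF a'(1)] b a'(2)]]
            \<alpha>n[OF a(1) a'(1) aa'] poset_functorD(4)[OF H bB[OF a(1)] bB[OF a'(1)] b aa' a'(2)]
          by simp
      qed
      from colimit_factor[OF col[OF b] this] show ?thesis
        by (metis (no_types, lifting) mem_Collect_eq poset_cat_simps(1))
    qed
    then obtain h where h: "\<And>b. b \<in> B \<Longrightarrow> h b \<in> hom M (c b) (fobj H b)"
      and h\<kappa>: "\<And>b a. b \<in> B \<Longrightarrow> a \<in> A \<Longrightarrow> (a, b) \<in> r \<Longrightarrow>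
         Comp M (h b) (\<kappa> b a) = Comp M (farr H (a, b)) (ncomp \<alpha> a)" by metis
    let ?\<beta> = "ntransf ?B ?L H h"
    have \<beta>: "?\<beta> \<in> hom (Fun ?B M) ?L H"
    proof (rule ntransf_hom[OF L H])
      show "h b \<in> hom M (fobj ?L b) (fobj H b)" if "b \<in> B" for b using h that by simp
      fix x y assume x: "x \<in> B" and y: "y \<in> B" and xy: "(x, y) \<in> r"
      have "Comp M (h y) (l x y) = Comp M (farr H (x, y)) (h x)"
      proof (rule unique[OF x Comp_hom[OF M l[OF x y xy] h[OF y]] Comp_hom[OF M h[OF x] Hh[OF x y xy]]])
        fix a assume a: "a \<in> A" and ax: "(a, x) \<in> r"
        note ay = tr[OF bB[OF a] x y ax xy]
        show "Comp M (Comp M (h y) (l x y)) (\<kappa> x a) = Comp M (Comp M (farr H (x, y)) (h x)) (\<kappa> x a)"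
          using Comp_assoc[OF M \<kappa>[OF a x ax] l[OF x y xy] h[OF y]] l\<kappa>[OF x y xy a ax]
            Comp_assoc[OF M \<kappa>[OF a x ax] h[OF x] Hh[OF x y xy]] h\<kappa>[OF x a ax] h\<kappa>[OF y a ay]
            Comp_assoc[OF M \<alpha>h[OF a] Hh[OF bB[OF a] x ax] Hh[OF x y xy]]
            poset_functorD(4)[OF H bB[OF a] x y ax xy] by simp
      qed
      then show "Comp M (h y) (farr ?L (x, y)) = Comp M (farr H (x, y)) (h x)" using x y xy by simp
    qed
    show "\<exists>!\<beta>. \<beta> \<in> hom (Fun ?B M) ?L H \<and> Comp (Fun ?A M) (whisker ?A \<beta> ?u) \<eta> = \<alpha>"
    proof (intro ex1I[of _ ?\<beta>] conjI)
      show "Comp (Fun ?A M) (whisker ?A ?\<beta> ?u) \<eta> = \<alpha>"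
      proof (rule ntrans_eqI[OF Comp_hom[OF category_Fun[OF cA M] \<eta> whisker_hom[OF cA u \<beta>]] \<alpha>])
        fix a assume "a \<in> Obj ?A"
        then have a: "a \<in> A" by simp
        show "ncomp (Comp (Fun ?A M) (whisker ?A ?\<beta> ?u) \<eta>) a = ncomp \<alpha> a"
          using a bB[OF a] h\<kappa>[OF bB[OF a] a bb[OF bB[OF a]]] poset_functorD(3)[OF H bB[OF a]]
            Comp_Ident_left[OF M \<alpha>h[OF a]] by (simp add: \<eta>_def)
      qed
      fix \<beta>' assume *: "\<beta>' \<in> hom (Fun ?B M) ?L H \<and> Comp (Fun ?A M) (whisker ?A \<beta>' ?u) \<eta> = \<alpha>"
      then have \<beta>': "\<beta>' \<in> hom (Fun ?B M) ?L H" by simp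
      have \<beta>'h: "ncomp \<beta>' b \<in> hom M (c b) (fobj H b)" if "b \<in> B" for b
        using ntrans_posetD(1)[OF \<beta>' that] that by simp
      have \<beta>'\<alpha>: "Comp M (ncomp \<beta>' a) (\<kappa> a a) = ncomp \<alpha> a" if "a \<in> A" for a
        using * that by (auto simp: \<eta>_def)
      show "\<beta>' = ?\<beta>"
      proof (rule ntrans_eqI[OF \<beta>' \<beta>])
        fix b assume "b \<in> Obj ?B"
        then have b: "b \<in> B" by simp
        have "ncomp \<beta>' b = h b"
        proof (rule unique[OF b \<beta>'h[OF b] h[OF b]])
          fix a assume a: "a \<in> A" and ab: "(a, b) \<in> r"
          note aB = bB[OF a]
          \<comment> \<open>The leg from \<open>a\<close> into \<open>c b\<close> is the transition
            map \<open>l a b\<close> after the unit at \<open>a\<close>, so naturality reduces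
            \<open>\<beta>'\<close> to its components over \<open>A\<close>.\<close>
          have "Comp M (ncomp \<beta>' b) (\<kappa> b a) = Comp M (ncomp \<beta>' b) (Comp M (l a b) (\<kappa> a a))"
            using l\<kappa>[OF aB b ab a bb[OF aB]] by simp
          also have "\<dots> = Comp M (Comp M (farr H (a, b)) (ncomp \<beta>' a)) (\<kappa> a a)"
            using Comp_assoc[OF M \<kappa>[OF a aB bb[OF aB]] l[OF aB b ab] \<beta>'h[OF b]]
              ntrans_posetD(2)[OF \<beta>' aB b ab] aB b ab by simp
          also have "\<dots> = Comp M (farr H (a, b)) (ncomp \<alpha> a)"
            using Comp_assoc[OF M \<kappa>[OF a aB bb[OF aB]] \<beta>'h[OF aB] Hh[OF aB b ab]] \<beta>'\<alpha>[OF a] by simp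
          finally show "Comp M (ncomp \<beta>' b) (\<kappa> b a) = Comp M (h b) (\<kappa> b a)"
            using h\<kappa>[OF b a ab] by simp
        qed
        then show "ncomp \<beta>' b = ncomp ?\<beta> b" using b by simp
      qed
    qed (rule \<beta>)
  qed (use L \<eta> in auto)
  moreover have "fobj ?L a = fobj X a" "ncomp \<eta> a = Ident M (fobj X a)" if "a \<in> A" for a
    using that bB triv poset_functorD(3)[OF X] by (auto simp: \<eta>_def)
  ultimately show thesis by (rule that)
qed

section \<open>Restriction along identities and along right adjoints\<close>

lemma precomp_Ident:
  assumes "X \<in> functors J M" "\<And>x. x \<in> Obj J \<Longrightarrow> fobj u x = x" "\<And>f. f \<in> Arr J \<Longrightarrow> farr u f = f"
  shows "precomp J X u = X"
proof -
  have "fobj (precomp J X u) = fobj X"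
    by (rule extensionalityI[of _ "Obj J"]) (use assms in \<open>auto simp: functors_def precomp_def compose_def\<close>)
  moreover have "farr (precomp J X u) = farr X"
    by (rule extensionalityI[of _ "Arr J"]) (use assms in \<open>auto simp: functors_def precomp_def compose_def\<close>)
  ultimately show ?thesis by simp
qed

lemma whisker_Ident_functor:
  assumes "t \<in> hom (Fun J M) X Y"
    and "\<And>x. x \<in> Obj J \<Longrightarrow> fobj u x = x" "\<And>f. f \<in> Arr J \<Longrightarrow> farr u f = f"
  shows "whisker J t u = t"
proof -
  have "ncomp (whisker J t u) = ncomp t"
    by (rule extensionalityI[of _ "Obj J"])
      (use assms(1,2) in \<open>auto simp: hom_Fun_iff whisker_def compose_def\<close>)
  moreover have "nsrc (whisker J t u) = nsrc t" "ntgt (whisker J t u) = ntgt t"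
    using precomp_Ident[OF hom_FunD(1)[OF assms(1)] assms(2,3)]
      precomp_Ident[OF hom_FunD(2)[OF assms(1)] assms(2,3)] assms(1)
    by (auto simp: hom_Fun_iff whisker_def)
  ultimately show ?thesis by simp
qed

text \<open>Restriction along \<open>i\<close> is left Kan extension along \<open>h\<close>, so
  transposition of lifting problems applies to the restricted map. Used in both directions of a
  poset isomorphism, it transports cofibrations.\<close>

lemma has_lifting_Galois:
  assumes M: "category M"
    and A: "refl_on A r" "trans_on A r" and B: "refl_on B s" "trans_on B s"
    and h: "h \<in> A \<rightarrow> B" and i: "i \<in> B \<rightarrow> A"
    and adj: "\<And>x y. x \<in> A \<Longrightarrow> y \<in> B \<Longrightarrow> (h x, y) \<in> s \<longleftrightarrow> (x, i y) \<in> r"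
    and fh: "is_functor (poset_cat A r) (poset_cat B s) (mono_functor h)"
    and fi: "is_functor (poset_cat B s) (poset_cat A r) (mono_functor i)"
    and g: "g \<in> hom (Fun (poset_cat A r) M) X Y" and p: "p \<in> hom (Fun (poset_cat B s) M) E D"
    and lift: "has_lifting (Fun (poset_cat A r) M) g (whisker (poset_cat A r) p (mono_functor h))"
  shows "has_lifting (Fun (poset_cat B s) M) (whisker (poset_cat B s) g (mono_functor i)) p"
proof -
  let ?A = "poset_cat A r" and ?B = "poset_cat B s"
  note cA = category_poset_cat[OF A] and cB = category_poset_cat[OF B]
  note X = hom_FunD(1)[OF g] and Y = hom_FunD(2)[OF g]
  obtain \<eta> where \<eta>: "is_left_kan_extension ?A ?B M (mono_functor h) X
      (precomp ?B X (mono_functor i)) \<eta>" "\<And>x. x \<in> A \<Longrightarrow> ncomp \<eta> x = farr X (x, i (h x))"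
    using left_kan_extension_Galois[OF M A B h i adj X] by metis
  obtain \<eta>' where \<eta>': "is_left_kan_extension ?A ?B M (mono_functor h) Y
      (precomp ?B Y (mono_functor i)) \<eta>'" "\<And>x. x \<in> A \<Longrightarrow> ncomp \<eta>' x = farr Y (x, i (h x))"
    using left_kan_extension_Galois[OF M A B h i adj Y] by metis
  note e = left_kan_extensionD(2)[OF cA cB M fh \<eta>(1)] and e' = left_kan_extensionD(2)[OF cA cB M fh \<eta>'(1)]
  note wg = whisker_hom[OF cB fi g]
  have "Comp (Fun ?A M) (whisker ?A (whisker ?B g (mono_functor i)) (mono_functor h)) \<eta>
      = Comp (Fun ?A M) \<eta>' g"
  proof (rule ntrans_eqI[OF Comp_hom[OF category_Fun[OF cA M] e whisker_hom[OF cA fh wg]]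
        Comp_hom[OF category_Fun[OF cA M] g e']])
    fix x assume "x \<in> Obj ?A"
    then have x: "x \<in> A" by simp
    have hx: "h x \<in> B" using x h by auto
    have ihx: "i (h x) \<in> A" using hx i by auto
    \<comment> \<open>The required square is naturality of \<open>g\<close> along the unit of the
      Galois connection.\<close>
    have "(x, i (h x)) \<in> r" using adj[OF x hx] refl_onD[OF B(1) hx] by simp
    then show "ncomp (Comp (Fun ?A M) (whisker ?A (whisker ?B g (mono_functor i)) (mono_functor h)) \<eta>) x
        = ncomp (Comp (Fun ?A M) \<eta>' g) x"
      using x hx ihx ntrans_posetD(2)[OF g x ihx] \<eta>(2)[OF x] \<eta>'(2)[OF x] by simp
  qed
  from has_lifting_left_kan_extension[OF cA cB M fh \<eta>(1) \<eta>'(1) g wg this p lift] show ?thesis .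
qed

section \<open>Zigzags of objectwise weak equivalences\<close>

lemma weakly_equivalentI:
  "t \<in> hom (Fun J M) X Y \<Longrightarrow> t \<in> objectwise J M (Weq S) \<Longrightarrow> weakly_equivalent J M S X Y"
  unfolding weakly_equivalent_def by (intro r_into_equivclp) blast

lemma weakly_equivalent_refl: "weakly_equivalent J M S X X"
  by (simp add: weakly_equivalent_def)

lemma weakly_equivalent_sym: "weakly_equivalent J M S X Y \<Longrightarrow> weakly_equivalent J M S Y X"
  unfolding weakly_equivalent_def by (rule equivclp_sym)

lemma weakly_equivalent_trans:
  "weakly_equivalent J M S X Y \<Longrightarrow> weakly_equivalent J M S Y Z \<Longrightarrow> weakly_equivalent J M S X Z"
  unfolding weakly_equivalent_def by (rule equivclp_trans)

lemma weakly_equivalent_precomp: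
  assumes J: "category J" and u: "is_functor J K u" and eq: "weakly_equivalent K M S X Y"
  shows "weakly_equivalent J M S (precomp J X u) (precomp J Y u)"
  using eq unfolding weakly_equivalent_def[of K]
proof (induction rule: equivclp_induct)
  case (step Y Z)
  have "weakly_equivalent J M S (precomp J Y u) (precomp J Z u)"
    if "t \<in> hom (Fun K M) Y Z" "t \<in> objectwise K M (Weq S)" for t Y Z
    using weakly_equivalentI[OF whisker_hom[OF J u that(1)] whisker_objectwise[OF J u that]] .
  then show ?case
    using step weakly_equivalent_trans weakly_equivalent_sym by blast
qed (rule weakly_equivalent_refl)

section \<open>Projective model structures on small posets\<close>

text \<open>The order axioms are asked only on \<open>A\<close>, so one relation serves all
  subposets. The injection stands in for being carried by a subset of \<open>'u\<close>.\<close>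

definition small_poset :: "'u itself \<Rightarrow> 'p set \<Rightarrow> 'p rel \<Rightarrow> bool" where
  "small_poset U A r \<longleftrightarrow> refl_on A r \<and> trans_on A r \<and> antisym_on A r \<and> (\<exists>f :: 'p \<Rightarrow> 'u. inj_on f A)"

lemma small_posetD:
  assumes "small_poset U A r"
  shows "refl_on A r" "trans_on A r" "category (poset_cat A r)"
  using assms category_poset_cat by (auto simp: small_poset_def)

lemma small_poset_subset: "small_poset U B r \<Longrightarrow> A \<subseteq> B \<Longrightarrow> small_poset U A r"
  unfolding small_poset_def refl_on_def
  using trans_on_subset antisym_on_subset inj_on_subset by (metis subsetD)

text \<open>An infinite \<open>'u\<close> contains codes for pairs, which index the arrows of a
  poset, and for the two labels of the copies of the orthant.\<close>

locale good_model =
  fixes U :: "'u itself" and M :: "('o, 'a) cat" and S :: "'a model_structure"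
  assumes good: "good_model_category U M S" and infinite_UNIV: "infinite (UNIV :: 'u set)"
begin

lemma model: "model_category U M S"
  using good by (simp add: good_model_category_def)

lemma M: "category M"
  using model by (simp add: model_category_def)

lemma Ident_Weq: "x \<in> Obj M \<Longrightarrow> Ident M x \<in> Weq S"
  using model by (auto simp: model_category_def wide_subcategory_def)

lemma Weq_Comp:
  assumes "f \<in> hom M x y" "g \<in> hom M y z" "f \<in> Weq S" "g \<in> Weq S"
  shows "Comp M g f \<in> Weq S"
  using model assms unfolding model_category_def two_out_of_three_def hom_def by auto

lemma Weq_cancel_left:
  assumes "f \<in> hom M x y" "g \<in> hom M y z" "g \<in> Weq S" "Comp M g f \<in> Weq S"
  shows "f \<in> Weq S"
proof -
  have "two_out_of_three M (Weq S)" using model by (simp add: model_category_def)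
  then show ?thesis using assms homD[OF assms(1)] homD[OF assms(2)]
    unfolding two_out_of_three_def by metis
qed

lemma Weq_retract:
  assumes "f \<in> Arr M" "g \<in> Weq S" "is_retract M f g"
  shows "f \<in> Weq S"
  using model assms unfolding model_category_def closed_under_retracts_def by blast

text \<open>An isomorphism is a retract of the identity of its source: identities connect the
  domains, \<open>g\<close> and \<open>f\<close> the codomains.\<close>

lemma iso_Weq:
  assumes f: "f \<in> hom M x y" and g: "g \<in> hom M y x"
    and gf: "Comp M g f = Ident M x" and fg: "Comp M f g = Ident M y"
  shows "f \<in> Weq S"
proof (rule Weq_retract[OF homD(1)[OF f] Ident_Weq[OF hom_Obj(1)[OF M f]]])
  note i = Ident_hom[OF M hom_Obj(1)[OF M f]]
  show "is_retract M f (Ident M x)"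
    unfolding is_retract_def homD[OF f] homD[OF i]
    using i f g gf fg Comp_Ident_left[OF M i] Comp_Ident_right[OF M f] by metis
qed

lemma natural_iso_Weq:
  assumes J: "category J"
    and t: "t \<in> hom (Fun J M) X Y" and s: "s \<in> hom (Fun J M) Y X"
    and st: "Comp (Fun J M) s t = Ident (Fun J M) X" and ts: "Comp (Fun J M) t s = Ident (Fun J M) Y"
  shows "t \<in> objectwise J M (Weq S)"
  unfolding objectwise_iff[OF t]
proof
  fix x assume x: "x \<in> Obj J"
  then have "Comp M (ncomp s x) (ncomp t x) = Ident M (fobj X x)"
    "Comp M (ncomp t x) (ncomp s x) = Ident M (fobj Y x)"
    using arg_cong[OF st, of "\<lambda>t. ncomp t x"] arg_cong[OF ts, of "\<lambda>t. ncomp t x"] by auto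
  then show "ncomp t x \<in> Weq S"
    using iso_Weq[OF hom_FunD(3)[OF t x] hom_FunD(3)[OF s x]] by simp
qed

lemma objectwise_Weq_Comp:
  assumes "category J" and f: "f \<in> hom (Fun J M) X Y" and g: "g \<in> hom (Fun J M) Y Z"
    and "f \<in> objectwise J M (Weq S)" "g \<in> objectwise J M (Weq S)"
  shows "Comp (Fun J M) g f \<in> objectwise J M (Weq S)"
  unfolding objectwise_iff[OF Comp_hom[OF category_Fun[OF assms(1) M] f g]]
  using assms(4,5) Weq_Comp[OF hom_FunD(3)[OF f] hom_FunD(3)[OF g]]
  by (simp add: objectwise_iff[OF f] objectwise_iff[OF g])

lemma objectwise_Weq_cancel_left:
  assumes f: "f \<in> hom (Fun J M) X Y" and g: "g \<in> hom (Fun J M) Y Z"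
    and "g \<in> objectwise J M (Weq S)" "Comp (Fun J M) g f \<in> objectwise J M (Weq S)"
  shows "f \<in> objectwise J M (Weq S)"
  using assms(3,4) Weq_cancel_left[OF hom_FunD(3)[OF f] hom_FunD(3)[OF g]]
  by (simp add: objectwise_iff[OF f] objectwise_iff[OF g]) (simp add: objectwise_def)

abbreviation trivial_fibrations :: "('i, 'j) cat \<Rightarrow> ('i, 'j, 'o, 'a) ntrans set" where
  "trivial_fibrations J \<equiv> objectwise J M (Fib S) \<inter> objectwise J M (Weq S)"

abbreviation cofibrations :: "('i, 'j) cat \<Rightarrow> ('i, 'j, 'o, 'a) ntrans set" where
  "cofibrations J \<equiv> Cofib (projective_structure J M S)"

lemma cofibrations_iff:
  "i \<in> hom (Fun J M) X Y \<Longrightarrow>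
     i \<in> cofibrations J \<longleftrightarrow> (\<forall>p \<in> trivial_fibrations J. has_lifting (Fun J M) i p)"
  by (simp add: projective_structure_def homD(1))

lemma projective_model:
  fixes A :: "'u set"
  assumes "partial_order_on A r"
  shows "model_category U (Fun (poset_cat A r) M) (projective_structure (poset_cat A r) M S)"
  using good assms by (simp add: good_model_category_def)

lemma objectwise_hom:
  assumes "t \<in> objectwise J M W"
  obtains X Y where "t \<in> hom (Fun J M) X Y"
  using assms hom_Dom_Cod[of t "Fun J M"] by (auto simp: objectwise_def)

text \<open>The model structure on diagrams over a poset drawn from \<^typ>\<open>'u\<close> is transported along an
  isomorphism of posets, which is a Galois connection in both directions.\<close>

lemma projective_axioms:
  fixes A :: "'p set"
  assumes A: "small_poset U A r"
  defines "J \<equiv> poset_cat A r"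
  shows "factors_through (Fun J M) (cofibrations J) (trivial_fibrations J)"
    and "factors_through (Fun J M) (cofibrations J \<inter> objectwise J M (Weq S)) (objectwise J M (Fib S))"
    and "\<And>i p. i \<in> cofibrations J \<Longrightarrow> i \<in> objectwise J M (Weq S) \<Longrightarrow> p \<in> objectwise J M (Fib S) \<Longrightarrow>
           has_lifting (Fun J M) i p"
proof -
  obtain f :: "'p \<Rightarrow> 'u" where f: "inj_on f A" using A by (auto simp: small_poset_def)
  define g where "g = the_inv_into A f"
  have gf [simp]: "g (f x) = x" if "x \<in> A" for x
    unfolding g_def by (rule the_inv_into_f_f[OF f that])
  define A' where "A' = f ` A"
  \<comment> \<open>\<open>r\<close> may relate points outside \<open>A\<close>; the intersection
    makes \<open>r'\<close> a relation on \<open>A'\<close>, as \<open>partial_order_on\<close>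
    requires.\<close>
  define r' where "r' = map_prod f f ` (r \<inter> A \<times> A)"
  define J' where "J' = poset_cat A' r'"
  have r'_iff: "(f x, f y) \<in> r' \<longleftrightarrow> (x, y) \<in> r" if "x \<in> A" "y \<in> A" for x y
    using that inj_onD[OF f] by (auto simp: r'_def)
  have gA: "g x \<in> A" and fg [simp]: "f (g x) = x" if "x \<in> A'" for x
    using that by (auto simp: A'_def)
  note rA = small_posetD(1,2)[OF A] and cJ = small_posetD(3)[OF A, folded J_def]
  have anti: "antisym_on A r" using A by (simp add: small_poset_def)
  have "refl_on A' r'" using rA r'_iff by (auto simp: A'_def refl_on_def)
  moreover have "trans r'"
  proof (rule transI)
    fix x y z assume "(x, y) \<in> r'" "(y, z) \<in> r'"
    then obtain a b b' c where abc: "a \<in> A" "b \<in> A" "b' \<in> A" "c \<in> A" "(a, b) \<in> r" "(b', c) \<in> r"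
      "x = f a" "y = f b" "y = f b'" "z = f c" by (auto simp: r'_def)
    then have "b = b'" using inj_onD[OF f, of b b'] by simp
    then show "(x, z) \<in> r'" using abc r'_iff[of a c] trans_onD[OF rA(2), of a b c] by simp
  qed
  moreover have "antisym r'"
  proof (rule antisymI)
    fix x y assume xy: "(x, y) \<in> r'" "(y, x) \<in> r'"
    then obtain a b where ab: "a \<in> A" "b \<in> A" "x = f a" "y = f b" by (auto simp: r'_def)
    then show "x = y" using antisym_onD[OF anti, of a b] r'_iff xy by simp
  qed
  moreover have "r' \<subseteq> A' \<times> A'" by (auto simp: r'_def A'_def)
  ultimately have po: "partial_order_on A' r'" and rA': "refl_on A' r'" "trans_on A' r'"
    by (auto simp: partial_order_on_def preorder_on_def intro: trans_on_subset)
  note mod = projective_model[OF po, folded J'_def]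
  note cJ' = category_poset_cat[OF rA', folded J'_def]
  have fA: "f \<in> A \<rightarrow> A'" and gA': "g \<in> A' \<rightarrow> A" using gA by (auto simp: A'_def)
  have adj: "(f x, y) \<in> r' \<longleftrightarrow> (x, g y) \<in> r" if "x \<in> A" "y \<in> A'" for x y
    using r'_iff[of x "g y"] gA that by simp
  have adj': "(g x, y) \<in> r \<longleftrightarrow> (x, f y) \<in> r'" if "x \<in> A'" "y \<in> A" for x y
    using r'_iff[of "g x" y] gA that by simp
  have E': "is_functor J J' (mono_functor f)"
    unfolding J_def J'_def using fA r'_iff by (intro is_functor_mono_functor) auto
  have E: "is_functor J' J (mono_functor g)"
    unfolding J_def J'_def using gA' adj adj' gA by (intro is_functor_mono_functor) auto
  have EE: "whisker J (whisker J' t (mono_functor g)) (mono_functor f) = t"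
    if t: "t \<in> hom (Fun J M) X Y" for t X Y
  proof -
    have "whisker J (whisker J' t (mono_functor g)) (mono_functor f) = whisker J t (mono_functor (\<lambda>x. x))"
      using fA by (intro whisker_comp[OF cJ cJ' cJ M E' E])
        (auto simp: J_def intro!: is_functor_mono_functor)
    then show ?thesis using whisker_Ident_functor[OF t, of "mono_functor (\<lambda>x. x)"] by simp
  qed
  have PE: "precomp J (precomp J' X (mono_functor g)) (mono_functor f) = X"
    if X: "X \<in> functors J M" for X
  proof -
    have "precomp J (precomp J' X (mono_functor g)) (mono_functor f) = precomp J X (mono_functor (\<lambda>x. x))"
      using fA by (intro precomp_comp[OF cJ cJ' cJ M E' E])
        (auto simp: J_def intro!: is_functor_mono_functor)
    then show ?thesis using precomp_Ident[OF X, of "mono_functor (\<lambda>x. x)"] by simp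
  qed
  \<comment> \<open>The inverse bijections \<open>f\<close> and \<open>g\<close> are adjoint on both
    sides, so whiskering preserves cofibrations in both directions.\<close>
  note lift = has_lifting_Galois[OF M rA' rA gA' fA adj', folded J_def J'_def, OF _ _ E E']
  note lift' = has_lifting_Galois[OF M rA rA' fA gA' adj, folded J_def J'_def, OF _ _ E' E]
  have w_ow: "whisker J' t (mono_functor g) \<in> objectwise J' M W"
    if t: "t \<in> objectwise J M W" for t W
  proof -
    obtain X Y where "t \<in> hom (Fun J M) X Y" using objectwise_hom[OF t] .
    then show ?thesis by (rule whisker_objectwise[OF cJ' E _ t])
  qed
  have w_ow': "whisker J t (mono_functor f) \<in> objectwise J M W"
    if t: "t \<in> objectwise J' M W" for t W
  proof -
    obtain X Y where "t \<in> hom (Fun J' M) X Y" using objectwise_hom[OF t] .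
    then show ?thesis by (rule whisker_objectwise[OF cJ E' _ t])
  qed
  have cof': "whisker J i (mono_functor f) \<in> cofibrations J"
    if i: "i \<in> hom (Fun J' M) X Y" and c: "i \<in> cofibrations J'" for i X Y
    unfolding cofibrations_iff[OF whisker_hom[OF cJ E' i]]
  proof
    fix p assume p: "p \<in> trivial_fibrations J"
    then obtain E D where pED: "p \<in> hom (Fun J M) E D" using objectwise_hom[of p J] by blast
    show "has_lifting (Fun J M) (whisker J i (mono_functor f)) p"
      using lift[OF _ _ i pED] c p w_ow unfolding cofibrations_iff[OF i] by blast
  qed
  have cof: "whisker J' i (mono_functor g) \<in> cofibrations J'"
    if i: "i \<in> hom (Fun J M) X Y" and c: "i \<in> cofibrations J" for i X Y
    unfolding cofibrations_iff[OF whisker_hom[OF cJ' E i]]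
  proof
    fix p assume p: "p \<in> trivial_fibrations J'"
    then obtain E D where pED: "p \<in> hom (Fun J' M) E D" using objectwise_hom[of p J'] by blast
    show "has_lifting (Fun J' M) (whisker J' i (mono_functor g)) p"
      using lift'[OF _ _ i pED] c p w_ow' unfolding cofibrations_iff[OF i] by blast
  qed
  \<comment> \<open>The map is carried to \<open>J'\<close>, factored there, and its factors are
    carried back; by \<open>EE\<close> the round trip is strictly the identity, so the composite is
    the original map.\<close>
  have factor: "factors_through (Fun J M) L R"
    if fac: "factors_through (Fun J' M) L' R'"
      and L: "\<And>i X Y. i \<in> hom (Fun J' M) X Y \<Longrightarrow> i \<in> L' \<Longrightarrow> whisker J i (mono_functor f) \<in> L"
      and R: "\<And>i X Y. i \<in> hom (Fun J' M) X Y \<Longrightarrow> i \<in> R' \<Longrightarrow> whisker J i (mono_functor f) \<in> R"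
      and L'R': "L' \<subseteq> Arr (Fun J' M)" "R' \<subseteq> Arr (Fun J' M)"
    for L R L' R'
    unfolding factors_through_def
  proof
    fix t assume "t \<in> Arr (Fun J M)"
    then have t: "t \<in> hom (Fun J M) (Dom (Fun J M) t) (Cod (Fun J M) t)" by (rule hom_Dom_Cod)
    note wt = whisker_hom[OF cJ' E t]
    obtain i p where ip: "i \<in> L'" "p \<in> R'" "Cod (Fun J' M) i = Dom (Fun J' M) p"
      "Comp (Fun J' M) p i = whisker J' t (mono_functor g)"
      using fac homD(1)[OF wt] unfolding factors_through_def by blast
    have i: "i \<in> hom (Fun J' M) (Dom (Fun J' M) i) (Cod (Fun J' M) i)"
      using ip(1) L'R'(1) by (intro hom_Dom_Cod) blast
    have p: "p \<in> hom (Fun J' M) (Cod (Fun J' M) i) (Cod (Fun J' M) p)"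
      using ip(2) L'R'(2) unfolding ip(3) by (intro hom_Dom_Cod) blast
    have "Comp (Fun J M) (whisker J p (mono_functor f)) (whisker J i (mono_functor f)) = t"
      using whisker_Comp[OF cJ cJ' M E' i p] ip(4) EE[OF t] by simp
    moreover have "Cod (Fun J M) (whisker J i (mono_functor f)) = Dom (Fun J M) (whisker J p (mono_functor f))"
      using homD[OF whisker_hom[OF cJ E' i]] homD[OF whisker_hom[OF cJ E' p]] by simp
    ultimately show "\<exists>i\<in>L. \<exists>p\<in>R. Cod (Fun J M) i = Dom (Fun J M) p \<and> Comp (Fun J M) p i = t"
      using L[OF i ip(1)] R[OF p ip(2)] by blast
  qed
  have arr: "t \<in> objectwise J' M W \<Longrightarrow> t \<in> Arr (Fun J' M)" for t W
    by (simp add: objectwise_def)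
  have arr': "t \<in> cofibrations J' \<Longrightarrow> t \<in> Arr (Fun J' M)" for t
    by (simp add: projective_structure_def)
  have PS: "Weq (projective_structure J' M S) = objectwise J' M (Weq S)"
    "Fib (projective_structure J' M S) = objectwise J' M (Fib S)"
    by (simp_all add: projective_structure_def)
  have mod': "factors_through (Fun J' M) (cofibrations J') (trivial_fibrations J')"
    "factors_through (Fun J' M) (cofibrations J' \<inter> objectwise J' M (Weq S)) (objectwise J' M (Fib S))"
    "\<And>i p. i \<in> cofibrations J' \<Longrightarrow> i \<in> objectwise J' M (Weq S) \<Longrightarrow> p \<in> objectwise J' M (Fib S) \<Longrightarrow>
           has_lifting (Fun J' M) i p"
    using mod unfolding model_category_def PS by blast+
  show "factors_through (Fun J M) (cofibrations J) (trivial_fibrations J)"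
    by (rule factor[OF mod'(1)]) (use cof' w_ow' arr arr' in blast)+
  show "factors_through (Fun J M) (cofibrations J \<inter> objectwise J M (Weq S)) (objectwise J M (Fib S))"
    by (rule factor[OF mod'(2)]) (use cof' w_ow' arr arr' in blast)+
  show "has_lifting (Fun J M) i p"
    if i: "i \<in> cofibrations J" "i \<in> objectwise J M (Weq S)" and p: "p \<in> objectwise J M (Fib S)" for i p
  proof -
    obtain X Y where iXY: "i \<in> hom (Fun J M) X Y" using objectwise_hom[OF i(2)] .
    obtain E D where pED: "p \<in> hom (Fun J M) E D" using objectwise_hom[OF p] .
    show ?thesis
      using lift[OF _ _ whisker_hom[OF cJ' E iXY] pED mod'(3)[OF cof[OF iXY i(1)] w_ow[OF i(2)] w_ow[OF p]]]
        EE[OF iXY] by simp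
  qed
qed

lemma factor_trivial_fibration:
  assumes A: "small_poset U A r" and f: "f \<in> hom (Fun (poset_cat A r) M) X Y"
  obtains Z i p where "i \<in> hom (Fun (poset_cat A r) M) X Z" "p \<in> hom (Fun (poset_cat A r) M) Z Y"
    "Comp (Fun (poset_cat A r) M) p i = f" "i \<in> cofibrations (poset_cat A r)"
    "p \<in> trivial_fibrations (poset_cat A r)"
proof -
  let ?F = "Fun (poset_cat A r) M"
  obtain i p where ip: "i \<in> cofibrations (poset_cat A r)" "p \<in> trivial_fibrations (poset_cat A r)"
    "Cod ?F i = Dom ?F p" "Comp ?F p i = f"
    using projective_axioms(1)[OF A] homD(1)[OF f] unfolding factors_through_def by blast
  have i: "i \<in> hom ?F (Dom ?F i) (Cod ?F i)" and p: "p \<in> hom ?F (Cod ?F i) (Cod ?F p)"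
    using ip hom_Dom_Cod[of i ?F] hom_Dom_Cod[of p ?F]
    by (auto simp: objectwise_def projective_structure_def)
  have "f \<in> hom ?F (Dom ?F i) (Cod ?F p)"
    using Comp_hom[OF category_Fun[OF small_posetD(3)[OF A] M] i p] ip by simp
  then have "X = Dom ?F i" "Y = Cod ?F p" using homD[OF f] homD[of f ?F] by auto
  then show thesis using that i p ip by auto
qed

lemma factor_trivial_cofibration:
  assumes A: "small_poset U A r" and f: "f \<in> hom (Fun (poset_cat A r) M) X Y"
  obtains Z i p where "i \<in> hom (Fun (poset_cat A r) M) X Z" "p \<in> hom (Fun (poset_cat A r) M) Z Y"
    "Comp (Fun (poset_cat A r) M) p i = f" "i \<in> objectwise (poset_cat A r) M (Weq S)"
    "p \<in> objectwise (poset_cat A r) M (Fib S)"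
proof -
  let ?F = "Fun (poset_cat A r) M"
  obtain i p where ip: "i \<in> objectwise (poset_cat A r) M (Weq S)"
    "p \<in> objectwise (poset_cat A r) M (Fib S)" "Cod ?F i = Dom ?F p" "Comp ?F p i = f"
    using projective_axioms(2)[OF A] homD(1)[OF f] unfolding factors_through_def by blast
  have i: "i \<in> hom ?F (Dom ?F i) (Cod ?F i)" and p: "p \<in> hom ?F (Cod ?F i) (Cod ?F p)"
    using ip hom_Dom_Cod[of i ?F] hom_Dom_Cod[of p ?F] by (auto simp: objectwise_def)
  have "f \<in> hom ?F (Dom ?F i) (Cod ?F p)"
    using Comp_hom[OF category_Fun[OF small_posetD(3)[OF A] M] i p] ip by simp
  then have "X = Dom ?F i" "Y = Cod ?F p" using homD[OF f] homD[of f ?F] by auto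
  then show thesis using that i p ip by auto
qed

text \<open>Retract argument: \<open>l\<close> is a retract of the trivial cofibration in its factorization.\<close>

lemma lifting_Weq:
  assumes A: "small_poset U A r" and l: "l \<in> hom (Fun (poset_cat A r) M) X Y"
    and lift: "\<And>p. p \<in> objectwise (poset_cat A r) M (Fib S) \<Longrightarrow> has_lifting (Fun (poset_cat A r) M) l p"
  shows "l \<in> objectwise (poset_cat A r) M (Weq S)"
proof -
  let ?J = "poset_cat A r"
  let ?F = "Fun ?J M"
  note F = category_Fun[OF small_posetD(3)[OF A] M]
  obtain Z j p where j: "j \<in> hom ?F X Z" "j \<in> objectwise ?J M (Weq S)"
    and p: "p \<in> hom ?F Z Y" "p \<in> objectwise ?J M (Fib S)" and pj: "Comp ?F p j = l"
    using factor_trivial_cofibration[OF A l] by metis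
  have Y: "Ident ?F Y \<in> hom ?F Y Y" by (rule Ident_hom[OF F hom_Obj(2)[OF F l]])
  have "Comp ?F p j = Comp ?F (Ident ?F Y) l"
    using pj Comp_Ident_left[OF F l] by simp
  then obtain h where h: "h \<in> hom ?F Y Z" "Comp ?F h l = j" "Comp ?F p h = Ident ?F Y"
    using lift[OF p(2)] j(1) Y unfolding has_lifting_def homD[OF l] homD[OF p(1)] by blast
  show ?thesis
    unfolding objectwise_iff[OF l]
  proof
    fix x assume x: "x \<in> Obj ?J"
    note lx = hom_FunD(3)[OF l x] and jx = hom_FunD(3)[OF j(1) x]
      and hx = hom_FunD(3)[OF h(1) x] and px = hom_FunD(3)[OF p(1) x]
    note i = Ident_hom[OF M hom_Obj(1)[OF M lx]]
    have eqs: "Comp M (ncomp h x) (ncomp l x) = ncomp j x" "Comp M (ncomp p x) (ncomp h x) = Ident M (fobj Y x)"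
      "Comp M (ncomp p x) (ncomp j x) = ncomp l x"
      using arg_cong[OF h(2), of "\<lambda>t. ncomp t x"] arg_cong[OF h(3), of "\<lambda>t. ncomp t x"]
        arg_cong[OF pj, of "\<lambda>t. ncomp t x"] x by auto
    have "is_retract M (ncomp l x) (ncomp j x)"
      unfolding is_retract_def homD[OF lx] homD[OF jx]
    proof (intro bexI conjI)
      show "Comp M (Ident M (fobj X x)) (Ident M (fobj X x)) = Ident M (fobj X x)"
        by (rule Comp_Ident_left[OF M i])
      show "Comp M (ncomp p x) (ncomp h x) = Ident M (fobj Y x)" by (rule eqs)
      show "Comp M (ncomp j x) (Ident M (fobj X x)) = Comp M (ncomp h x) (ncomp l x)"
        using eqs Comp_Ident_right[OF M jx] by simp
      show "Comp M (ncomp l x) (Ident M (fobj X x)) = Comp M (ncomp p x) (ncomp j x)"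
        using eqs Comp_Ident_right[OF M lx] by simp
    qed (use i hx px in auto)
    then show "ncomp l x \<in> Weq S"
      using Weq_retract[OF homD(1)[OF lx]] j(2) x unfolding objectwise_iff[OF j(1)] by blast
  qed
qed

end

section \<open>Coproducts, initial diagrams and cofibrant objects\<close>

definition is_coproduct :: "('o, 'a) cat \<Rightarrow> 'o \<Rightarrow> 'o \<Rightarrow> 'o \<Rightarrow> 'a \<Rightarrow> 'a \<Rightarrow> bool" where
  "is_coproduct C x y c a b \<longleftrightarrow> a \<in> hom C x c \<and> b \<in> hom C y c \<and>
     (\<forall>d. \<forall>f\<in>hom C x d. \<forall>g\<in>hom C y d. \<exists>!h. h \<in> hom C c d \<and> Comp C h a = f \<and> Comp C h b = g)"

lemma is_coproductD:
  assumes "is_coproduct C x y c a b"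
  shows "a \<in> hom C x c" "b \<in> hom C y c"
  using assms by (auto simp: is_coproduct_def)

lemma coproduct_factor:
  assumes "is_coproduct C x y c a b" "f \<in> hom C x d" "g \<in> hom C y d"
  obtains h where "h \<in> hom C c d" "Comp C h a = f" "Comp C h b = g"
  using assms unfolding is_coproduct_def by metis

lemma coproduct_unique:
  assumes C: "category C" and c: "is_coproduct C x y c a b" and h: "h \<in> hom C c d" and h': "h' \<in> hom C c d"
    and "Comp C h a = Comp C h' a" "Comp C h b = Comp C h' b"
  shows "h = h'"
proof -
  have "\<exists>!k. k \<in> hom C c d \<and> Comp C k a = Comp C h a \<and> Comp C k b = Comp C h b"
    using c Comp_hom[OF C is_coproductD(1)[OF c] h] Comp_hom[OF C is_coproductD(2)[OF c] h]
    unfolding is_coproduct_def by blast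
  then show ?thesis using assms by metis
qed

lemma is_coproduct_commute: "is_coproduct C x y c a b \<Longrightarrow> is_coproduct C y x c b a"
  unfolding is_coproduct_def by (simp add: conj_commute conj_left_commute)

context good_model
begin

lemma inj_pair_exists:
  obtains pr :: "'u \<times> 'u \<Rightarrow> 'u" where "inj pr"
  using card_of_Times_same_infinite[OF infinite_UNIV]
  unfolding card_of_ordIso[symmetric] bij_betw_def by auto

lemma inj_bool_exists:
  obtains f :: "bool \<Rightarrow> 'u" where "inj f"
proof -
  obtain g :: "nat \<Rightarrow> 'u" where "inj g"
    using infinite_UNIV by (auto dest: infinite_countable_subset)
  then have "inj (\<lambda>b. g (if b then 0 else 1))" by (auto intro!: injI dest: injD split: if_splits)
  then show thesis by (rule that)
qed

lemma small_poset_colimit: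
  assumes A: "small_poset U A r" and D: "is_functor (poset_cat A r) M D"
  obtains c \<kappa> where "is_colimit (poset_cat A r) M D c \<kappa>"
proof -
  obtain f :: "_ \<Rightarrow> 'u" where f: "inj_on f A" using A by (auto simp: small_poset_def)
  obtain pr :: "'u \<times> 'u \<Rightarrow> 'u" where pr: "inj pr" by (rule inj_pair_exists)
  have "inj_on (\<lambda>p. pr (f (fst p), f (snd p))) (Arr (poset_cat A r))"
    by (rule inj_onI, drule injD[OF pr]) (auto simp: prod_eq_iff dest: inj_onD[OF f])
  moreover have "bicomplete TYPE('u) M"
    using model by (simp add: model_category_def bicomplete_def)
  ultimately show thesis
    using small_colimit_exists[OF _ small_posetD(3)[OF A] _ _ D, of f] f that by auto
qed

text \<open>A colimit over the empty poset is initial in \<open>M\<close>, and the constant diagram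
  at it is initial among diagrams. Any record is a functor on the empty poset, hence the
  \<open>undefined\<close> fields.\<close>

lemma initial_exists:
  assumes A: "small_poset U A r"
  obtains Z where "is_initial (Fun (poset_cat A r) M) Z"
proof -
  let ?E = "poset_cat ({} :: 'u set) {}"
  have "small_poset U ({} :: 'u set) {}"
    by (auto simp: small_poset_def refl_on_def)
  moreover have "is_functor ?E M D" for D
    by (rule is_functor_posetI) auto
  ultimately obtain z and \<kappa> :: "'u \<Rightarrow> 'a"
    where "is_colimit ?E M \<lparr>fobj = undefined, farr = undefined\<rparr> z \<kappa>"
    using small_poset_colimit by metis
  then have z: "z \<in> Obj M" and z': "\<And>x. x \<in> Obj M \<Longrightarrow> \<exists>!f. f \<in> hom M z x"
    unfolding is_colimit_def is_cocone_poset_cat by auto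
  let ?J = "poset_cat A r"
  let ?Z = "diagram A r (\<lambda>_. z) (\<lambda>_ _. Ident M z)"
  have Z: "?Z \<in> functors ?J M"
    using small_posetD[OF A] Ident_hom[OF M z] z Comp_Ident_left[OF M Ident_hom[OF M z]]
    by (intro diagram_functors) auto
  have "\<exists>!t. t \<in> hom (Fun ?J M) ?Z X" if X: "X \<in> functors ?J M" for X
  proof -
    have "\<exists>f. f \<in> hom M z (fobj X x)" if "x \<in> A" for x
      using z'[OF poset_functorD(1)[OF X that]] by blast
    then obtain f where f: "\<And>x. x \<in> A \<Longrightarrow> f x \<in> hom M z (fobj X x)" by metis
    have unique: "g = f x" if "x \<in> A" "g \<in> hom M z (fobj X x)" for g x
      using z'[OF poset_functorD(1)[OF X that(1)]] f[OF that(1)] that(2) by blast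
    let ?t = "ntransf ?J ?Z X f"
    have t: "?t \<in> hom (Fun ?J M) ?Z X"
    proof (rule ntransf_hom[OF Z X])
      show "f x \<in> hom M (fobj ?Z x) (fobj X x)" if "x \<in> A" for x using f that by simp
      show "Comp M (f y) (farr ?Z (x, y)) = Comp M (farr X (x, y)) (f x)"
        if "x \<in> A" "y \<in> A" "(x, y) \<in> r" for x y
        using unique[OF that(2) Comp_hom[OF M f[OF that(1)] poset_functorD(2)[OF X that]]]
          Comp_Ident_right[OF M f[OF that(2)]] that by simp
    qed
    show ?thesis
    proof (rule ex1I[of _ ?t])
      fix s assume s: "s \<in> hom (Fun ?J M) ?Z X"
      show "s = ?t"
        using unique ntrans_posetD(1)[OF s] by (intro ntrans_eqI[OF s t]) auto
    qed (rule t)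
  qed
  then show thesis using that[of ?Z] Z by (simp add: is_initial_def)
qed

text \<open>A square starting at an initial object commutes automatically, so lifting for the map
  out of it is lifting for maps out of \<open>Q\<close>. In this form cofibrancy can be transposed
  along Kan extensions.\<close>

lemma cofibrant_iff:
  assumes A: "small_poset U A r"
  shows "cofibrant (Fun (poset_cat A r) M) (projective_structure (poset_cat A r) M S) Q \<longleftrightarrow>
    Q \<in> functors (poset_cat A r) M \<and>
    (\<forall>E D. \<forall>p\<in>hom (Fun (poset_cat A r) M) E D. p \<in> trivial_fibrations (poset_cat A r) \<longrightarrow>
       (\<forall>v\<in>hom (Fun (poset_cat A r) M) Q D. \<exists>h\<in>hom (Fun (poset_cat A r) M) Q E.
          Comp (Fun (poset_cat A r) M) p h = v))"
    (is "?cof \<longleftrightarrow> _ \<and> ?lift")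
proof (intro iffI conjI)
  let ?J = "poset_cat A r"
  let ?F = "Fun ?J M"
  note F = category_Fun[OF small_posetD(3)[OF A] M]
  {
    assume ?cof
    then obtain z f where z: "is_initial ?F z" and f: "f \<in> hom ?F z Q" "f \<in> cofibrations ?J"
      by (auto simp: cofibrant_def)
    show "Q \<in> functors ?J M" by (rule hom_FunD(2)[OF f(1)])
    show ?lift
    proof (intro allI ballI impI)
      fix E D p v assume p: "p \<in> hom ?F E D" "p \<in> trivial_fibrations ?J" and v: "v \<in> hom ?F Q D"
      have E: "E \<in> Obj ?F" and D: "D \<in> Obj ?F" using hom_FunD(1,2)[OF p(1)] by auto
      obtain u where u: "u \<in> hom ?F z E" using z E unfolding is_initial_def by blast
      have "Comp ?F p u = Comp ?F v f"
        using z D Comp_hom[OF F u p(1)] Comp_hom[OF F f(1) v] unfolding is_initial_def by blast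
      moreover have "has_lifting ?F f p" using f(2) p(2) unfolding cofibrations_iff[OF f(1)] by blast
      ultimately show "\<exists>h\<in>hom ?F Q E. Comp ?F p h = v"
        using u v unfolding has_lifting_def homD[OF f(1)] homD[OF p(1)] by blast
    qed
  }
  assume *: "Q \<in> functors ?J M \<and> ?lift"
  obtain z where z: "is_initial ?F z" using initial_exists[OF A] .
  then obtain f where f: "f \<in> hom ?F z Q" using * unfolding is_initial_def by auto
  have "f \<in> cofibrations ?J"
    unfolding cofibrations_iff[OF f]
  proof
    fix p assume p: "p \<in> trivial_fibrations ?J"
    then obtain E D where pED: "p \<in> hom ?F E D" using objectwise_hom[of p ?J] by blast
    have E: "E \<in> Obj ?F" using hom_FunD(1)[OF pED] by auto
    show "has_lifting ?F f p"
      unfolding has_lifting_def homD[OF f] homD[OF pED]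
    proof (intro ballI impI)
      fix u v assume u: "u \<in> hom ?F z E" and v: "v \<in> hom ?F Q D"
      obtain h where h: "h \<in> hom ?F Q E" "Comp ?F p h = v" using * pED p v by blast
      have "Comp ?F h f = u"
        using z E u Comp_hom[OF F f h(1)] unfolding is_initial_def by blast
      then show "\<exists>h\<in>hom ?F Q E. Comp ?F h f = u \<and> Comp ?F p h = v" using h by blast
    qed
  qed
  then show ?cof using z f unfolding cofibrant_def by blast
qed

lemma cofibrant_lift:
  assumes A: "small_poset U A r"
    and "cofibrant (Fun (poset_cat A r) M) (projective_structure (poset_cat A r) M S) Q"
    and "p \<in> hom (Fun (poset_cat A r) M) E D" "p \<in> trivial_fibrations (poset_cat A r)"
    and "v \<in> hom (Fun (poset_cat A r) M) Q D"
  obtains h where "h \<in> hom (Fun (poset_cat A r) M) Q E" "Comp (Fun (poset_cat A r) M) p h = v"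
  using assms(2-) unfolding cofibrant_iff[OF A] by blast

lemma cofibrant_replacement_exists:
  assumes A: "small_poset U A r" and X: "X \<in> functors (poset_cat A r) M"
  obtains Q q where "cofibrant (Fun (poset_cat A r) M) (projective_structure (poset_cat A r) M S) Q"
    "q \<in> hom (Fun (poset_cat A r) M) Q X" "q \<in> objectwise (poset_cat A r) M (Weq S)"
proof -
  let ?F = "Fun (poset_cat A r) M"
  obtain z where z: "is_initial ?F z" using initial_exists[OF A] .
  then obtain f where f: "f \<in> hom ?F z X" using X unfolding is_initial_def by auto
  obtain Q i q where "i \<in> hom ?F z Q" "q \<in> hom ?F Q X" "Comp ?F q i = f"
    "i \<in> cofibrations (poset_cat A r)" "q \<in> trivial_fibrations (poset_cat A r)"
    by (rule factor_trivial_fibration[OF A f])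
  with z show thesis by (intro that[of Q q]) (auto simp: cofibrant_def)
qed

lemma coproduct_exists:
  assumes x: "x \<in> Obj M" and y: "y \<in> Obj M"
  obtains c a b where "is_coproduct M x y c a b"
proof -
  let ?J = "poset_cat (UNIV :: bool set) Id"
  obtain f :: "bool \<Rightarrow> 'u" where "inj f" by (rule inj_bool_exists)
  then have J: "small_poset U (UNIV :: bool set) Id"
    by (auto simp: small_poset_def refl_on_def trans_on_def antisym_on_def)
  let ?o = "\<lambda>b. if b then x else y"
  let ?D = "\<lparr>fobj = ?o, farr = \<lambda>p. Ident M (?o (fst p))\<rparr>"
  have D: "is_functor ?J M ?D"
    using x y Ident_hom[OF M] Comp_Ident_left[OF M Ident_hom[OF M x]] Comp_Ident_left[OF M Ident_hom[OF M y]]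
    by (intro is_functor_posetI) auto
  obtain c \<kappa> where c: "is_colimit ?J M ?D c \<kappa>" using small_poset_colimit[OF J D] .
  have cocone: "is_cocone ?J M ?D c' \<kappa>'" if "\<kappa>' True \<in> hom M x c'" "\<kappa>' False \<in> hom M y c'" for c' \<kappa>'
    using that hom_Obj[OF M that(1)] Comp_Ident_right[OF M that(1)] Comp_Ident_right[OF M that(2)]
    unfolding is_cocone_poset_cat by (auto simp: all_bool_eq)
  have "is_cocone ?J M ?D c \<kappa>" using c unfolding is_colimit_def by blast
  then have "\<forall>b. \<kappa> b \<in> hom M (?o b) c" unfolding is_cocone_poset_cat by simp
  then have \<kappa>: "\<kappa> True \<in> hom M x c" "\<kappa> False \<in> hom M y c" by (auto dest: spec[of _ True] spec[of _ False])
  have "is_coproduct M x y c (\<kappa> True) (\<kappa> False)"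
    unfolding is_coproduct_def
  proof (intro conjI allI ballI \<kappa>)
    fix d f g assume f: "f \<in> hom M x d" and g: "g \<in> hom M y d"
    have "\<exists>!h. h \<in> hom M c d \<and> (\<forall>j\<in>Obj ?J. Comp M h (\<kappa> j) = (\<lambda>b. if b then f else g) j)"
      using c cocone[of "\<lambda>b. if b then f else g" d] f g unfolding is_colimit_def by simp
    then show "\<exists>!h. h \<in> hom M c d \<and> Comp M h (\<kappa> True) = f \<and> Comp M h (\<kappa> False) = g"
      by (simp add: all_bool_eq conj_commute)
  qed
  then show thesis by (rule that)
qed

text \<open>Coproducts are taken objectwise without a functorial choice. Transition maps come from
  the universal property, and every equation between maps out of a coproduct is tested on the two
  injections.\<close>

lemma coproduct_diagram_exists:
  assumes A: "small_poset U A r"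
    and X: "X \<in> functors (poset_cat A r) M" and Y: "Y \<in> functors (poset_cat A r) M"
  obtains C a b where "is_coproduct (Fun (poset_cat A r) M) X Y C a b"
proof -
  let ?J = "poset_cat A r"
  let ?F = "Fun ?J M"
  note F = category_Fun[OF small_posetD(3)[OF A] M]
  have rr: "(x, x) \<in> r" if "x \<in> A" for x using small_posetD(1)[OF A] that by (auto simp: refl_on_def)
  note tr = trans_onD[OF small_posetD(2)[OF A]]
  have "\<exists>c a b. is_coproduct M (fobj X t) (fobj Y t) c a b" if "t \<in> A" for t
    using coproduct_exists[OF poset_functorD(1)[OF X that] poset_functorD(1)[OF Y that]] by metis
  then obtain c a b where cop: "\<And>t. t \<in> A \<Longrightarrow> is_coproduct M (fobj X t) (fobj Y t) (c t) (a t) (b t)"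
    by metis
  note a = is_coproductD(1)[OF cop] and b = is_coproductD(2)[OF cop]
  note Xh = poset_functorD(2)[OF X] and Yh = poset_functorD(2)[OF Y]
  note unique = coproduct_unique[OF M cop]
  define P where "P x y h \<longleftrightarrow> h \<in> hom M (c x) (c y) \<and>
      Comp M h (a x) = Comp M (a y) (farr X (x, y)) \<and> Comp M h (b x) = Comp M (b y) (farr Y (x, y))"
    for x y h
  have "\<exists>h. P x y h" if "x \<in> A" "y \<in> A" "(x, y) \<in> r" for x y
    using coproduct_factor[OF cop[OF that(1)] Comp_hom[OF M Xh[OF that] a[OF that(2)]]
        Comp_hom[OF M Yh[OF that] b[OF that(2)]]] unfolding P_def by metis
  then obtain l where "\<And>x y. x \<in> A \<Longrightarrow> y \<in> A \<Longrightarrow> (x, y) \<in> r \<Longrightarrow> P x y (l x y)" by metis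
  then have l: "\<And>x y. x \<in> A \<Longrightarrow> y \<in> A \<Longrightarrow> (x, y) \<in> r \<Longrightarrow> l x y \<in> hom M (c x) (c y)"
    and la: "\<And>x y. x \<in> A \<Longrightarrow> y \<in> A \<Longrightarrow> (x, y) \<in> r \<Longrightarrow>
      Comp M (l x y) (a x) = Comp M (a y) (farr X (x, y))"
    and lb: "\<And>x y. x \<in> A \<Longrightarrow> y \<in> A \<Longrightarrow> (x, y) \<in> r \<Longrightarrow>
      Comp M (l x y) (b x) = Comp M (b y) (farr Y (x, y))" unfolding P_def by blast+
  let ?C = "diagram A r c l"
  have C: "?C \<in> functors ?J M"
  proof (rule diagram_functors[OF small_posetD(1,2)[OF A] _ l])
    show "c x \<in> Obj M" if "x \<in> A" for x using hom_Obj[OF M a[OF that]] by simp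
    show "l x x = Ident M (c x)" if x: "x \<in> A" for x
      using hom_Obj[OF M a[OF x]] la[OF x x rr[OF x]] lb[OF x x rr[OF x]]
        Comp_Ident_left[OF M a[OF x]] Comp_Ident_left[OF M b[OF x]]
        Comp_Ident_right[OF M a[OF x]] Comp_Ident_right[OF M b[OF x]]
        poset_functorD(3)[OF X x] poset_functorD(3)[OF Y x]
      by (intro unique[OF x l[OF x x rr[OF x]] Ident_hom[OF M]]) auto
    show "l x z = Comp M (l y z) (l x y)"
      if x: "x \<in> A" and y: "y \<in> A" and z: "z \<in> A" and xy: "(x, y) \<in> r" and yz: "(y, z) \<in> r" for x y z
    proof (rule unique[OF x l[OF x z tr[OF x y z xy yz]] Comp_hom[OF M l[OF x y xy] l[OF y z yz]]])
      show "Comp M (l x z) (a x) = Comp M (Comp M (l y z) (l x y)) (a x)"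
        using la[OF x z tr[OF x y z xy yz]] la[OF x y xy] la[OF y z yz]
          Comp_assoc[OF M a[OF x] l[OF x y xy] l[OF y z yz]]
          Comp_assoc[OF M Xh[OF x y xy] a[OF y] l[OF y z yz]]
          Comp_assoc[OF M Xh[OF x y xy] Xh[OF y z yz] a[OF z]] poset_functorD(4)[OF X x y z xy yz] by simp
      show "Comp M (l x z) (b x) = Comp M (Comp M (l y z) (l x y)) (b x)"
        using lb[OF x z tr[OF x y z xy yz]] lb[OF x y xy] lb[OF y z yz]
          Comp_assoc[OF M b[OF x] l[OF x y xy] l[OF y z yz]]
          Comp_assoc[OF M Yh[OF x y xy] b[OF y] l[OF y z yz]]
          Comp_assoc[OF M Yh[OF x y xy] Yh[OF y z yz] b[OF z]] poset_functorD(4)[OF Y x y z xy yz] by simp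
    qed
  qed
  let ?a = "ntransf ?J X ?C a" and ?b = "ntransf ?J Y ?C b"
  have a': "?a \<in> hom ?F X ?C" by (rule ntransf_hom[OF X C]) (use a la in auto)
  have b': "?b \<in> hom ?F Y ?C" by (rule ntransf_hom[OF Y C]) (use b lb in auto)
  have "is_coproduct ?F X Y ?C ?a ?b"
    unfolding is_coproduct_def
  proof (intro conjI allI ballI a' b')
    fix D f g assume f: "f \<in> hom ?F X D" and g: "g \<in> hom ?F Y D"
    note D = hom_FunD(2)[OF f]
    note fh = ntrans_posetD(1)[OF f] and gh = ntrans_posetD(1)[OF g]
    note Dh = poset_functorD(2)[OF D]
    have "\<exists>h. h \<in> hom M (c x) (fobj D x) \<and> Comp M h (a x) = ncomp f x \<and> Comp M h (b x) = ncomp g x"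
      if "x \<in> A" for x
      using coproduct_factor[OF cop[OF that] fh[OF that] gh[OF that]] by metis
    then obtain h where h: "\<And>x. x \<in> A \<Longrightarrow> h x \<in> hom M (c x) (fobj D x)"
      and ha: "\<And>x. x \<in> A \<Longrightarrow> Comp M (h x) (a x) = ncomp f x"
      and hb: "\<And>x. x \<in> A \<Longrightarrow> Comp M (h x) (b x) = ncomp g x" by metis
    let ?h = "ntransf ?J ?C D h"
    have h': "?h \<in> hom ?F ?C D"
    proof (rule ntransf_hom[OF C D])
      show "h x \<in> hom M (fobj ?C x) (fobj D x)" if "x \<in> A" for x using h that by simp
      fix x y assume x: "x \<in> A" and y: "y \<in> A" and xy: "(x, y) \<in> r"
      have "Comp M (h y) (l x y) = Comp M (farr D (x, y)) (h x)"
      proof (rule unique[OF x Comp_hom[OF M l[OF x y xy] h[OF y]] Comp_hom[OF M h[OF x] Dh[OF x y xy]]])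
        show "Comp M (Comp M (h y) (l x y)) (a x) = Comp M (Comp M (farr D (x, y)) (h x)) (a x)"
          using Comp_assoc[OF M a[OF x] l[OF x y xy] h[OF y]] Comp_assoc[OF M Xh[OF x y xy] a[OF y] h[OF y]]
            Comp_assoc[OF M a[OF x] h[OF x] Dh[OF x y xy]] la[OF x y xy] ha[OF x] ha[OF y]
            ntrans_posetD(2)[OF f x y xy] by simp
        show "Comp M (Comp M (h y) (l x y)) (b x) = Comp M (Comp M (farr D (x, y)) (h x)) (b x)"
          using Comp_assoc[OF M b[OF x] l[OF x y xy] h[OF y]] Comp_assoc[OF M Yh[OF x y xy] b[OF y] h[OF y]]
            Comp_assoc[OF M b[OF x] h[OF x] Dh[OF x y xy]] lb[OF x y xy] hb[OF x] hb[OF y]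
            ntrans_posetD(2)[OF g x y xy] by simp
      qed
      then show "Comp M (h y) (farr ?C (x, y)) = Comp M (farr D (x, y)) (h x)" using x y xy by simp
    qed
    show "\<exists>!h. h \<in> hom ?F ?C D \<and> Comp ?F h ?a = f \<and> Comp ?F h ?b = g"
    proof (intro ex1I[of _ ?h] conjI h')
      show "Comp ?F ?h ?a = f"
        by (rule ntrans_eqI[OF Comp_hom[OF F a' h'] f]) (simp add: ha)
      show "Comp ?F ?h ?b = g"
        by (rule ntrans_eqI[OF Comp_hom[OF F b' h'] g]) (simp add: hb)
      fix k assume k: "k \<in> hom ?F ?C D \<and> Comp ?F k ?a = f \<and> Comp ?F k ?b = g"
      then have k': "k \<in> hom ?F ?C D" by simp
      show "k = ?h"
      proof (rule ntrans_eqI[OF k' h'])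
        fix x assume "x \<in> Obj ?J"
        then have x: "x \<in> A" by simp
        have kx: "ncomp k x \<in> hom M (c x) (fobj D x)" using ntrans_posetD(1)[OF k' x] x by simp
        have "Comp M (ncomp k x) (a x) = ncomp f x" "Comp M (ncomp k x) (b x) = ncomp g x"
          using k x by auto
        then show "ncomp k x = ncomp ?h x"
          using unique[OF x kx h[OF x]] ha[OF x] hb[OF x] x by simp
      qed
    qed
  qed
  then show thesis by (rule that)
qed

section \<open>Homotopy left Kan extensions along inclusions\<close>

lemma left_kan_extension_exists:
  assumes B: "small_poset U B r" and AB: "A \<subseteq> B" and X: "X \<in> functors (poset_cat A r) M"
  obtains L \<eta> where
    "is_left_kan_extension (poset_cat A r) (poset_cat B r) M (mono_functor (\<lambda>x. x)) X L \<eta>"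
    "\<And>a. a \<in> A \<Longrightarrow> fobj L a = fobj X a" "\<And>a. a \<in> A \<Longrightarrow> ncomp \<eta> a = Ident M (fobj X a)"
proof (rule pointwise_left_kan_extension[OF M small_posetD(1,2)[OF B] AB X])
  fix b assume b: "b \<in> B"
  have "is_functor (poset_cat {a \<in> A. (a, b) \<in> r} r) M X"
    by (rule is_functor_posetI) (simp_all add: poset_functorD[OF X])
  moreover have "small_poset U {a \<in> A. (a, b) \<in> r} r"
    using AB by (intro small_poset_subset[OF B]) auto
  ultimately show "\<exists>c \<kappa>. is_colimit (poset_cat {a \<in> A. (a, b) \<in> r} r) M X c \<kappa>"
    using small_poset_colimit by metis
qed (rule that)

context
  fixes A B :: "'p set" and r :: "'p rel"
  assumes B: "small_poset U B r" and AB: "A \<subseteq> B"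
begin

abbreviation (input) "JA \<equiv> poset_cat A r"
abbreviation (input) "JB \<equiv> poset_cat B r"
abbreviation (input) "incl \<equiv> mono_functor (\<lambda>x :: 'p. x)"

lemma small_A: "small_poset U A r"
  by (rule small_poset_subset[OF B AB])

lemmas cat_A = small_posetD(3)[OF small_A] and cat_B = small_posetD(3)[OF B]

lemma is_functor_incl: "is_functor JA JB incl"
  using AB by (intro is_functor_mono_functor) auto

lemma homotopy_left_kan_extension_exists:
  assumes X: "X \<in> functors JA M"
  obtains T where "is_homotopy_left_kan_extension JA JB M S incl X T"
proof -
  obtain Q q where Q: "cofibrant (Fun JA M) (projective_structure JA M S) Q"
    "q \<in> hom (Fun JA M) Q X" "q \<in> objectwise JA M (Weq S)"
    by (rule cofibrant_replacement_exists[OF small_A X])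
  obtain L \<eta> where "is_left_kan_extension JA JB M incl Q L \<eta>"
    using left_kan_extension_exists[OF B AB hom_FunD(1)[OF Q(2)]] by metis
  with Q show thesis by (intro that[of L]) (auto simp: is_homotopy_left_kan_extension_def)
qed

text \<open>Composing with \<open>t\<close> makes a cofibrant replacement of \<open>X\<close> into
  one of \<open>Y\<close>, with the same Kan extension.\<close>

lemma homotopy_left_kan_extension_Weq:
  assumes t: "t \<in> hom (Fun JA M) X Y" "t \<in> objectwise JA M (Weq S)"
    and "is_homotopy_left_kan_extension JA JB M S incl X T"
  shows "is_homotopy_left_kan_extension JA JB M S incl Y T"
  using assms(3) Comp_hom[OF category_Fun[OF cat_A M] _ t(1)] objectwise_Weq_Comp[OF cat_A _ t(1) _ t(2)]
  unfolding is_homotopy_left_kan_extension_def by metis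

text \<open>Restriction preserves objectwise fibrations, so lifting for the trivial cofibration
  \<open>g\<close> transposes to lifting for \<open>l\<close> against all fibrations, and
  \<open>lifting_Weq\<close> applies.\<close>

lemma left_kan_extension_trivial_cofibration:
  assumes K: "is_left_kan_extension JA JB M incl Q L \<eta>" and K': "is_left_kan_extension JA JB M incl Z L' \<eta>'"
    and g: "g \<in> hom (Fun JA M) Q Z" "g \<in> cofibrations JA" "g \<in> objectwise JA M (Weq S)"
  shows "weakly_equivalent JB M S L L'"
proof -
  note D = left_kan_extensionD[OF cat_A cat_B M is_functor_incl]
  obtain l where l: "l \<in> hom (Fun JB M) L L'"
    and eq: "Comp (Fun JA M) (whisker JA l incl) \<eta> = Comp (Fun JA M) \<eta>' g"
    using left_kan_extension_factor[OF cat_A cat_B M is_functor_incl K D(1)[OF K']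
        Comp_hom[OF category_Fun[OF cat_A M] g(1) D(2)[OF K']]] .
  have "l \<in> objectwise JB M (Weq S)"
  proof (rule lifting_Weq[OF B l])
    fix p assume p: "p \<in> objectwise JB M (Fib S)"
    then obtain E D where pED: "p \<in> hom (Fun JB M) E D" by (rule objectwise_hom)
    have "has_lifting (Fun JA M) g (whisker JA p incl)"
      by (rule projective_axioms(3)[OF small_A g(2,3) whisker_objectwise[OF cat_A is_functor_incl pED p]])
    from has_lifting_left_kan_extension[OF cat_A cat_B M is_functor_incl K K' g(1) l eq pED this]
    show "has_lifting (Fun JB M) l p" .
  qed
  with l show ?thesis by (rule weakly_equivalentI)
qed

text \<open>Cofibrancy of \<open>Y\<close> supplies a lift on the second summand. Together with the
  given map on \<open>X\<close> it defines a map out of the coproduct, to which the lifting property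
  of \<open>i\<close> applies.\<close>

lemma coproduct_injection_cofibration:
  assumes c: "is_coproduct (Fun JA M) X Y C a b"
    and Y: "cofibrant (Fun JA M) (projective_structure JA M S) Y"
    and i: "i \<in> hom (Fun JA M) C Z" "i \<in> cofibrations JA"
  shows "Comp (Fun JA M) i a \<in> cofibrations JA"
proof -
  let ?F = "Fun JA M"
  note F = category_Fun[OF cat_A M]
  note a = is_coproductD(1)[OF c] and b = is_coproductD(2)[OF c]
  show ?thesis
    unfolding cofibrations_iff[OF Comp_hom[OF F a i(1)]]
  proof
    fix p assume p: "p \<in> trivial_fibrations JA"
    then obtain E D where pED: "p \<in> hom ?F E D" using objectwise_hom[of p JA] by blast
    show "has_lifting ?F (Comp ?F i a) p"
      unfolding has_lifting_def homD[OF Comp_hom[OF F a i(1)]] homD[OF pED]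
    proof (intro ballI impI)
      fix u v assume u: "u \<in> hom ?F X E" and v: "v \<in> hom ?F Z D"
        and sq: "Comp ?F p u = Comp ?F v (Comp ?F i a)"
      note ib = Comp_hom[OF F b i(1)] and vi = Comp_hom[OF F i(1) v]
      obtain w where w: "w \<in> hom ?F Y E" "Comp ?F p w = Comp ?F v (Comp ?F i b)"
        using cofibrant_lift[OF small_A Y pED p Comp_hom[OF F ib v]] .
      obtain k where k: "k \<in> hom ?F C E" "Comp ?F k a = u" "Comp ?F k b = w"
        using coproduct_factor[OF c u w(1)] .
      have "Comp ?F p k = Comp ?F v i"
      proof (rule coproduct_unique[OF F c Comp_hom[OF F k(1) pED] vi])
        show "Comp ?F (Comp ?F p k) a = Comp ?F (Comp ?F v i) a"
          using Comp_assoc[OF F a k(1) pED] Comp_assoc[OF F a i(1) v] k sq by simp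
        show "Comp ?F (Comp ?F p k) b = Comp ?F (Comp ?F v i) b"
          using Comp_assoc[OF F b k(1) pED] Comp_assoc[OF F b i(1) v] k w by simp
      qed
      moreover have "has_lifting ?F i p" using i(2) p unfolding cofibrations_iff[OF i(1)] by blast
      ultimately obtain h where h: "h \<in> hom ?F Z E" "Comp ?F h i = k" "Comp ?F p h = v"
        using k(1) v unfolding has_lifting_def homD[OF i(1)] homD[OF pED] by blast
      then show "\<exists>h\<in>hom ?F Z E. Comp ?F h (Comp ?F i a) = u \<and> Comp ?F p h = v"
        using Comp_assoc[OF F a i(1) h(1)] k(2) by auto
    qed
  qed
qed

text \<open>Two cofibrant replacements \<open>Q\<close> and \<open>Q'\<close> of \<open>X\<close> are compared through a factorization
  \<open>Q + Q' \<rightarrow> Z \<rightarrow> X\<close> into a cofibration and a trivial fibration.\<close>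

lemma homotopy_left_kan_extension_unique:
  assumes "is_homotopy_left_kan_extension JA JB M S incl X T"
    and "is_homotopy_left_kan_extension JA JB M S incl X T'"
  shows "weakly_equivalent JB M S T T'"
proof -
  let ?F = "Fun JA M"
  note F = category_Fun[OF cat_A M]
  obtain Q q \<eta> where Q: "cofibrant ?F (projective_structure JA M S) Q"
    and q: "q \<in> hom ?F Q X" "q \<in> objectwise JA M (Weq S)"
    and K: "is_left_kan_extension JA JB M incl Q T \<eta>"
    using assms(1) unfolding is_homotopy_left_kan_extension_def by blast
  obtain Q' q' \<eta>' where Q': "cofibrant ?F (projective_structure JA M S) Q'"
    and q': "q' \<in> hom ?F Q' X" "q' \<in> objectwise JA M (Weq S)"
    and K': "is_left_kan_extension JA JB M incl Q' T' \<eta>'"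
    using assms(2) unfolding is_homotopy_left_kan_extension_def by blast
  obtain C a b where c: "is_coproduct ?F Q Q' C a b"
    using coproduct_diagram_exists[OF small_A hom_FunD(1)[OF q(1)] hom_FunD(1)[OF q'(1)]] .
  note a = is_coproductD(1)[OF c] and b = is_coproductD(2)[OF c]
  obtain f where f: "f \<in> hom ?F C X" "Comp ?F f a = q" "Comp ?F f b = q'"
    using coproduct_factor[OF c q(1) q'(1)] .
  obtain Z i p where i: "i \<in> hom ?F C Z" and p: "p \<in> hom ?F Z X" and pi: "Comp ?F p i = f"
    and ic: "i \<in> cofibrations JA" and pf: "p \<in> trivial_fibrations JA"
    by (rule factor_trivial_fibration[OF small_A f(1)])
  obtain L \<zeta> where L: "is_left_kan_extension JA JB M incl Z L \<zeta>"
    using left_kan_extension_exists[OF B AB hom_FunD(1)[OF p]] by metis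
  \<comment> \<open>Two-out-of-three: \<open>p\<close> is a weak equivalence, and so is
    \<open>p\<close> after \<open>i\<close> after \<open>a\<close>, which equals
    \<open>q\<close>.\<close>
  have "Comp ?F i a \<in> objectwise JA M (Weq S)"
    using objectwise_Weq_cancel_left[OF Comp_hom[OF F a i] p] pf Comp_assoc[OF F a i p] pi f(2) q(2)
    by simp
  then have "weakly_equivalent JB M S T L"
    using left_kan_extension_trivial_cofibration[OF K L Comp_hom[OF F a i]
        coproduct_injection_cofibration[OF c Q' i ic]] by simp
  moreover have "Comp ?F i b \<in> objectwise JA M (Weq S)"
    using objectwise_Weq_cancel_left[OF Comp_hom[OF F b i] p] pf Comp_assoc[OF F b i p] pi f(3) q'(2)
    by simp
  then have "weakly_equivalent JB M S T' L"
    using left_kan_extension_trivial_cofibration[OF K' L Comp_hom[OF F b i]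
        coproduct_injection_cofibration[OF is_coproduct_commute[OF c] Q i ic]] by simp
  ultimately show ?thesis using weakly_equivalent_trans weakly_equivalent_sym by blast
qed

text \<open>Induction along the zigzag. The quantifier over \<open>T'\<close> is needed because an
  extension of one functor in the zigzag is not yet one of the next.\<close>

lemma homotopy_left_kan_extension_invariant:
  assumes "weakly_equivalent JA M S X Y"
    and K: "is_homotopy_left_kan_extension JA JB M S incl X T"
    and K': "is_homotopy_left_kan_extension JA JB M S incl Y T'"
  shows "weakly_equivalent JB M S T T'"
proof -
  have "\<forall>T'. is_homotopy_left_kan_extension JA JB M S incl Y T' \<longrightarrow> weakly_equivalent JB M S T T'"
    using assms(1) unfolding weakly_equivalent_def[of JA]
  proof (induction rule: equivclp_induct)
    case base
    then show ?case using homotopy_left_kan_extension_unique[OF K] by blast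
  next
    case (step Y Z)
    show ?case
    proof (intro allI impI)
      fix T' assume T': "is_homotopy_left_kan_extension JA JB M S incl Z T'"
      from step(2) show "weakly_equivalent JB M S T T'"
      proof
        assume "\<exists>t\<in>hom (Fun JA M) Y Z. t \<in> objectwise JA M (Weq S)"
        then obtain t where t: "t \<in> hom (Fun JA M) Y Z" "t \<in> objectwise JA M (Weq S)" by blast
        \<comment> \<open>Extensions pass only in the direction of \<open>t\<close>, from
          \<open>Y\<close> to \<open>Z\<close>. Hence an auxiliary extension of \<open>Y\<close> is
          pushed forward and compared with \<open>T'\<close> over \<open>Z\<close>; for a reversed
          arrow \<open>T'\<close> itself is moved.\<close>
        obtain T1 where T1: "is_homotopy_left_kan_extension JA JB M S incl Y T1"
          by (rule homotopy_left_kan_extension_exists[OF hom_FunD(1)[OF t(1)]])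
        have "weakly_equivalent JB M S T1 T'"
          by (rule homotopy_left_kan_extension_unique[OF homotopy_left_kan_extension_Weq[OF t T1] T'])
        then show ?thesis using step(3) T1 weakly_equivalent_trans by blast
      next
        assume "\<exists>t\<in>hom (Fun JA M) Z Y. t \<in> objectwise JA M (Weq S)"
        then show ?thesis using step(3) homotopy_left_kan_extension_Weq T' by blast
      qed
    qed
  qed
  then show ?thesis using K' by blast
qed

text \<open>\<open>T\<close> is isomorphic to the pointwise extension \<open>L\<close> of the same
  \<open>Q\<close>, whose unit has identity components on \<open>A\<close>; so the restriction of
  \<open>T\<close> is linked to \<open>Q\<close> and by \<open>q\<close> to
  \<open>X\<close>.\<close>

lemma homotopy_left_kan_extension_restrict:
  assumes "is_homotopy_left_kan_extension JA JB M S incl X T"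
  shows "weakly_equivalent JA M S (precomp JA T incl) X"
proof -
  obtain Q q \<eta> where q: "q \<in> hom (Fun JA M) Q X" "q \<in> objectwise JA M (Weq S)"
    and K: "is_left_kan_extension JA JB M incl Q T \<eta>"
    using assms(1) unfolding is_homotopy_left_kan_extension_def by blast
  note Q = hom_FunD(1)[OF q(1)]
  obtain L \<zeta> where L: "is_left_kan_extension JA JB M incl Q L \<zeta>"
    and \<zeta>: "\<And>a. a \<in> A \<Longrightarrow> ncomp \<zeta> a = Ident M (fobj Q a)"
    using left_kan_extension_exists[OF B AB Q] by metis
  note D = left_kan_extensionD[OF cat_A cat_B M is_functor_incl L]
  obtain \<theta> \<theta>' where \<theta>: "\<theta> \<in> hom (Fun JB M) T L" "\<theta>' \<in> hom (Fun JB M) L T"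
    "Comp (Fun JB M) \<theta>' \<theta> = Ident (Fun JB M) T" "Comp (Fun JB M) \<theta> \<theta>' = Ident (Fun JB M) L"
    by (rule left_kan_extension_iso[OF cat_A cat_B M is_functor_incl K L])
  have "weakly_equivalent JB M S T L"
    using weakly_equivalentI[OF \<theta>(1) natural_iso_Weq[OF cat_B \<theta>]] .
  then have "weakly_equivalent JA M S (precomp JA T incl) (precomp JA L incl)"
    by (rule weakly_equivalent_precomp[OF cat_A is_functor_incl])
  moreover have "\<zeta> \<in> objectwise JA M (Weq S)"
    using \<zeta> Ident_Weq poset_functorD(1)[OF Q] by (simp add: objectwise_iff[OF D(2)])
  then have "weakly_equivalent JA M S Q (precomp JA L incl)"
    using D(2) by (rule weakly_equivalentI[rotated])
  ultimately show ?thesis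
    using weakly_equivalentI[OF q] weakly_equivalent_trans weakly_equivalent_sym by blast
qed

end

end

section \<open>The interleaving poset\<close>

text \<open>The points \<open>(x, False)\<close> and \<open>(x, True)\<close> carry the two interleaved functors. Over fixed points
  of the scaling the two points are isomorphic for the preorder below, so only \<open>(x, False)\<close> is kept
  and the relation becomes antisymmetric.\<close>

definition interleaving_rel :: "real \<Rightarrow> ((real ^ 'n) \<times> bool) rel" where
  "interleaving_rel \<epsilon> = {((x, a), (y, b)). if a = b then x \<le> y else scaling \<epsilon> x \<le> y}"

definition interleaving_points :: "real \<Rightarrow> (real ^ 'n) set \<Rightarrow> ((real ^ 'n) \<times> bool) set" where
  "interleaving_points \<epsilon> V = {(x, b). x \<in> V \<and> (b \<longrightarrow> scaling \<epsilon> x \<noteq> x)}"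

text \<open>Where \<open>scaling \<epsilon>\<close> fixes \<open>x\<close>, the omitted point
  \<open>(x, True)\<close> is represented by its isomorphic partner
  \<open>(x, False)\<close>.\<close>

definition strand :: "real \<Rightarrow> bool \<Rightarrow> real ^ 'n \<Rightarrow> (real ^ 'n) \<times> bool" where
  "strand \<epsilon> b x = (x, b \<and> scaling \<epsilon> x \<noteq> x)"

text \<open>This is the least \<open>y\<close> with \<open>p\<close> below \<open>(y, b)\<close>,
  which makes it left adjoint to \<open>strand \<epsilon> b\<close>.\<close>

definition collapse :: "real \<Rightarrow> bool \<Rightarrow> (real ^ 'n) \<times> bool \<Rightarrow> real ^ 'n" where
  "collapse \<epsilon> b p = (if snd p = b then fst p else scaling \<epsilon> (fst p))"

lemma interleaving_rel_iff [simp]: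
  "((x, a), (y, b)) \<in> interleaving_rel \<epsilon> \<longleftrightarrow> (if a = b then x \<le> y else scaling \<epsilon> x \<le> y)"
  by (simp add: interleaving_rel_def)

lemma scaling_mono: "x \<le> y \<Longrightarrow> scaling \<epsilon> x \<le> scaling \<epsilon> y"
  by (simp add: scaling_def less_eq_vec_def)

lemma scaling_orthant: "x \<in> orthant \<Longrightarrow> scaling \<epsilon> x \<in> orthant"
  by (simp add: scaling_def orthant_def)

text \<open>The factor \<open>exp \<epsilon>\<close> is nonzero, so the set of nonzero coordinates
  is unchanged. This makes \<open>orthant_le k\<close> an admissible choice of \<open>V\<close>
  below.\<close>

lemma scaling_orthant_le: "x \<in> orthant_le k \<Longrightarrow> scaling \<epsilon> x \<in> orthant_le k"
  by (simp add: orthant_le_def scaling_orthant) (simp add: scaling_def)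

lemma le_scaling:
  assumes "0 \<le> \<epsilon>" "x \<in> orthant"
  shows "x \<le> scaling \<epsilon> x"
proof -
  have "x $ i \<le> exp \<epsilon> * x $ i" for i
    using assms mult_right_mono[of 1 "exp \<epsilon>" "x $ i"] by (simp add: orthant_def)
  then show ?thesis by (simp add: scaling_def less_eq_vec_def)
qed

context
  fixes \<epsilon> :: real and V :: "(real ^ 'n::finite) set"
  assumes \<epsilon>: "0 \<le> \<epsilon>" and V: "V \<subseteq> orthant" and scaling_V: "\<And>x. x \<in> V \<Longrightarrow> scaling \<epsilon> x \<in> V"
begin

lemma refl_on_interleaving: "refl_on (V \<times> UNIV) (interleaving_rel \<epsilon>)"
  by (auto simp: refl_on_def)

text \<open>Crossing twice gives \<open>scaling \<epsilon> x \<le> y\<close> and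
  \<open>scaling \<epsilon> y \<le> z\<close>; since \<open>0 \<le> \<epsilon>\<close>, scaling
  moves points of the orthant upwards and \<open>x \<le> z\<close> follows.\<close>

lemma trans_on_interleaving: "trans_on (V \<times> UNIV) (interleaving_rel \<epsilon>)"
proof (rule trans_onI)
  fix p q s assume pqs: "p \<in> V \<times> (UNIV :: bool set)" "q \<in> V \<times> (UNIV :: bool set)"
    "s \<in> V \<times> (UNIV :: bool set)" "(p, q) \<in> interleaving_rel \<epsilon>" "(q, s) \<in> interleaving_rel \<epsilon>"
  obtain x a y b z c where [simp]: "p = (x, a)" "q = (y, b)" "s = (z, c)" by (metis surj_pair)
  have xV: "x \<in> orthant" "y \<in> orthant" using pqs V by auto
  note \<Lambda>x = le_scaling[OF \<epsilon> xV(1)] and \<Lambda>y = le_scaling[OF \<epsilon> xV(2)]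
    and \<Lambda>xy = scaling_mono[of x y \<epsilon>]
  show "(p, s) \<in> interleaving_rel \<epsilon>"
    using pqs(4,5) \<Lambda>x \<Lambda>y \<Lambda>xy by (cases a; cases b; cases c) (auto intro: order_trans)
qed

lemma interleaving_points_subset: "interleaving_points \<epsilon> V \<subseteq> V \<times> UNIV"
  by (auto simp: interleaving_points_def)

lemma antisym_on_interleaving: "antisym_on (interleaving_points \<epsilon> V) (interleaving_rel \<epsilon>)"
proof (rule antisym_onI)
  fix p q assume pq: "p \<in> interleaving_points \<epsilon> V" "q \<in> interleaving_points \<epsilon> V"
    "(p, q) \<in> interleaving_rel \<epsilon>" "(q, p) \<in> interleaving_rel \<epsilon>"
  obtain x a y b where [simp]: "p = (x, a)" "q = (y, b)" by (metis surj_pair)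
  have x: "x \<in> orthant" and y: "y \<in> orthant" using pq(1,2) V by (auto simp: interleaving_points_def)
  show "p = q"
  proof (cases "a = b")
    case True
    then show ?thesis using pq(3,4) by auto
  next
    case False
    \<comment> \<open>A cycle through both copies squeezes \<open>x\<close> and \<open>y\<close>
      into fixed points of the scaling, where no point labelled \<open>True\<close> is kept.\<close>
    then have "scaling \<epsilon> x \<le> y" "scaling \<epsilon> y \<le> x" using pq(3,4) by auto
    with le_scaling[OF \<epsilon> x] le_scaling[OF \<epsilon> y]
    have "x \<le> y" "y \<le> x" "scaling \<epsilon> x \<le> x" "scaling \<epsilon> y \<le> y" by (auto intro: order_trans)
    then have "scaling \<epsilon> x = x" "scaling \<epsilon> y = y"
      using le_scaling[OF \<epsilon> x] le_scaling[OF \<epsilon> y] by auto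
    then show ?thesis using pq(1,2) False by (auto simp: interleaving_points_def)
  qed
qed

lemma strand_in: "strand \<epsilon> b \<in> V \<rightarrow> interleaving_points \<epsilon> V"
  by (auto simp: strand_def interleaving_points_def)

lemma collapse_in: "collapse \<epsilon> b \<in> interleaving_points \<epsilon> V \<rightarrow> V"
  using scaling_V by (auto simp: collapse_def interleaving_points_def)

text \<open>On all labelled points the relation is a preorder in which
  \<open>strand \<epsilon> b y\<close> and \<open>(y, b)\<close> are isomorphic. Order questions
  about strands thus reduce to plain pairs.\<close>

lemma le_strand_iff:
  assumes "p \<in> V \<times> UNIV" "y \<in> V"
  shows "(p, strand \<epsilon> b y) \<in> interleaving_rel \<epsilon> \<longleftrightarrow> (p, (y, b)) \<in> interleaving_rel \<epsilon>"
    and "(strand \<epsilon> b y, p) \<in> interleaving_rel \<epsilon> \<longleftrightarrow> ((y, b), p) \<in> interleaving_rel \<epsilon>"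
proof -
  obtain x c where [simp]: "p = (x, c)" by (metis surj_pair)
  have "x \<in> orthant" using assms V by auto
  note \<Lambda>x = le_scaling[OF \<epsilon> this]
  have *: "scaling \<epsilon> x \<le> y \<longleftrightarrow> x \<le> y" if "scaling \<epsilon> y = y"
    using \<Lambda>x scaling_mono[of x y \<epsilon>] that by (auto intro: order_trans)
  show "(p, strand \<epsilon> b y) \<in> interleaving_rel \<epsilon> \<longleftrightarrow> (p, (y, b)) \<in> interleaving_rel \<epsilon>"
    using * by (auto simp: strand_def)
  show "(strand \<epsilon> b y, p) \<in> interleaving_rel \<epsilon> \<longleftrightarrow> ((y, b), p) \<in> interleaving_rel \<epsilon>"
    by (auto simp: strand_def)
qed

text \<open>Once the strand is replaced by \<open>(y, b)\<close>, the two cases of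
  \<open>interleaving_rel\<close> are the two cases of \<open>collapse\<close>.\<close>

lemma collapse_strand_adjoint:
  assumes "p \<in> interleaving_points \<epsilon> V" "y \<in> V"
  shows "(collapse \<epsilon> b p, y) \<in> {(x, y). x \<le> y} \<longleftrightarrow> (p, strand \<epsilon> b y) \<in> interleaving_rel \<epsilon>"
  using le_strand_iff(1)[of p y b] assms interleaving_points_subset
  by (cases p) (auto simp: collapse_def)

lemma strand_mono:
  assumes "x \<in> V" "y \<in> V" "x \<le> y"
  shows "(strand \<epsilon> b x, strand \<epsilon> b y) \<in> interleaving_rel \<epsilon>"
  using le_strand_iff(1)[of "strand \<epsilon> b x" y b] le_strand_iff(2)[of "(y, b)" x b] assms
  by (auto simp: strand_def split: if_splits)

text \<open>A diagram on the interleaving poset sends these relations to the two interleaving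
  transformations.\<close>

lemma strand_scaling:
  assumes "x \<in> V"
  shows "(strand \<epsilon> b x, strand \<epsilon> (\<not> b) (scaling \<epsilon> x)) \<in> interleaving_rel \<epsilon>"
  using le_strand_iff(1)[of "strand \<epsilon> b x" "scaling \<epsilon> x" "\<not> b"]
    le_strand_iff(2)[of "(scaling \<epsilon> x, \<not> b)" x b] assms scaling_V[OF assms]
  by (auto simp: strand_def split: if_splits)

lemma collapse_mono:
  assumes "p \<in> interleaving_points \<epsilon> V" "q \<in> interleaving_points \<epsilon> V" "(p, q) \<in> interleaving_rel \<epsilon>"
  shows "collapse \<epsilon> b p \<le> collapse \<epsilon> b q"
proof -
  obtain x a y c where [simp]: "p = (x, a)" "q = (y, c)" by (metis surj_pair)
  have "x \<in> orthant" "y \<in> orthant" using assms V by (auto simp: interleaving_points_def)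
  then show ?thesis
    using assms(3) le_scaling[OF \<epsilon>, of x] le_scaling[OF \<epsilon>, of y] scaling_mono[of x y \<epsilon>]
    by (cases a; cases b; cases c) (auto simp: collapse_def intro: order_trans)
qed

end

section \<open>Homotopy interleavings of homotopy left Kan extensions\<close>

context good_model
begin

text \<open>Restriction preserves objectwise trivial fibrations, so a map out of \<open>L\<close> is
  lifted by transposing it to \<open>Q\<close>, lifting there and factoring back through the
  unit.\<close>

lemma left_kan_extension_cofibrant:
  assumes A: "small_poset U A r" and B: "small_poset U B s"
    and u: "is_functor (poset_cat A r) (poset_cat B s) u"
    and K: "is_left_kan_extension (poset_cat A r) (poset_cat B s) M u Q L \<eta>"
    and Q: "cofibrant (Fun (poset_cat A r) M) (projective_structure (poset_cat A r) M S) Q"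
  shows "cofibrant (Fun (poset_cat B s) M) (projective_structure (poset_cat B s) M S) L"
proof -
  let ?A = "poset_cat A r" and ?B = "poset_cat B s"
  note cA = small_posetD(3)[OF A] and cB = small_posetD(3)[OF B]
  note D = left_kan_extensionD[OF cA cB M u K]
  note FA = category_Fun[OF cA M] and FB = category_Fun[OF cB M]
  show ?thesis
    unfolding cofibrant_iff[OF B]
  proof (intro conjI allI ballI impI D)
    fix E D' p v assume p: "p \<in> hom (Fun ?B M) E D'" "p \<in> trivial_fibrations ?B"
      and v: "v \<in> hom (Fun ?B M) L D'"
    note wp = whisker_hom[OF cA u p(1)]
    have "whisker ?A p u \<in> trivial_fibrations ?A"
      using whisker_objectwise[OF cA u p(1)] p(2) by blast
    then obtain h' where h': "h' \<in> hom (Fun ?A M) Q (precomp ?A E u)"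
      "Comp (Fun ?A M) (whisker ?A p u) h' = Comp (Fun ?A M) (whisker ?A v u) \<eta>"
      by (rule cofibrant_lift[OF A Q wp _ Comp_hom[OF FA D(2) whisker_hom[OF cA u v]]])
    obtain h where h: "h \<in> hom (Fun ?B M) L E" "Comp (Fun ?A M) (whisker ?A h u) \<eta> = h'"
      by (rule left_kan_extension_factor[OF cA cB M u K hom_FunD(1)[OF p(1)] h'(1)])
    have "Comp (Fun ?B M) p h = v"
      using left_kan_extension_unique[OF cA cB M u K Comp_hom[OF FB h(1) p(1)] v]
        whisker_Comp_unit[OF cA cB M u D(2) h(1) p(1)] h(2) h'(2) by simp
    then show "\<exists>h\<in>hom (Fun ?B M) L E. Comp (Fun ?B M) p h = v" using h(1) by blast
  qed
qed

text \<open>Points related in both directions are isomorphic, and a functor sends every loop in a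
  preorder to an identity. This allows \<open>strand \<epsilon> b\<close> to be replaced by the
  plain pairing with \<open>b\<close>.\<close>

lemma precomp_equivalent_mono:
  assumes A: "refl_on A r" "trans_on A r" and B: "refl_on B s" "trans_on B s"
    and h: "is_functor (poset_cat A r) (poset_cat B s) (mono_functor h)"
    and h': "is_functor (poset_cat A r) (poset_cat B s) (mono_functor h')"
    and le: "\<And>x. x \<in> A \<Longrightarrow> (h x, h' x) \<in> s" and ge: "\<And>x. x \<in> A \<Longrightarrow> (h' x, h x) \<in> s"
    and X: "X \<in> functors (poset_cat B s) M"
  shows "weakly_equivalent (poset_cat A r) M S (precomp (poset_cat A r) X (mono_functor h))
     (precomp (poset_cat A r) X (mono_functor h'))"
proof -
  let ?J = "poset_cat A r"
  note J = category_poset_cat[OF A]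
  note F = category_Fun[OF J M]
  note t = ntransf_mono_hom[OF M A B(2) h h' le X] and s = ntransf_mono_hom[OF M A B(2) h' h ge X]
  note Xh = precomp_functors[OF J h X] and Xh' = precomp_functors[OF J h' X]
  have hB: "h x \<in> B" "h' x \<in> B" "(h x, h x) \<in> s" "(h' x, h' x) \<in> s" if "x \<in> A" for x
    using is_functorD(1)[OF h, of x] is_functorD(1)[OF h', of x] that B(1) by (auto simp: refl_on_def)
  note c = poset_functorD(3,4)[OF X]
  show ?thesis
  proof (rule weakly_equivalentI[OF t natural_iso_Weq[OF J t s]])
    show "Comp (Fun ?J M) (ntransf ?J (precomp ?J X (mono_functor h')) (precomp ?J X (mono_functor h))
          (\<lambda>x. farr X (h' x, h x)))
        (ntransf ?J (precomp ?J X (mono_functor h)) (precomp ?J X (mono_functor h')) (\<lambda>x. farr X (h x, h' x)))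
      = Ident (Fun ?J M) (precomp ?J X (mono_functor h))"
      using Xh by (intro ntrans_eqI[OF Comp_hom[OF F t s] Ident_hom[OF F]]) (auto simp: hB le ge c)
    show "Comp (Fun ?J M) (ntransf ?J (precomp ?J X (mono_functor h)) (precomp ?J X (mono_functor h'))
          (\<lambda>x. farr X (h x, h' x)))
        (ntransf ?J (precomp ?J X (mono_functor h')) (precomp ?J X (mono_functor h)) (\<lambda>x. farr X (h' x, h x)))
      = Ident (Fun ?J M) (precomp ?J X (mono_functor h'))"
      using Xh' by (intro ntrans_eqI[OF Comp_hom[OF F s t] Ident_hom[OF F]]) (auto simp: hB le ge c)
  qed
qed

section \<open>The diagram that encodes an interleaving\<close>

context
  fixes F :: "bool \<Rightarrow> ('n::finite, 'o, 'a) orthant_functor"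
    and \<rho> :: "bool \<Rightarrow> (real ^ 'n, (real ^ 'n) \<times> (real ^ 'n), 'o, 'a) ntrans"
    and \<epsilon> :: real
  assumes \<epsilon>: "0 \<le> \<epsilon>"
    and F: "\<And>b. F b \<in> functors P_cat M"
    and \<rho>: "\<And>b. \<rho> b \<in> hom (Fun P_cat M) (F b) (precomp P_cat (F (\<not> b)) (mono_functor (scaling \<epsilon>)))"
    and \<rho>\<rho>: "\<And>b x. x \<in> orthant \<Longrightarrow>
       Comp M (ncomp (\<rho> (\<not> b)) (scaling \<epsilon> x)) (ncomp (\<rho> b) x) = farr (F b) (x, scaling \<epsilon> (scaling \<epsilon> x))"
begin

text \<open>A crossing applies \<open>\<rho>\<close> and then a structure map of the other functor.
  Fixed points keep both labels at this stage so that the two copies enter symmetrically.\<close>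

definition interleaving_diagram ::
    "((real ^ 'n) \<times> bool, ((real ^ 'n) \<times> bool) \<times> ((real ^ 'n) \<times> bool), 'o, 'a) ftor" where
  "interleaving_diagram = diagram (orthant \<times> UNIV) (interleaving_rel \<epsilon>) (\<lambda>(x, a). fobj (F a) x)
     (\<lambda>(x, a) (y, b). if a = b then farr (F a) (x, y)
        else Comp M (farr (F b) (scaling \<epsilon> x, y)) (ncomp (\<rho> a) x))"

text \<open>Composites are sorted by the steps that change copy. One crossing needs at most
  naturality of \<open>\<rho>\<close>; two crossings are exactly where the interleaving identities
  enter.\<close>

lemma interleaving_diagram_functors:
  "interleaving_diagram \<in> functors (poset_cat (orthant \<times> UNIV) (interleaving_rel \<epsilon>)) M"
proof -
  let ?\<Lambda> = "scaling \<epsilon> :: real ^ 'n \<Rightarrow> real ^ 'n"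
  note D = poset_functorD[OF F[unfolded order_cat_def]]
  have D2: "farr (F a) (x, y) \<in> hom M (fobj (F a) x) (fobj (F a) y)"
    if "x \<in> orthant" "y \<in> orthant" "x \<le> y" for a x y
    using D(2) that by simp
  have D4: "Comp M (farr (F a) (y, z)) (farr (F a) (x, y)) = farr (F a) (x, z)"
    if "x \<in> orthant" "y \<in> orthant" "z \<in> orthant" "x \<le> y" "y \<le> z" for a x y z
    using D(4) that by simp
  note so = scaling_orthant[of _ \<epsilon>] and ls = le_scaling[OF \<epsilon>] and sm = scaling_mono[of _ _ \<epsilon>]
  have ch: "ncomp (\<rho> a) x \<in> hom M (fobj (F a) x) (fobj (F (\<not> a)) (?\<Lambda> x))" if "x \<in> orthant" for a x
    using ntrans_posetD(1)[OF \<rho>[unfolded order_cat_def] that] that by simp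
  have cn: "Comp M (ncomp (\<rho> a) y) (farr (F a) (x, y)) = Comp M (farr (F (\<not> a)) (?\<Lambda> x, ?\<Lambda> y)) (ncomp (\<rho> a) x)"
    if "x \<in> orthant" "y \<in> orthant" "x \<le> y" for a x y
    using ntrans_posetD(2)[OF \<rho>[unfolded order_cat_def] that(1,2), of a] that by simp
  show ?thesis
    unfolding interleaving_diagram_def
  proof (rule diagram_functors)
    show "refl_on (orthant \<times> (UNIV :: bool set)) (interleaving_rel \<epsilon>)"
      by (auto simp: refl_on_def)
    show "trans_on (orthant \<times> (UNIV :: bool set)) (interleaving_rel \<epsilon>)"
      by (rule trans_on_interleaving[OF \<epsilon> order_refl scaling_orthant])
    show "(case p of (x, a) \<Rightarrow> fobj (F a) x) \<in> Obj M" if "p \<in> orthant \<times> UNIV" for p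
      using that D(1) by auto
    show "(case p of (x, a) \<Rightarrow> \<lambda>(y, b). if a = b then farr (F a) (x, y)
            else Comp M (farr (F b) (scaling \<epsilon> x, y)) (ncomp (\<rho> a) x)) q
        \<in> hom M (case p of (x, a) \<Rightarrow> fobj (F a) x) (case q of (x, a) \<Rightarrow> fobj (F a) x)"
      if "p \<in> orthant \<times> UNIV" "q \<in> orthant \<times> UNIV" "(p, q) \<in> interleaving_rel \<epsilon>" for p q
    proof -
      obtain x a y b where [simp]: "p = (x, a)" "q = (y, b)" by (metis surj_pair)
      have x: "x \<in> orthant" and y: "y \<in> orthant" using that by auto
      show ?thesis
      proof (cases "a = b")
        case True
        then show ?thesis using D2[OF x y] that(3) by simp
      next
        case False
        then have b: "b = (\<not> a)" by simp
        show ?thesis using that(3) Comp_hom[OF M ch[OF x] D2[OF so[OF x] y]] by (simp add: b)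
      qed
    qed
    show "(case p of (x, a) \<Rightarrow> \<lambda>(y, b). if a = b then farr (F a) (x, y)
            else Comp M (farr (F b) (scaling \<epsilon> x, y)) (ncomp (\<rho> a) x)) p
        = Ident M (case p of (x, a) \<Rightarrow> fobj (F a) x)"
      if "p \<in> orthant \<times> UNIV" for p
      using that D(3) by auto
    fix p q s :: "(real ^ 'n) \<times> bool"
    assume pqs: "p \<in> orthant \<times> UNIV" "q \<in> orthant \<times> UNIV" "s \<in> orthant \<times> UNIV"
      "(p, q) \<in> interleaving_rel \<epsilon>" "(q, s) \<in> interleaving_rel \<epsilon>"
    obtain x a y b z c where [simp]: "p = (x, a)" "q = (y, b)" "s = (z, c)" by (metis surj_pair)
    have x: "x \<in> orthant" and y: "y \<in> orthant" and z: "z \<in> orthant" using pqs by auto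
    note \<Lambda>x = so[OF x] and \<Lambda>y = so[OF y]
    consider (eq) "b = a" "c = a" | (last) "b = a" "c = (\<not> a)" | (first) "b = (\<not> a)" "c = (\<not> a)"
      | (twice) "b = (\<not> a)" "c = a" by (cases a; cases b; cases c) auto
    then show "(case p of (x, a) \<Rightarrow> \<lambda>(y, b). if a = b then farr (F a) (x, y)
            else Comp M (farr (F b) (scaling \<epsilon> x, y)) (ncomp (\<rho> a) x)) s
        = Comp M ((case q of (x, a) \<Rightarrow> \<lambda>(y, b). if a = b then farr (F a) (x, y)
              else Comp M (farr (F b) (scaling \<epsilon> x, y)) (ncomp (\<rho> a) x)) s)
            ((case p of (x, a) \<Rightarrow> \<lambda>(y, b). if a = b then farr (F a) (x, y)
              else Comp M (farr (F b) (scaling \<epsilon> x, y)) (ncomp (\<rho> a) x)) q)"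
    proof cases
      case eq
      then show ?thesis using pqs D4[OF x y z] by simp
    next
      case last
      then have le: "x \<le> y" "?\<Lambda> y \<le> z" using pqs by auto
      show ?thesis
        using last Comp_assoc[OF M D2[OF x y le(1)] ch[OF y] D2[OF \<Lambda>y z le(2)]] cn[OF x y le(1)]
          Comp_assoc[OF M ch[OF x] D2[OF \<Lambda>x \<Lambda>y sm[OF le(1)]] D2[OF \<Lambda>y z le(2)]]
          D4[OF \<Lambda>x \<Lambda>y z sm[OF le(1)] le(2)] by simp
    next
      case first
      then have le: "?\<Lambda> x \<le> y" "y \<le> z" using pqs by auto
      show ?thesis
        using first Comp_assoc[OF M ch[OF x] D2[OF \<Lambda>x y le(1)] D2[OF y z le(2)]]
          D4[OF \<Lambda>x y z le] by simp
    next
      case twice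
      then have le: "?\<Lambda> x \<le> y" "?\<Lambda> y \<le> z" using pqs by auto
      note \<Lambda>\<Lambda>x = so[OF \<Lambda>x]
      have ch': "ncomp (\<rho> (\<not> a)) t \<in> hom M (fobj (F (\<not> a)) t) (fobj (F a) (?\<Lambda> t))" if "t \<in> orthant" for t
        using ch[OF that, of "\<not> a"] by simp
      have cn': "Comp M (ncomp (\<rho> (\<not> a)) y) (farr (F (\<not> a)) (?\<Lambda> x, y))
          = Comp M (farr (F a) (?\<Lambda> (?\<Lambda> x), ?\<Lambda> y)) (ncomp (\<rho> (\<not> a)) (?\<Lambda> x))"
        using cn[OF \<Lambda>x y le(1), of "\<not> a"] by simp
      have x\<Lambda>\<Lambda>: "x \<le> ?\<Lambda> (?\<Lambda> x)" using ls[OF x] ls[OF \<Lambda>x] by (rule order_trans)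
      have \<Lambda>\<Lambda>z: "?\<Lambda> (?\<Lambda> x) \<le> z" using sm[OF le(1)] le(2) by (rule order_trans)
      \<comment> \<open>Naturality moves the second crossing from \<open>y\<close> back to
        \<open>?\<Lambda> x\<close>, next to the first one, where \<open>\<rho>\<rho>\<close> turns
        the pair into a structure map of \<open>F a\<close>.\<close>
      have "Comp M (Comp M (farr (F a) (?\<Lambda> y, z)) (ncomp (\<rho> (\<not> a)) y))
            (Comp M (farr (F (\<not> a)) (?\<Lambda> x, y)) (ncomp (\<rho> a) x))
          = Comp M (farr (F a) (?\<Lambda> y, z)) (Comp M (Comp M (farr (F a) (?\<Lambda> (?\<Lambda> x), ?\<Lambda> y))
              (ncomp (\<rho> (\<not> a)) (?\<Lambda> x))) (ncomp (\<rho> a) x))"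
        using Comp_assoc[OF M Comp_hom[OF M ch[OF x] D2[OF \<Lambda>x y le(1)]] ch'[OF y] D2[OF \<Lambda>y z le(2)]]
          Comp_assoc[OF M ch[OF x] D2[OF \<Lambda>x y le(1)] ch'[OF y]] cn' by simp
      also have "\<dots> = Comp M (farr (F a) (?\<Lambda> y, z)) (Comp M (farr (F a) (?\<Lambda> (?\<Lambda> x), ?\<Lambda> y))
              (farr (F a) (x, ?\<Lambda> (?\<Lambda> x))))"
        using Comp_assoc[OF M ch[OF x] ch'[OF \<Lambda>x] D2[OF \<Lambda>\<Lambda>x \<Lambda>y sm[OF le(1)]]] \<rho>\<rho>[OF x, of a] by simp
      also have "\<dots> = farr (F a) (x, z)"
        using D4[OF x \<Lambda>\<Lambda>x \<Lambda>y x\<Lambda>\<Lambda> sm[OF le(1)]] D4[OF x \<Lambda>y z _ le(2)]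
          order_trans[OF x\<Lambda>\<Lambda> sm[OF le(1)]] by simp
      finally show ?thesis using twice by simp
    qed
  qed
qed

lemma precomp_interleaving_diagram:
  assumes V: "V \<subseteq> orthant"
  shows "precomp (order_cat V) interleaving_diagram (mono_functor (\<lambda>x. (x, b)))
       = precomp (order_cat V) (F b) (mono_functor (\<lambda>x. x))"
  unfolding order_cat_def
  by (auto simp: precomp_def compose_def interleaving_diagram_def subsetD[OF V] intro!: restrict_ext)

end

text \<open>Only stability of \<open>V\<close> under scaling matters, and \<open>X\<close>,
  \<open>Y\<close> may differ from the restrictions of \<open>F\<close>, \<open>G\<close> by
  zigzags. Thus the strictly interleaved models behind a homotopy interleaving can serve as
  \<open>F\<close> and \<open>G\<close>, while \<open>T\<close> and \<open>T'\<close> extend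
  restrictions of other functors.\<close>

lemma homotopy_interleaved_left_kan_extension:
  fixes F G :: "('n::finite, 'o, 'a) orthant_functor" and \<iota> :: "real ^ 'n \<Rightarrow> 'u"
  assumes \<epsilon>: "0 \<le> \<epsilon>" and \<iota>: "inj \<iota>"
    and V: "V \<subseteq> orthant" and scaling_V: "\<And>x. x \<in> V \<Longrightarrow> scaling \<epsilon> x \<in> V"
    and F: "F \<in> functors P_cat M" and G: "G \<in> functors P_cat M" and FG: "interleaved M \<epsilon> F G"
    and FX: "weakly_equivalent (order_cat V) M S (precomp (order_cat V) F (mono_functor (\<lambda>x. x))) X"
    and GY: "weakly_equivalent (order_cat V) M S (precomp (order_cat V) G (mono_functor (\<lambda>x. x))) Y"
    and T: "is_homotopy_left_kan_extension (order_cat V) P_cat M S (mono_functor (\<lambda>x. x)) X T"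
    and T': "is_homotopy_left_kan_extension (order_cat V) P_cat M S (mono_functor (\<lambda>x. x)) Y T'"
  shows "homotopy_interleaved M S \<epsilon> T T'"
proof -
  define le :: "(real ^ 'n) rel" where "le = {(x, y). x \<le> y}"
  define P where "P = (orthant :: (real ^ 'n) set)"
  define R :: "((real ^ 'n) \<times> bool) rel" where "R = interleaving_rel \<epsilon>"
  define IP where "IP = interleaving_points \<epsilon> P"
  define IV where "IV = interleaving_points \<epsilon> V"
  let ?P = "poset_cat P le" and ?V = "poset_cat V le" and ?IP = "poset_cat IP R" and ?IV = "poset_cat IV R"
  let ?E = "poset_cat (P \<times> (UNIV :: bool set)) R"
  have oc: "order_cat orthant = ?P" "order_cat V = ?V"
    by (simp_all add: order_cat_def le_def P_def)
  have VP: "V \<subseteq> P" using V by (simp add: P_def)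
  have IVIP: "IV \<subseteq> IP" using VP by (auto simp: IV_def IP_def interleaving_points_def)
  have sP: "scaling \<epsilon> x \<in> P" if "x \<in> P" for x using that scaling_orthant by (simp add: P_def)
  have PP: "P \<subseteq> orthant" by (simp add: P_def)
  note iP = refl_on_interleaving[OF \<epsilon> PP sP, folded R_def] trans_on_interleaving[OF \<epsilon> PP sP, folded R_def]

  have smP: "small_poset U P le"
    using \<iota> by (auto simp: small_poset_def le_def refl_on_def trans_on_def antisym_on_def
        intro!: exI[of _ \<iota>] intro: inj_on_subset)
  obtain pr :: "'u \<times> 'u \<Rightarrow> 'u" where pr: "inj pr" by (rule inj_pair_exists)
  obtain \<beta> :: "bool \<Rightarrow> 'u" where \<beta>: "inj \<beta>" by (rule inj_bool_exists)
  have "inj (\<lambda>(x, b). pr (\<iota> x, \<beta> b))"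
    by (auto intro!: injI dest!: injD[OF pr] injD[OF \<iota>] injD[OF \<beta>])
  then have "\<exists>f :: (real ^ 'n) \<times> bool \<Rightarrow> 'u. inj_on f IP"
    by (blast intro: inj_on_subset)
  moreover have "refl_on IP R" "trans_on IP R"
    using iP interleaving_points_subset[OF \<epsilon> PP sP] trans_on_subset[OF iP(2)]
    unfolding IP_def refl_on_def by blast+
  moreover have "antisym_on IP R"
    using antisym_on_interleaving[OF \<epsilon> PP sP] by (simp add: IP_def R_def)
  ultimately have smIP: "small_poset U IP R" by (simp add: small_poset_def)
  note smV = small_poset_subset[OF smP VP] and smIV = small_poset_subset[OF smIP IVIP]
  note cP = small_posetD(3)[OF smP] and cV = small_posetD(3)[OF smV]
    and cIP = small_posetD(3)[OF smIP] and cIV = small_posetD(3)[OF smIV]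
  note cE = category_poset_cat[OF iP]
  note incl_VP = is_functor_incl[OF smP VP] and incl_IVIP = is_functor_incl[OF smIP IVIP]

  obtain \<phi> \<psi> where \<phi>: "\<phi> \<in> hom (Fun P_cat M) F (precomp P_cat G (mono_functor (scaling \<epsilon>)))"
    and \<psi>: "\<psi> \<in> hom (Fun P_cat M) G (precomp P_cat F (mono_functor (scaling \<epsilon>)))"
    and \<phi>\<psi>: "\<And>x. x \<in> orthant \<Longrightarrow>
        Comp M (ncomp \<psi> (scaling \<epsilon> x)) (ncomp \<phi> x) = farr F (x, scaling \<epsilon> (scaling \<epsilon> x)) \<and>
        Comp M (ncomp \<phi> (scaling \<epsilon> x)) (ncomp \<psi> x) = farr G (x, scaling \<epsilon> (scaling \<epsilon> x))"
    using FG unfolding interleaved_def by blast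
  \<comment> \<open>Indexing functors and transformations by \<open>bool\<close> makes
    \<open>\<not> b\<close> the other copy, so each argument is made once.\<close>
  define FF where "FF b = (if b then G else F)" for b
  define \<rho> where "\<rho> b = (if b then \<psi> else \<phi>)" for b
  have FF: "FF b \<in> functors P_cat M" for b using F G by (simp add: FF_def)
  have \<rho>: "\<rho> b \<in> hom (Fun P_cat M) (FF b) (precomp P_cat (FF (\<not> b)) (mono_functor (scaling \<epsilon>)))" for b
    using \<phi> \<psi> by (simp add: FF_def \<rho>_def)
  have \<rho>\<rho>: "Comp M (ncomp (\<rho> (\<not> b)) (scaling \<epsilon> x)) (ncomp (\<rho> b) x)
      = farr (FF b) (x, scaling \<epsilon> (scaling \<epsilon> x))" if "x \<in> orthant" for b x
    using \<phi>\<psi>[OF that] by (simp add: FF_def \<rho>_def)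
  obtain H where H: "H \<in> functors ?E M"
    and HF: "\<And>b. precomp ?V H (mono_functor (\<lambda>x. (x, b))) = precomp ?V (FF b) (mono_functor (\<lambda>x. x))"
    using interleaving_diagram_functors[where F = FF and \<rho> = \<rho>, OF \<epsilon> FF \<rho> \<rho>\<rho>] precomp_interleaving_diagram[where F = FF and \<rho> = \<rho>, OF \<epsilon> FF \<rho> \<rho>\<rho> V]
    unfolding oc R_def P_def le_def order_cat_def by metis
  have incl_IVE: "is_functor ?IV ?E (mono_functor (\<lambda>p. p))"
    using IVIP interleaving_points_subset[OF \<epsilon> PP sP]
    by (intro is_functor_mono_functor) (auto simp: IP_def)
  \<comment> \<open>\<open>?E\<close> is in general only a preorder; projective model structures
    become available on the antisymmetric part \<open>IV\<close>.\<close>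
  let ?H = "precomp ?IV H (mono_functor (\<lambda>p. p))"
  note HIV = precomp_functors[OF cIV incl_IVE H]
  obtain Q q where Q: "cofibrant (Fun ?IV M) (projective_structure ?IV M S) Q"
    and q: "q \<in> hom (Fun ?IV M) Q ?H" "q \<in> objectwise ?IV M (Weq S)"
    by (rule cofibrant_replacement_exists[OF smIV HIV])
  note QF = hom_FunD(1)[OF q(1)]
  obtain L \<eta> where L: "is_left_kan_extension ?IV ?IP M (mono_functor (\<lambda>p. p)) Q L \<eta>"
    using left_kan_extension_exists[OF smIP IVIP QF] by metis
  note LF = left_kan_extensionD(1)[OF cIV cIP M incl_IVIP L]

  have s_VIV: "is_functor ?V ?IV (mono_functor (strand \<epsilon> b))" for b
    using strand_in[OF \<epsilon> V scaling_V] strand_mono[OF \<epsilon> V scaling_V]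
    by (intro is_functor_mono_functor) (auto simp: IV_def R_def le_def)
  have s_PIP: "is_functor ?P ?IP (mono_functor (strand \<epsilon> b))" for b
    using strand_in[OF \<epsilon> PP sP] strand_mono[OF \<epsilon> PP sP]
    by (intro is_functor_mono_functor) (auto simp: IP_def R_def le_def)
  have c_IVV: "is_functor ?IV ?V (mono_functor (collapse \<epsilon> b))" for b
    using collapse_in[OF \<epsilon> V scaling_V] collapse_mono[OF \<epsilon> V scaling_V]
    by (intro is_functor_mono_functor) (auto simp: IV_def R_def le_def)
  have c_IPP: "is_functor ?IP ?P (mono_functor (collapse \<epsilon> b))" for b
    using collapse_in[OF \<epsilon> PP sP] collapse_mono[OF \<epsilon> PP sP]
    by (intro is_functor_mono_functor) (auto simp: IP_def R_def le_def)
  have c_IVP: "is_functor ?IV ?P (mono_functor (collapse \<epsilon> b))" for b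
    using collapse_in[OF \<epsilon> V scaling_V] collapse_mono[OF \<epsilon> V scaling_V] VP
    by (intro is_functor_mono_functor) (fastforce simp: IV_def R_def le_def)+
  let ?L = "\<lambda>b. precomp ?P L (mono_functor (strand \<epsilon> b))"
  \<comment> \<open>Collapsing after the inclusion of \<open>IV\<close> in \<open>IP\<close> agrees
    with including \<open>V\<close> in \<open>P\<close> after collapsing. Along the one route
    \<open>Q\<close> extends to \<open>L\<close> and then to \<open>?L b\<close>; cancelling the
    collapse onto \<open>V\<close> from the other exhibits \<open>?L b\<close> as an extension along
    the inclusion of \<open>V\<close>.\<close>
  have hoL: "is_homotopy_left_kan_extension ?V ?P M S (mono_functor (\<lambda>x. x))
      (precomp ?V ?H (mono_functor (strand \<epsilon> b))) (?L b)" for b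
  proof -
    obtain \<zeta> where \<zeta>: "is_left_kan_extension ?IP ?P M (mono_functor (collapse \<epsilon> b)) L (?L b) \<zeta>"
      using left_kan_extension_Galois[OF M small_posetD(1,2)[OF smIP] small_posetD(1,2)[OF smP]
          collapse_in[OF \<epsilon> PP sP, folded IP_def] strand_in[OF \<epsilon> PP sP, folded IP_def]
          collapse_strand_adjoint[OF \<epsilon> PP sP, folded IP_def R_def le_def] LF] by metis
    obtain \<xi> where \<xi>: "is_left_kan_extension ?IV ?V M (mono_functor (collapse \<epsilon> b)) Q
        (precomp ?V Q (mono_functor (strand \<epsilon> b))) \<xi>"
      using left_kan_extension_Galois[OF M small_posetD(1,2)[OF smIV] small_posetD(1,2)[OF smV]
          collapse_in[OF \<epsilon> V scaling_V, folded IV_def] strand_in[OF \<epsilon> V scaling_V, folded IV_def]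
          collapse_strand_adjoint[OF \<epsilon> V scaling_V, folded IV_def R_def le_def] QF] by metis
    have Lb: "is_left_kan_extension ?IV ?P M (mono_functor (collapse \<epsilon> b)) Q (?L b)
        (Comp (Fun ?IV M) (whisker ?IV \<zeta> (mono_functor (\<lambda>p. p))) \<eta>)"
      by (rule left_kan_extension_trans[OF cIV cIP cP M incl_IVIP c_IPP c_IVP _ _ L \<zeta>]) auto
    obtain \<theta> where "is_left_kan_extension ?V ?P M (mono_functor (\<lambda>x. x))
        (precomp ?V Q (mono_functor (strand \<epsilon> b))) (?L b) \<theta>"
      by (rule left_kan_extension_cancel[OF cIV cV cP M c_IVV incl_VP c_IVP _ _ \<xi> Lb]) auto
    \<comment> \<open>The strand of \<open>Q\<close> is its extension along the collapse onto
      \<open>V\<close>, hence cofibrant; the strand of \<open>q\<close> makes it a replacement of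
      the strand of \<open>?H\<close>.\<close>
    moreover have "cofibrant (Fun ?V M) (projective_structure ?V M S)
        (precomp ?V Q (mono_functor (strand \<epsilon> b)))"
      by (rule left_kan_extension_cofibrant[OF smIV smV c_IVV \<xi> Q])
    ultimately show ?thesis
      using whisker_hom[OF cV s_VIV q(1)] whisker_objectwise[OF cV s_VIV q]
      unfolding is_homotopy_left_kan_extension_def by blast
  qed
  \<comment> \<open>Strand and plain pairing agree up to isomorphism in \<open>?E\<close>, and on
    plain pairs \<open>H\<close> restricts to \<open>FF b\<close> exactly.\<close>
  have HFF: "weakly_equivalent ?V M S (precomp ?V ?H (mono_functor (strand \<epsilon> b)))
      (precomp ?V (FF b) (mono_functor (\<lambda>x. x)))" for b
  proof -
    have s_VE: "is_functor ?V ?E (mono_functor (strand \<epsilon> b))"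
      using VP strand_mono[OF \<epsilon> V scaling_V]
      by (intro is_functor_mono_functor) (auto simp: R_def le_def strand_def)
    have pair: "is_functor ?V ?E (mono_functor (\<lambda>x. (x, b)))"
      using VP by (intro is_functor_mono_functor) (auto simp: R_def le_def)
    have sx: "(strand \<epsilon> b x, (x, b)) \<in> R" "((x, b), strand \<epsilon> b x) \<in> R" if "x \<in> V" for x
      using le_strand_iff[OF \<epsilon> PP sP, of "(x, b)" x b] that VP by (auto simp: R_def)
    have "precomp ?V ?H (mono_functor (strand \<epsilon> b)) = precomp ?V H (mono_functor (strand \<epsilon> b))"
      by (rule precomp_comp[OF cV cIV cE M s_VIV incl_IVE s_VE]) auto
    then show ?thesis
      using precomp_equivalent_mono[OF small_posetD(1,2)[OF smV] iP s_VE pair sx H] HF by simp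
  qed
  have eqT: "weakly_equivalent ?P M S (?L False) T"
    using homotopy_left_kan_extension_invariant[OF smP VP _ hoL T[unfolded oc]]
      weakly_equivalent_trans[OF HFF[of False]] FX[unfolded oc] by (simp add: FF_def)
  have eqT': "weakly_equivalent ?P M S (?L True) T'"
    using homotopy_left_kan_extension_invariant[OF smP VP _ hoL T'[unfolded oc]]
      weakly_equivalent_trans[OF HFF[of True]] GY[unfolded oc] by (simp add: FF_def)

  have \<Lambda>: "is_functor ?P ?P (mono_functor (scaling \<epsilon>))"
    using sP scaling_mono by (intro is_functor_mono_functor) (auto simp: le_def)
  have sIP: "strand \<epsilon> b x \<in> IP" if "x \<in> P" for b x
    using strand_in[OF \<epsilon> PP sP] that by (auto simp: IP_def)
  have up: "(strand \<epsilon> b x, strand \<epsilon> (\<not> b) (scaling \<epsilon> x)) \<in> R" if "x \<in> P" for b x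
    using strand_scaling[OF \<epsilon> PP sP that] by (simp add: R_def)
  have s\<Lambda>: "is_functor ?P ?IP (mono_functor (\<lambda>x. strand \<epsilon> b (scaling \<epsilon> x)))" for b
    using sIP sP strand_mono[OF \<epsilon> PP sP sP sP scaling_mono]
    by (intro is_functor_mono_functor) (auto simp: R_def le_def)
  have L\<Lambda>: "precomp ?P (?L b) (mono_functor (scaling \<epsilon>)) = precomp ?P L (mono_functor (\<lambda>x. strand \<epsilon> b (scaling \<epsilon> x)))" for b
    by (rule precomp_comp[OF cP cP cIP M \<Lambda> s_PIP s\<Lambda>]) auto
  \<comment> \<open>The interleaving maps are the values of the one diagram \<open>L\<close> on
    arrows crossing between the strands. Both identities are therefore functoriality of
    \<open>L\<close> and hold strictly.\<close>
  define \<tau> where "\<tau> b = ntransf ?P (?L b) (precomp ?P (?L (\<not> b)) (mono_functor (scaling \<epsilon>)))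
      (\<lambda>x. farr L (strand \<epsilon> b x, strand \<epsilon> (\<not> b) (scaling \<epsilon> x)))" for b
  have \<tau>: "\<tau> b \<in> hom (Fun ?P M) (?L b) (precomp ?P (?L (\<not> b)) (mono_functor (scaling \<epsilon>)))" for b
    unfolding \<tau>_def L\<Lambda>
    by (rule ntransf_mono_hom[OF M small_posetD(1,2)[OF smP] small_posetD(2)[OF smIP] s_PIP s\<Lambda> up LF])
  have \<tau>\<tau>: "Comp M (ncomp (\<tau> (\<not> b)) (scaling \<epsilon> x)) (ncomp (\<tau> b) x)
      = farr (?L b) (x, scaling \<epsilon> (scaling \<epsilon> x))" if x: "x \<in> P" for b x
  proof -
    have "x \<le> scaling \<epsilon> (scaling \<epsilon> x)"
      using le_scaling[OF \<epsilon>, of x] le_scaling[OF \<epsilon>, of "scaling \<epsilon> x"] x sP[OF x]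
      by (auto simp: P_def intro: order_trans)
    then show ?thesis
      using poset_functorD(4)[OF LF sIP[OF x] sIP[OF sP[OF x]] sIP[OF sP[OF sP[OF x]]] up[OF x, of b]
          up[OF sP[OF x], of "\<not> b"]] x sP[OF x] sP[OF sP[OF x]]
      by (simp add: \<tau>_def le_def)
  qed
  have "interleaved M \<epsilon> (?L False) (?L True)"
    unfolding interleaved_def oc
    using \<tau>[of False] \<tau>[of True] \<tau>\<tau>[of _ False] \<tau>\<tau>[of _ True]
    by (intro bexI[of _ "\<tau> False"] bexI[of _ "\<tau> True"]) (auto simp: P_def)
  then show ?thesis
    using eqT eqT' precomp_functors[OF cP s_PIP LF] unfolding homotopy_interleaved_def oc by auto
qed

end

section \<open>The inequalities for the codegree approximations\<close>

lemma orthant_le_subset: "orthant_le k \<subseteq> orthant"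
  by (auto simp: orthant_le_def)

lemma orthant_le_mono: "k \<le> l \<Longrightarrow> orthant_le k \<subseteq> orthant_le l"
  by (auto simp: orthant_le_def)

text \<open>Constant vectors embed the reals into \<open>real ^ 'n\<close>, and so into
  \<open>'u\<close>.\<close>

lemma infinite_of_inj_vec:
  fixes \<iota> :: "real ^ 'n \<Rightarrow> 'u"
  assumes "inj \<iota>"
  shows "infinite (UNIV :: 'u set)"
proof
  assume "finite (UNIV :: 'u set)"
  moreover have "inj (\<lambda>c :: real. \<iota> (\<chi> i. c))"
    by (rule injI, drule injD[OF assms]) (simp add: vec_eq_iff)
  ultimately have "finite (UNIV :: real set)"
    by (metis finite_imageD finite_subset subset_UNIV)
  then show False by (simp add: infinite_UNIV_char_0)
qed

theorem corollary6p7: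
  fixes M :: "('o, 'a) cat" and S :: "'a model_structure"
    and F G :: "('n::finite, 'o, 'a) orthant_functor"
    and \<iota> :: "real ^ 'n \<Rightarrow> 'u" and k :: nat
  assumes small: "inj \<iota>"
    and good: "good_model_category TYPE('u) M S"
    and F: "F \<in> Obj (Fun P_cat M)"
    and G: "G \<in> Obj (Fun P_cat M)"
    and k: "k > 0"
  shows "interleaving_distance M S (codegree_approx M S k F) (codegree_approx M S k G)
           \<le> interleaving_distance M S F G
         \<and> interleaving_distance M S (codegree_approx M S k F) (codegree_approx M S k G)
           \<le> interleaving_distance M S (codegree_approx M S (k + 1) F) (codegree_approx M S (k + 1) G)"
proof -
  interpret good_model "TYPE('u)" M S
    using good infinite_of_inj_vec[OF small] by unfold_locales
  let ?u = "mono_functor (\<lambda>v :: real ^ 'n. v)"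
  have smP: "small_poset TYPE('u) (orthant :: (real ^ 'n) set) {(x, y). x \<le> y}"
    using small by (auto simp: small_poset_def refl_on_def trans_on_def antisym_on_def
        intro!: exI[of _ \<iota>] intro: inj_on_subset)
  note incl = is_functor_incl[OF smP orthant_le_subset, folded order_cat_def]
  note cat_le = small_posetD(3)[OF small_poset_subset[OF smP orthant_le_subset], folded order_cat_def]
  have T: "is_homotopy_left_kan_extension (P_le_cat j) P_cat M S ?u (precomp (P_le_cat j) X ?u)
      (codegree_approx M S j X)" if X: "X \<in> functors P_cat M" for X :: "('n, 'o, 'a) orthant_functor" and j
  proof -
    obtain T where "is_homotopy_left_kan_extension (P_le_cat j) P_cat M S ?u (precomp (P_le_cat j) X ?u) T"
      by (rule homotopy_left_kan_extension_exists[OF smP orthant_le_subset, folded order_cat_def,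
            OF precomp_functors[OF cat_le incl X]])
    then show ?thesis unfolding codegree_approx_def by (rule someI)
  qed
  \<comment> \<open>Both inequalities in one form: \<open>F'\<close> and \<open>G'\<close> need to
    agree with \<open>F\<close> and \<open>G\<close> only over \<open>orthant_le k\<close>, up to
    zigzags. The pairs used are \<open>F\<close>, \<open>G\<close> themselves and their
    approximations at \<open>k + 1\<close>.\<close>
  have step: "homotopy_interleaved M S \<epsilon> (codegree_approx M S k F) (codegree_approx M S k G)"
    if \<epsilon>: "0 \<le> \<epsilon>" and hi: "homotopy_interleaved M S \<epsilon> F' G'"
      and F': "weakly_equivalent (P_le_cat k) M S (precomp (P_le_cat k) F' ?u) (precomp (P_le_cat k) F ?u)"
      and G': "weakly_equivalent (P_le_cat k) M S (precomp (P_le_cat k) G' ?u) (precomp (P_le_cat k) G ?u)"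
    for \<epsilon> F' G'
  proof -
    obtain F'' G'' where *: "F'' \<in> functors P_cat M" "G'' \<in> functors P_cat M"
      "weakly_equivalent P_cat M S F'' F'" "weakly_equivalent P_cat M S G'' G'" "interleaved M \<epsilon> F'' G''"
      using hi unfolding homotopy_interleaved_def by auto
    show ?thesis
      using F G F' G' weakly_equivalent_trans
      by (intro homotopy_interleaved_left_kan_extension[OF \<epsilon> small orthant_le_subset scaling_orthant_le *(1,2,5)
            weakly_equivalent_trans[OF weakly_equivalent_precomp[OF cat_le incl *(3)] F']
            weakly_equivalent_trans[OF weakly_equivalent_precomp[OF cat_le incl *(4)] G'] T T]) auto
  qed
  have restrict: "weakly_equivalent (P_le_cat k) M S
      (precomp (P_le_cat k) (codegree_approx M S (k + 1) X) ?u) (precomp (P_le_cat k) X ?u)"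
    if X: "X \<in> functors P_cat M" for X :: "('n, 'o, 'a) orthant_functor"
  proof -
    have kk: "is_functor (P_le_cat k) (P_le_cat (k + 1)) ?u"
      unfolding order_cat_def using orthant_le_mono[of k "k + 1"]
      by (intro is_functor_mono_functor) auto
    have "precomp (P_le_cat k) (precomp (P_le_cat (k + 1)) Y ?u) ?u = precomp (P_le_cat k) Y ?u"
      for Y :: "('n, 'o, 'a) orthant_functor"
      by (rule precomp_comp[OF cat_le cat_le small_posetD(3)[OF smP, folded order_cat_def] M kk incl incl]) auto
    then show ?thesis
      using weakly_equivalent_precomp[OF cat_le kk homotopy_left_kan_extension_restrict[OF smP orthant_le_subset,
            folded order_cat_def, OF T[OF X]]] by simp
  qed
  \<comment> \<open>Each \<open>\<epsilon>\<close> admissible on the right is admissible on the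
    left, so the left infimum runs over a superset.\<close>
  have "interleaving_distance M S (codegree_approx M S k F) (codegree_approx M S k G)
      \<le> interleaving_distance M S F G"
    unfolding interleaving_distance_def
    by (intro INF_superset_mono) (use step[OF _ _ weakly_equivalent_refl weakly_equivalent_refl] in auto)
  moreover have "interleaving_distance M S (codegree_approx M S k F) (codegree_approx M S k G)
      \<le> interleaving_distance M S (codegree_approx M S (k + 1) F) (codegree_approx M S (k + 1) G)"
    unfolding interleaving_distance_def
    by (intro INF_superset_mono) (use step[OF _ _ restrict restrict] F G in auto)
  ultimately show ?thesis by blast
qed

end
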